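(* Let $J$ be a countably infinite index set. Let $G$ be a nuclear Fréchet space satisfying $(\underline{\mathrm{DN}})$. Let $(x'_j)_{j\in J}\subseteq G'$ be an Eidelheit family such that $$\ker Q=\{x\in G\mid \langle x'_j,x\rangle=0\ \ \forall j\in J\}$$ satisfies $(\Omega)$. Let $E$ be a locally complete lcHs with a fundamental sequence of bounded sets. Then the associated $E$-valued family of $(x'_j)_{j\in J}$ is Eidelheit if and only if $E$ satisfies $(\mathrm{A})$.
   Context: All vector spaces are over $\mathbb{C}$; lcHs means locally convex Hausdorff space; $L(X,Y)$ is the space of continuous linear maps. A lcHs $E$ is locally complete if every bounded subset is contained in a Banach disk, i.e. an absolutely convex bounded set $B$ such that its linear span $E_B$, normed by the Minkowski functional of $B$, is complete. A fundamental sequence of bounded sets is a sequence of bounded sets $(B_N)_{N\in\mathbb{N}}$ such that every bounded set is contained in some $B_N$; it may be taken increasing. $\varepsilon$-product: $X\varepsilon Y=L(X'_c,Y)$, where $X'_c$ is the dual $X'$ with the topology of uniform convergence on absolutely convex compact subsets of $X$. For $T\in L(X_1,X_2)$, $S\in L(Y_1,Y_2)$, $T\varepsilon S:X_1\varepsilon Y_1\to X_2\varepsilon Y_2$ is $R\mapsto S\circ R\circ T^t$. One identifies $\mathbb{C}\,\varepsilon E=E$. For a Fréchet space $G$, a family $(x'_j)_{j\in J}\subseteq G'$ is Eidelheit if for every $(a_j)_j\in\mathbb{C}^J$ there is $x\in G$ with $\langle x'_j,x\rangle=a_j$ for all $j\in J$, i.e. if $Q:G\to\mathbb{C}^J$,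 $x\mapsto(\langle x'_j,x\rangle)_j$ is surjective. The associated $E$-valued family is $(x'_j\varepsilon\operatorname{id}_E)_{j\in J}\subseteq L(G\varepsilon E,E)$ (that is, $R\in G\varepsilon E$ is mapped to $R(x'_j)$). It is Eidelheit if for every $(e_j)_j\in E^J$ there is $x\in G\varepsilon E$ with $(x'_j\varepsilon\operatorname{id}_E)(x)=e_j$ for all $j\in J$. $(\underline{\mathrm{DN}})$ for a Fréchet space with increasing fundamental sequence of seminorms $(\|\cdot\|_n)_n$ (choice immaterial): $\exists n\ \forall m\ge n\ \exists\theta\in(0,1)\ \exists k\ge m,\ C>0:\ \|x\|_m\le C\|x\|_n^{\theta}\|x\|_k^{1-\theta}$ for all $x$. $(\Omega)$ for a Fréchet space $F$: with $(U_n)_n$ a decreasing fundamental sequence of absolutely convex zero neighbourhoods (choice immaterial) and $Z_n=(F')_{U_n^\circ}$ the span of the polar $U_n^\circ$ normed by its Minkowski functional, $\forall n\ \exists m\ge n\ \forall k\ge m\ \exists\theta\in(0,1),\ C>0:\ \|z\|_{Z_m}\le C\|z\|_{Z_n}^{\theta}\|z\|_{Z_k}^{1-\theta}$ for all $z\in Z_n$. $(\mathrm{A})$ for $E$, with $(B_N)_N$ an increasing fundamental sequence of bounded sets (choice immaterial): $\exists N\ \forall M\ge N\ \forall\nu>0\ \exists K\ge M,\ C>0\ \forall r>0:\ B_M\subseteq rB_K+\frac{C}{r^{\nu}}B_N$. *)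

theory Defs
  imports "HOL-Analysis.Analysis" "HOL-Library.Function_Algebras"
begin

text \<open>A topological vector space over the complex numbers is a pair \<open>s T\<close> of a scalar multiplication
  \<open>s\<close> on a type of class \<open>ab_group_add\<close> and a topology \<open>T\<close> whose carrier \<open>topspace T\<close> is a linear
  subspace of that type. A subspace \<open>F\<close> with the induced topology is then \<open>s (subtopology T F)\<close>,
  and spaces of functionals live in a function type with the pointwise operations.\<close>

definition zero_nhd :: "'a::ab_group_add topology \<Rightarrow> 'a set \<Rightarrow> bool" where
  "zero_nhd T U \<longleftrightarrow> U \<subseteq> topspace T \<and> (\<exists>W. openin T W \<and> 0 \<in> W \<and> W \<subseteq> U)"

definition abs_convex :: "(complex \<Rightarrow> 'a::ab_group_add \<Rightarrow> 'a) \<Rightarrow> 'a set \<Rightarrow> bool" where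
  "abs_convex s B \<longleftrightarrow> B \<noteq> {} \<and>
     (\<forall>x\<in>B. \<forall>y\<in>B. \<forall>a b. norm a + norm b \<le> 1 \<longrightarrow> s a x + s b y \<in> B)"

definition lcHs :: "(complex \<Rightarrow> 'a::ab_group_add \<Rightarrow> 'a) \<Rightarrow> 'a topology \<Rightarrow> bool" where
  "lcHs s T \<longleftrightarrow> vector_space s \<and> module.subspace s (topspace T) \<and>
     continuous_map (prod_topology T T) T (\<lambda>(x, y). x + y) \<and>
     continuous_map (prod_topology euclidean T) T (\<lambda>(c, x). s c x) \<and>
     Hausdorff_space T \<and>
     (\<forall>U. zero_nhd T U \<longrightarrow> (\<exists>V. zero_nhd T V \<and> abs_convex s V \<and> V \<subseteq> U))"

definition tvs_Cauchy :: "'a::ab_group_add topology \<Rightarrow> (nat \<Rightarrow> 'a) \<Rightarrow> bool" where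
  "tvs_Cauchy T x \<longleftrightarrow> (\<forall>n. x n \<in> topspace T) \<and>
     (\<forall>U. zero_nhd T U \<longrightarrow> (\<exists>n0. \<forall>m\<ge>n0. \<forall>n\<ge>n0. x m - x n \<in> U))"

text \<open>For metrizable spaces, completeness and sequential completeness agree.\<close>

definition frechet :: "(complex \<Rightarrow> 'a::ab_group_add \<Rightarrow> 'a) \<Rightarrow> 'a topology \<Rightarrow> bool" where
  "frechet s T \<longleftrightarrow> lcHs s T \<and> metrizable_space T \<and>
     (\<forall>x. tvs_Cauchy T x \<longrightarrow> (\<exists>l. limitin T x l sequentially))"

text \<open>Continuous linear maps are total functions on the ambient type; requiring the value \<open>0\<close> outside
  the carrier makes equality of functions the same as equality of maps.\<close>

definition cont_linear ::
  "(complex \<Rightarrow> 'a::ab_group_add \<Rightarrow> 'a) \<Rightarrow> 'a topology \<Rightarrow>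
   (complex \<Rightarrow> 'b::ab_group_add \<Rightarrow> 'b) \<Rightarrow> 'b topology \<Rightarrow> ('a \<Rightarrow> 'b) set" where
  "cont_linear s T s' T' = {f. continuous_map T T' f \<and>
     (\<forall>x\<in>topspace T. \<forall>y\<in>topspace T. f (x + y) = f x + f y) \<and>
     (\<forall>c. \<forall>x\<in>topspace T. f (s c x) = s' c (f x)) \<and>
     (\<forall>x. x \<notin> topspace T \<longrightarrow> f x = 0)}"

definition dual :: "(complex \<Rightarrow> 'a::ab_group_add \<Rightarrow> 'a) \<Rightarrow> 'a topology \<Rightarrow> ('a \<Rightarrow> complex) set" where
  "dual s T = cont_linear s T (*) euclidean"

definition fun_scale :: "complex \<Rightarrow> ('a \<Rightarrow> complex) \<Rightarrow> ('a \<Rightarrow> complex)" where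
  "fun_scale c f = (\<lambda>x. c * f x)"

lemma vector_space_fun_scale: "vector_space fun_scale"
  by unfold_locales (auto simp: fun_scale_def fun_eq_iff algebra_simps)

definition polar ::
  "(complex \<Rightarrow> 'a::ab_group_add \<Rightarrow> 'a) \<Rightarrow> 'a topology \<Rightarrow> 'a set \<Rightarrow> ('a \<Rightarrow> complex) set" where
  "polar s T U = {f \<in> dual s T. \<forall>x\<in>U. norm (f x) \<le> 1}"

definition minkowski :: "(complex \<Rightarrow> 'a::ab_group_add \<Rightarrow> 'a) \<Rightarrow> 'a set \<Rightarrow> 'a \<Rightarrow> real" where
  "minkowski s B x = Inf {t. 0 < t \<and> x \<in> s (of_real t) ` B}"

text \<open>The dual with the topology of uniform convergence on the absolutely convex compact sets.\<close>

definition dual_c ::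
  "(complex \<Rightarrow> 'a::ab_group_add \<Rightarrow> 'a) \<Rightarrow> 'a topology \<Rightarrow> ('a \<Rightarrow> complex) topology" where
  "dual_c s T = topology_generated_by
     {{g \<in> dual s T. \<forall>x\<in>K. norm (g x - f x) < \<epsilon>} | f K \<epsilon>.
        f \<in> dual s T \<and> compactin T K \<and> abs_convex s K \<and> (0::real) < \<epsilon>}"

definition eps_product ::
  "(complex \<Rightarrow> 'a::ab_group_add \<Rightarrow> 'a) \<Rightarrow> 'a topology \<Rightarrow>
   (complex \<Rightarrow> 'b::ab_group_add \<Rightarrow> 'b) \<Rightarrow> 'b topology \<Rightarrow> (('a \<Rightarrow> complex) \<Rightarrow> 'b) set" where
  "eps_product s T s' T' = cont_linear fun_scale (dual_c s T) s' T'"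

definition tvs_bounded :: "(complex \<Rightarrow> 'a::ab_group_add \<Rightarrow> 'a) \<Rightarrow> 'a topology \<Rightarrow> 'a set \<Rightarrow> bool" where
  "tvs_bounded s T B \<longleftrightarrow> B \<subseteq> topspace T \<and>
     (\<forall>U. zero_nhd T U \<longrightarrow> (\<exists>r>0. \<forall>c. r \<le> norm c \<longrightarrow> B \<subseteq> s c ` U))"

definition banach_disk :: "(complex \<Rightarrow> 'a::ab_group_add \<Rightarrow> 'a) \<Rightarrow> 'a topology \<Rightarrow> 'a set \<Rightarrow> bool" where
  "banach_disk s T D \<longleftrightarrow> abs_convex s D \<and> tvs_bounded s T D \<and>
     (\<forall>x::nat \<Rightarrow> 'a. (\<forall>n. x n \<in> module.span s D) \<longrightarrow>
        (\<forall>\<epsilon>>0. \<exists>n0. \<forall>m\<ge>n0. \<forall>n\<ge>n0. minkowski s D (x m - x n) < \<epsilon>) \<longrightarrow>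
        (\<exists>l\<in>module.span s D. (\<lambda>n. minkowski s D (x n - l)) \<longlonglongrightarrow> 0))"

definition locally_complete :: "(complex \<Rightarrow> 'a::ab_group_add \<Rightarrow> 'a) \<Rightarrow> 'a topology \<Rightarrow> bool" where
  "locally_complete s T \<longleftrightarrow> (\<forall>B. tvs_bounded s T B \<longrightarrow> (\<exists>D. banach_disk s T D \<and> B \<subseteq> D))"

definition fundamental_bounded ::
  "(complex \<Rightarrow> 'a::ab_group_add \<Rightarrow> 'a) \<Rightarrow> 'a topology \<Rightarrow> (nat \<Rightarrow> 'a set) \<Rightarrow> bool" where
  "fundamental_bounded s T B \<longleftrightarrow> (\<forall>n. tvs_bounded s T (B n)) \<and>
     (\<forall>A. tvs_bounded s T A \<longrightarrow> (\<exists>n. A \<subseteq> B n))"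

definition cont_seminorm ::
  "(complex \<Rightarrow> 'a::ab_group_add \<Rightarrow> 'a) \<Rightarrow> 'a topology \<Rightarrow> ('a \<Rightarrow> real) \<Rightarrow> bool" where
  "cont_seminorm s T p \<longleftrightarrow> continuous_map T euclideanreal p \<and>
     (\<forall>x\<in>topspace T. 0 \<le> p x) \<and>
     (\<forall>x\<in>topspace T. \<forall>y\<in>topspace T. p (x + y) \<le> p x + p y) \<and>
     (\<forall>c. \<forall>x\<in>topspace T. p (s c x) = norm c * p x)"

text \<open>For continuous seminorms \<open>p \<le> q\<close>, nuclearity of the canonical map from the local normed space of
  \<open>q\<close> to that of \<open>p\<close>, written out on representatives: \<open>x = (\<Sum>j. f j x \<cdot> b j)\<close> with respect to \<open>p\<close>, where
  \<open>c j\<close> bounds the dual norm of \<open>f j\<close> with respect to \<open>q\<close>. Passing to the completions of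
  the local spaces gives the same notion, because every element of a completion is the sum of an
  absolutely convergent series from the dense subspace whose sum of norms is arbitrarily close to
  the norm of the element.\<close>

definition nuclear_canonical ::
  "(complex \<Rightarrow> 'a::ab_group_add \<Rightarrow> 'a) \<Rightarrow> 'a topology \<Rightarrow> ('a \<Rightarrow> real) \<Rightarrow> ('a \<Rightarrow> real) \<Rightarrow> bool" where
  "nuclear_canonical s T q p \<longleftrightarrow>
     (\<exists>(f::nat \<Rightarrow> 'a \<Rightarrow> complex) (b::nat \<Rightarrow> 'a) (c::nat \<Rightarrow> real).
        (\<forall>j. f j \<in> dual s T \<and> b j \<in> topspace T \<and> 0 \<le> c j \<and>
             (\<forall>x\<in>topspace T. norm (f j x) \<le> c j * q x)) \<and>
        summable (\<lambda>j. c j * p (b j)) \<and>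
        (\<forall>x\<in>topspace T. (\<lambda>n. p (x - (\<Sum>j<n. s (f j x) (b j)))) \<longlonglongrightarrow> 0))"

definition nuclear :: "(complex \<Rightarrow> 'a::ab_group_add \<Rightarrow> 'a) \<Rightarrow> 'a topology \<Rightarrow> bool" where
  "nuclear s T \<longleftrightarrow> (\<forall>p. cont_seminorm s T p \<longrightarrow>
     (\<exists>q. cont_seminorm s T q \<and> (\<forall>x\<in>topspace T. p x \<le> q x) \<and> nuclear_canonical s T q p))"

definition fundamental_seminorms ::
  "(complex \<Rightarrow> 'a::ab_group_add \<Rightarrow> 'a) \<Rightarrow> 'a topology \<Rightarrow> (nat \<Rightarrow> 'a \<Rightarrow> real) \<Rightarrow> bool" where
  "fundamental_seminorms s T p \<longleftrightarrow> (\<forall>n. cont_seminorm s T (p n)) \<and>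
     (\<forall>q. cont_seminorm s T q \<longrightarrow> (\<exists>n. \<exists>C>0. \<forall>x\<in>topspace T. q x \<le> C * p n x))"

definition fundamental_zero_nhds ::
  "(complex \<Rightarrow> 'a::ab_group_add \<Rightarrow> 'a) \<Rightarrow> 'a topology \<Rightarrow> (nat \<Rightarrow> 'a set) \<Rightarrow> bool" where
  "fundamental_zero_nhds s T U \<longleftrightarrow> (\<forall>n. zero_nhd T (U n) \<and> abs_convex s (U n)) \<and>
     (\<forall>V. zero_nhd T V \<longrightarrow> (\<exists>n. U n \<subseteq> V))"

text \<open>The next three conditions do not depend on the choice of the fundamental sequence; they are stated
  as the existence of a sequence with the required property. The first one is the
  underlined condition (DN).\<close>

definition cond_uDN :: "(complex \<Rightarrow> 'a::ab_group_add \<Rightarrow> 'a) \<Rightarrow> 'a topology \<Rightarrow> bool" where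
  "cond_uDN s T \<longleftrightarrow> (\<exists>p. fundamental_seminorms s T p \<and>
     (\<forall>n. \<forall>x\<in>topspace T. p n x \<le> p (Suc n) x) \<and>
     (\<exists>n. \<forall>m\<ge>n. \<exists>\<theta>\<in>{0<..<1}. \<exists>k\<ge>m. \<exists>C>0. \<forall>x\<in>topspace T.
        p m x \<le> C * p n x powr \<theta> * p k x powr (1 - \<theta>)))"

definition cond_Omega :: "(complex \<Rightarrow> 'a::ab_group_add \<Rightarrow> 'a) \<Rightarrow> 'a topology \<Rightarrow> bool" where
  "cond_Omega s T \<longleftrightarrow> (\<exists>U. fundamental_zero_nhds s T U \<and> decseq U \<and>
     (\<forall>n. \<exists>m\<ge>n. \<forall>k\<ge>m. \<exists>\<theta>\<in>{0<..<1}. \<exists>C>0. \<forall>z\<in>module.span fun_scale (polar s T (U n)).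
        minkowski fun_scale (polar s T (U m)) z \<le>
          C * minkowski fun_scale (polar s T (U n)) z powr \<theta>
            * minkowski fun_scale (polar s T (U k)) z powr (1 - \<theta>)))"

definition cond_A :: "(complex \<Rightarrow> 'a::ab_group_add \<Rightarrow> 'a) \<Rightarrow> 'a topology \<Rightarrow> bool" where
  "cond_A s T \<longleftrightarrow> (\<exists>B. fundamental_bounded s T B \<and> incseq B \<and>
     (\<exists>N. \<forall>M\<ge>N. \<forall>\<nu>>0. \<exists>K\<ge>M. \<exists>C>0. \<forall>r>0.
        B M \<subseteq> {s (of_real r) x + s (of_real (C / r powr \<nu>)) y | x y. x \<in> B K \<and> y \<in> B N}))"

definition eidelheit :: "'a topology \<Rightarrow> 'j set \<Rightarrow> ('j \<Rightarrow> 'a \<Rightarrow> complex) \<Rightarrow> bool" where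
  "eidelheit T J x' \<longleftrightarrow> (\<forall>a. \<exists>x\<in>topspace T. \<forall>j\<in>J. x' j x = a j)"

definition kerQ :: "'a topology \<Rightarrow> 'j set \<Rightarrow> ('j \<Rightarrow> 'a \<Rightarrow> complex) \<Rightarrow> 'a set" where
  "kerQ T J x' = {x \<in> topspace T. \<forall>j\<in>J. x' j x = 0}"

text \<open>The map \<open>\<phi> \<epsilon> id\<close> sends \<open>R\<close> to \<open>R \<circ> \<phi>\<^sup>t\<close>; identifying the \<open>\<epsilon>\<close>-product of the scalar field and
  \<open>E\<close> with \<open>E\<close> through evaluation at the identity functional, this is \<open>R \<phi>\<close>.\<close>

definition eps_id :: "('a \<Rightarrow> complex) \<Rightarrow> (('a \<Rightarrow> complex) \<Rightarrow> 'e) \<Rightarrow> 'e" where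
  "eps_id \<phi> R = R \<phi>"

definition valued_eidelheit ::
  "(complex \<Rightarrow> 'a::ab_group_add \<Rightarrow> 'a) \<Rightarrow> 'a topology \<Rightarrow>
   (complex \<Rightarrow> 'e::ab_group_add \<Rightarrow> 'e) \<Rightarrow> 'e topology \<Rightarrow>
   'j set \<Rightarrow> ('j \<Rightarrow> 'a \<Rightarrow> complex) \<Rightarrow> bool" where
  "valued_eidelheit s T sE TE J x' \<longleftrightarrow>
     (\<forall>e. (\<forall>j\<in>J. e j \<in> topspace TE) \<longrightarrow>
        (\<exists>R\<in>eps_product s T sE TE. \<forall>j\<in>J. eps_id (x' j) R = e j))"

end

theory Submission
  imports Defs
begin

text \<open>Necessity. By the underlined condition (DN) and the Hahn--Banach theorem, every \<open>x'\<^sub>j\<close> splits, for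
  each \<open>r > 0\<close>, into functionals bounded by \<open>C r q\<close> and \<open>C r\<^sup>-\<^sup>\<nu> p\<close>, where \<open>\<nu>\<close> and \<open>q\<close> depend on \<open>j\<close> but
  the seminorm \<open>p\<close> does not. If \<open>(A)\<close> fails, Baire's theorem in the Banach disks provides for each \<open>j\<close> an
  element \<open>e\<^sub>j\<close> that cannot be split with exponent \<open>\<nu>\<^sub>j\<close> relative to the \<open>j\<close>-th bounded set. A solution \<open>R\<close>
  maps the polar of \<open>p\<close> into the \<open>N\<close>-th bounded set for some \<open>N\<close>, which is absurd for \<open>j = N\<close>.

  Sufficiency. By \<open>(\<Omega>)\<close>, a dual basis of \<open>(x'\<^sub>j)\<close> can be corrected by elements of the kernel to \<open>g\<^sub>j\<^sub>l\<close> whose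
  \<open>n\<close>-th seminorm is at most \<open>2\<^sup>-\<^sup>j 4\<^sup>-\<^sup>l\<close>, with \<open>n\<close> tending to infinity with \<open>j\<close>, while every seminorm grows
  at most exponentially in \<open>l\<close>. By \<open>(A)\<close>, \<open>e\<^sub>j = \<Sum>\<^sub>l d\<^sub>j\<^sub>l\<close> where \<open>d\<^sub>j\<^sub>l\<close> is of size \<open>2\<^sup>l\<close> in a Banach disk
  independent of \<open>j\<close> and decays faster than any given exponential in a larger disk. Then
  \<open>R \<phi> = \<Sum>\<^sub>j\<^sub>l \<phi>(g\<^sub>j\<^sub>l) d\<^sub>j\<^sub>l\<close> is the required element of the \<open>\<epsilon>\<close>-product.\<close>

section \<open>Seminorms and linear functionals\<close>

text \<open>Three points lie behind the overview. First, a failure of (A) must be a failure for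
  every exponent at once, since the exponent attached to a functional cannot be prescribed. This
  works because an interpolation with one exponent can be iterated, each iteration halving the
  exponent. Second, correcting by kernel elements needs the kernel to be dense, for each seminorm,
  in the common kernel of finitely many of the functionals. Surjectivity gives this: only finitely
  many functionals can enter combinations bounded by a given continuous seminorm. Hence the n-th
  level of smallness is reached only from some index j on. Third, the growth rate in l of the k-th
  seminorm of \<open>g\<^sub>j\<^sub>l\<close> depends on j and k, so the resolution of
  \<open>e\<^sub>j\<close> must beat every exponential, each in a disk of its own. For fixed k, all
  but finitely many j are served by the common disk, and the finitely many exceptional disks fit
  into one larger disk. Continuity of R is a statement about compact disks of G, so the series has
  to be absorbed into one.\<close>

definition seminorm_on :: "(complex \<Rightarrow> 'a::ab_group_add \<Rightarrow> 'a) \<Rightarrow> 'a set \<Rightarrow> ('a \<Rightarrow> real) \<Rightarrow> bool" where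
  "seminorm_on s S p \<longleftrightarrow> (\<forall>x\<in>S. 0 \<le> p x) \<and> (\<forall>x\<in>S. \<forall>y\<in>S. p (x + y) \<le> p x + p y) \<and>
     (\<forall>c. \<forall>x\<in>S. p (s c x) = norm c * p x)"

definition sublinear_on :: "(complex \<Rightarrow> 'a::ab_group_add \<Rightarrow> 'a) \<Rightarrow> 'a set \<Rightarrow> ('a \<Rightarrow> real) \<Rightarrow> bool" where
  "sublinear_on s S q \<longleftrightarrow> (\<forall>x\<in>S. \<forall>y\<in>S. q (x + y) \<le> q x + q y) \<and>
     (\<forall>x\<in>S. \<forall>t\<ge>0. q (s (of_real t) x) = t * q x)"

text \<open>The value 0 outside \<open>S\<close> is the convention of \<open>cont_linear\<close>, so
  that members of \<open>dual\<close> are literally functions of this kind.\<close>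

definition linear_on ::
  "(complex \<Rightarrow> 'a::ab_group_add \<Rightarrow> 'a) \<Rightarrow> 'a set \<Rightarrow> ('a \<Rightarrow> complex) \<Rightarrow> bool" where
  "linear_on s S f \<longleftrightarrow> (\<forall>x\<in>S. \<forall>y\<in>S. f (x + y) = f x + f y) \<and>
     (\<forall>c. \<forall>x\<in>S. f (s c x) = c * f x) \<and> (\<forall>x. x \<notin> S \<longrightarrow> f x = 0)"

text \<open>Turns the geometric mean of the underlined (DN) into a sum, once its factors have been
  rescaled by opposite powers of a parameter.\<close>

lemma mult_powr_le_max:
  fixes a b \<theta> :: real
  assumes "0 \<le> a" "0 \<le> b" "0 < \<theta>" "\<theta> < 1"
  shows "a powr \<theta> * b powr (1 - \<theta>) \<le> max a b"
proof -
  have "a powr \<theta> * b powr (1 - \<theta>) \<le> max a b powr \<theta> * max a b powr (1 - \<theta>)"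
    using assms by (intro mult_mono powr_mono2) auto
  also have "\<dots> = max a b"
    using assms by (simp add: powr_add [symmetric])
  finally show ?thesis .
qed

locale cvs = vector_space s for s :: "complex \<Rightarrow> 'a::ab_group_add \<Rightarrow> 'a"
begin

lemma seminorm_onD:
  assumes "seminorm_on s S p"
  shows "x \<in> S \<Longrightarrow> 0 \<le> p x" "x \<in> S \<Longrightarrow> y \<in> S \<Longrightarrow> p (x + y) \<le> p x + p y"
    "x \<in> S \<Longrightarrow> p (s c x) = norm c * p x"
  using assms unfolding seminorm_on_def by auto

text \<open>The estimate for a nonzero scalar, applied to its inverse, gives the opposite
  inequality.\<close>

lemma seminorm_onI:
  assumes S: "subspace S" and nn: "\<And>x. x \<in> S \<Longrightarrow> 0 \<le> p x"
    and add: "\<And>x y. x \<in> S \<Longrightarrow> y \<in> S \<Longrightarrow> p (x + y) \<le> p x + p y"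
    and le: "\<And>x c. x \<in> S \<Longrightarrow> c \<noteq> 0 \<Longrightarrow> p (s c x) \<le> norm c * p x" and zero: "p 0 \<le> 0"
  shows "seminorm_on s S p"
proof -
  have "p (s c x) = norm c * p x" if x: "x \<in> S" for x c
  proof (cases "c = 0")
    case True
    then show ?thesis using zero nn[OF subspace_0[OF S]] by simp
  next
    case False
    have "p (s (inverse c) (s c x)) \<le> norm (inverse c) * p (s c x)"
      using x False by (intro le subspace_scale S) auto
    then have "norm c * p x \<le> p (s c x)" using False by (simp only: norm_inverse) (simp add: field_simps)
    then show ?thesis using le[OF x False] by simp
  qed
  then show ?thesis unfolding seminorm_on_def using nn add by blast
qed

lemma sublinear_onI:
  assumes S: "subspace S" and add: "\<And>x y. x \<in> S \<Longrightarrow> y \<in> S \<Longrightarrow> q (x + y) \<le> q x + q y"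
    and le: "\<And>x t. x \<in> S \<Longrightarrow> 0 < t \<Longrightarrow> q (s (of_real t) x) \<le> t * q x" and zero: "q 0 = 0"
  shows "sublinear_on s S q"
proof -
  have "q (s (of_real t) x) = t * q x" if x: "x \<in> S" and t: "0 \<le> t" for t x
  proof (cases "t = 0")
    case False
    have "q (s (of_real (inverse t)) (s (of_real t) x)) \<le> inverse t * q (s (of_real t) x)"
      using False t x S by (intro le subspace_scale) auto
    then have "t * q x \<le> q (s (of_real t) x)" using False t by (simp add: field_simps)
    then show ?thesis using le[of x t] False t x by simp
  qed (simp add: zero)
  then show ?thesis unfolding sublinear_on_def using add by blast
qed

lemma seminorm_on_minus:
  assumes "seminorm_on s S p" "x \<in> S"
  shows "p (- x) = p x"
  using seminorm_onD(3)[OF assms, of "-1"] by simp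

lemma seminorm_on_zero:
  assumes "seminorm_on s S p" "subspace S"
  shows "p 0 = 0"
  using seminorm_onD(3)[OF assms(1) subspace_0[OF assms(2)], of 0] by simp

lemma seminorm_on_diff:
  assumes "seminorm_on s S p" "subspace S" "x \<in> S" "y \<in> S"
  shows "p (x - y) \<le> p x + p y" "\<bar>p x - p y\<bar> \<le> p (x - y)" "p (x - y) = p (y - x)"
proof -
  have d: "p (a - b) \<le> p a + p b" "p a - p b \<le> p (a - b)" if "a \<in> S" "b \<in> S" for a b
    using seminorm_onD(2)[OF assms(1) that(1), of "- b"] seminorm_on_minus[OF assms(1) that(2)]
      subspace_neg[OF assms(2) that(2)]
      seminorm_onD(2)[OF assms(1) subspace_diff[OF assms(2) that] that(2)] by auto
  show "p (x - y) \<le> p x + p y" using d assms by blast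
  show s: "p (x - y) = p (y - x)"
    using seminorm_on_minus[OF assms(1) subspace_diff[OF assms(2-4)]] by simp
  show "\<bar>p x - p y\<bar> \<le> p (x - y)"
    using d(2)[OF assms(3,4)] d(2)[OF assms(4,3)] s by linarith
qed

lemma seminorm_on_sum:
  assumes "seminorm_on s S p" "subspace S" "finite I" "\<And>i. i \<in> I \<Longrightarrow> x i \<in> S"
  shows "p (\<Sum>i\<in>I. x i) \<le> (\<Sum>i\<in>I. p (x i))"
  using assms(3,4)
proof (induction I rule: finite_induct)
  case empty
  then show ?case using seminorm_on_zero[OF assms(1,2)] by simp
next
  case (insert i I)
  then have "p (x i + sum x I) \<le> p (x i) + p (sum x I)"
    using assms by (intro seminorm_onD(2)[OF assms(1)] subspace_sum) auto
  then show ?case using insert by auto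
qed

lemma seminorm_on_scale:
  "seminorm_on s S p \<Longrightarrow> 0 \<le> c \<Longrightarrow> seminorm_on s S (\<lambda>x. c * p x)"
  unfolding seminorm_on_def by (simp add: distrib_left[symmetric] mult_left_mono mult.left_commute)

lemma seminorm_on_sublinear: "seminorm_on s S p \<Longrightarrow> sublinear_on s S p"
  unfolding seminorm_on_def sublinear_on_def by auto

lemma linear_on_seminorm: "linear_on s S f \<Longrightarrow> seminorm_on s S (\<lambda>x. norm (f x))"
  unfolding linear_on_def seminorm_on_def by (auto simp: norm_mult norm_triangle_ineq)

lemma linear_onD:
  assumes "linear_on s S f"
  shows "x \<in> S \<Longrightarrow> y \<in> S \<Longrightarrow> f (x + y) = f x + f y" "x \<in> S \<Longrightarrow> f (s c x) = c * f x"
    "x \<notin> S \<Longrightarrow> f x = 0"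
  using assms unfolding linear_on_def by auto

lemma linear_on_diff:
  assumes "linear_on s S f" "subspace S" "x \<in> S" "y \<in> S"
  shows "f (x - y) = f x - f y"
  using linear_onD(1)[OF assms(1) subspace_diff[OF assms(2-4)] assms(4)] by simp

lemma linear_on_zero:
  assumes "linear_on s S f" "subspace S"
  shows "f 0 = 0"
  using linear_onD(2)[OF assms(1) subspace_0[OF assms(2)], of 0] by simp

lemma linear_on_sum:
  assumes "linear_on s S f" "subspace S" "finite I" "\<And>i. i \<in> I \<Longrightarrow> x i \<in> S"
  shows "f (\<Sum>i\<in>I. x i) = (\<Sum>i\<in>I. f (x i))"
  using assms(3,4)
proof (induction I rule: finite_induct)
  case empty
  then show ?case using linear_on_zero[OF assms(1,2)] by simp
next
  case (insert i I)
  then show ?case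
    using assms by (simp add: linear_onD(1)[OF assms(1)] subspace_sum)
qed

section \<open>The Hahn--Banach theorem\<close>

text \<open>Lowers \<open>q\<close> as far as sublinearity in the direction \<open>y\<close> allows:
  at \<open>- y\<close> the new value is at most \<open>- q y\<close>. The value 0 off
  \<open>S\<close> is the normalisation used in the Zorn argument below.\<close>

definition descent :: "'a set \<Rightarrow> ('a \<Rightarrow> real) \<Rightarrow> 'a \<Rightarrow> 'a \<Rightarrow> real" where
  "descent S q y x = (if x \<in> S then INF t\<in>{0..}. q (x + s (of_real t) y) - t * q y else 0)"

lemma sublinear_on_descent:
  assumes S: "subspace S" and q: "sublinear_on s S q" and y: "y \<in> S"
  defines "r \<equiv> descent S q y"
  shows "sublinear_on s S r" "\<And>x. x \<in> S \<Longrightarrow> r x \<le> q x"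
    "\<And>x t. x \<in> S \<Longrightarrow> 0 \<le> t \<Longrightarrow> r x \<le> q (x + s (of_real t) y) - t * q y"
proof -
  have q1: "q (x + z) \<le> q x + q z" if "x \<in> S" "z \<in> S" for x z
    using q that unfolding sublinear_on_def by blast
  have q2: "q (s (of_real t) x) = t * q x" if "x \<in> S" "0 \<le> t" for t x
    using q that unfolding sublinear_on_def by blast
  have Sy: "x + s c y \<in> S" if "x \<in> S" for x c
    using S y that by (intro subspace_add subspace_scale)
  \<comment> \<open>A bound independent of t, without which the infimum could be minus
    infinity.\<close>
  have lower: "- q (- x) \<le> q (x + s (of_real t) y) - t * q y" if "x \<in> S" "0 \<le> t" for x t
  proof -
    have "t * q y = q ((- x) + (x + s (of_real t) y))" using q2[OF y that(2)] by simp
    also have "\<dots> \<le> q (- x) + q (x + s (of_real t) y)"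
      using S that Sy by (intro q1) (auto intro: subspace_neg)
    finally show ?thesis by simp
  qed
  have bdd: "bdd_below ((\<lambda>t. q (x + s (of_real t) y) - t * q y) ` {0..})" if "x \<in> S" for x
    using lower[OF that] by (intro bdd_belowI2[where m = "- q (- x)"]) auto
  show le: "r x \<le> q (x + s (of_real t) y) - t * q y" if "x \<in> S" "0 \<le> t" for x t
    using that unfolding r_def descent_def by (auto intro!: cINF_lower bdd)
  show "r x \<le> q x" if "x \<in> S" for x
    using le[OF that, of 0] by simp
  have ge: "m \<le> r x" if "x \<in> S" "\<And>t. 0 \<le> t \<Longrightarrow> m \<le> q (x + s (of_real t) y) - t * q y" for x m
    using that unfolding r_def descent_def by (auto intro!: cINF_greatest)
  have add: "r (x + z) \<le> r x + r z" if "x \<in> S" "z \<in> S" for x z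
  proof -
    have "r (x + z) - r x \<le> r z"
    proof (rule ge[OF that(2)])
      fix t :: real assume t: "0 \<le> t"
      have "r (x + z) - (q (z + s (of_real t) y) - t * q y) \<le> r x"
      proof (rule ge[OF that(1)])
        fix u :: real assume u: "0 \<le> u"
        have "r (x + z) \<le> q (x + z + s (of_real (u + t)) y) - (u + t) * q y"
          using t u S that by (intro le subspace_add) auto
        also have "x + z + s (of_real (u + t)) y = (x + s (of_real u) y) + (z + s (of_real t) y)"
          by (simp add: scale_left_distrib algebra_simps)
        also have "q \<dots> \<le> q (x + s (of_real u) y) + q (z + s (of_real t) y)"
          using Sy that by (intro q1) auto
        finally show "r (x + z) - (q (z + s (of_real t) y) - t * q y) \<le> q (x + s (of_real u) y) - u * q y"
          by (simp add: algebra_simps)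
      qed
      then show "r (x + z) - r x \<le> q (z + s (of_real t) y) - t * q y" by simp
    qed
    then show ?thesis by simp
  qed
  have scale_le: "r (s (of_real c) x) \<le> c * r x" if "x \<in> S" "0 < c" for c x
  proof -
    have "r (s (of_real c) x) / c \<le> r x"
    proof (rule ge[OF that(1)])
      fix t :: real assume t: "0 \<le> t"
      have "r (s (of_real c) x) \<le> q (s (of_real c) x + s (of_real (c * t)) y) - (c * t) * q y"
        using t that S by (intro le subspace_scale) auto
      also have "s (of_real c) x + s (of_real (c * t)) y = s (of_real c) (x + s (of_real t) y)"
        by (simp add: scale_right_distrib)
      also have "q \<dots> = c * q (x + s (of_real t) y)"
        using that Sy by (intro q2) auto
      finally show "r (s (of_real c) x) / c \<le> q (x + s (of_real t) y) - t * q y"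
        using that by (simp add: field_simps)
    qed
    then show ?thesis using that by (simp add: field_simps)
  qed
  have zero: "r 0 = 0"
  proof (rule antisym)
    show "r 0 \<le> 0" using le[OF subspace_0[OF S], of 0] q2[OF subspace_0[OF S], of 0] by simp
    show "0 \<le> r 0"
      using q2[OF y] by (intro ge subspace_0 S) auto
  qed
  show "sublinear_on s S r" by (rule sublinear_onI[OF S add scale_le zero])
qed

text \<open>A minimal sublinear functional coincides with all its descents
  \<open>x \<mapsto> inf\<^sub>t (q (x + t y) - t q y)\<close> and is therefore additive.\<close>

lemma sublinear_on_dominates_additive:
  assumes S: "subspace S" and q: "sublinear_on s S q"
  obtains h where "\<And>x y. x \<in> S \<Longrightarrow> y \<in> S \<Longrightarrow> h (x + y) = h x + h y"
    "\<And>x t. x \<in> S \<Longrightarrow> h (s (of_real t) x) = t * h x"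
    "\<And>x. x \<in> S \<Longrightarrow> h x \<le> q x"
proof -
  define A where "A = {h. sublinear_on s S h \<and> (\<forall>x\<in>S. h x \<le> q x) \<and> (\<forall>x. x \<notin> S \<longrightarrow> h x = 0)}"
  \<comment> \<open>The order is reversed: a maximal element for \<open>P\<close> is a pointwise
    minimal functional.\<close>
  define P where "P = (\<lambda>h k::'a \<Rightarrow> real. \<forall>x. k x \<le> h x)"
  have A1: "h (x + z) \<le> h x + h z" if "h \<in> A" "x \<in> S" "z \<in> S" for h x z
    using that unfolding A_def sublinear_on_def by blast
  have A2: "h (s (of_real t) x) = t * h x" if "h \<in> A" "x \<in> S" "0 \<le> t" for h t x
    using that unfolding A_def sublinear_on_def by blast
  have Aneg: "- h (- x) \<le> h x" if "h \<in> A" "x \<in> S" for h x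
    using A1[OF that(1) that(2) subspace_neg[OF S that(2)]] A2[OF that, of 0]
      A2[OF that(1) subspace_0[OF S], of 0] by simp
  have "\<exists>m\<in>A. \<forall>a\<in>A. P m a \<longrightarrow> a = m"
  proof (rule predicate_Zorn)
    show "partial_order_on A (relation_of P A)"
      unfolding P_def
      by (rule partial_order_on_relation_ofI) (auto simp: fun_eq_iff intro: order_trans antisym)
    fix C assume C: "C \<in> Chains (relation_of P A)"
    then have CA: "C \<subseteq> A" and chain: "\<And>h k. h \<in> C \<Longrightarrow> k \<in> C \<Longrightarrow> P h k \<or> P k h"
      unfolding Chains_def relation_of_def by auto
    show "\<exists>u\<in>A. \<forall>a\<in>C. P a u"
    proof (cases "C = {}")
      case True
      \<comment> \<open>The empty chain needs a bound too; \<open>q\<close>, cut off outside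
        \<open>S\<close>, serves.\<close>
      define q' where "q' = (\<lambda>x. if x \<in> S then q x else 0)"
      have "q' \<in> A"
        using q S unfolding A_def q'_def sublinear_on_def by (auto simp: subspace_add subspace_scale)
      then show ?thesis using True by blast
    next
      case False
      define u where "u = (\<lambda>x. if x \<in> S then INF h\<in>C. h x else 0)"
      have bdd: "bdd_below ((\<lambda>h. h x) ` C)" if "x \<in> S" for x
      proof (rule bdd_belowI2)
        fix h assume "h \<in> C"
        then have h: "h \<in> A" using CA by blast
        have "h (- x) \<le> q (- x)" using h subspace_neg[OF S that] unfolding A_def by blast
        then show "- q (- x) \<le> h x" using Aneg[OF h that] by linarith
      qed
      have ule: "u x \<le> h x" if "x \<in> S" "h \<in> C" for x h
        using that bdd unfolding u_def by (auto intro!: cINF_lower)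
      have uge: "m \<le> u x" if "x \<in> S" "\<And>h. h \<in> C \<Longrightarrow> m \<le> h x" for x m
        using that False unfolding u_def by (auto intro!: cINF_greatest)
      have "u (x + z) \<le> u x + u z" if x: "x \<in> S" and z: "z \<in> S" for x z
      proof -
        have "u (x + z) - u x \<le> u z"
        proof (rule uge[OF z])
          fix h assume h: "h \<in> C"
          have "u (x + z) - h z \<le> u x"
          proof (rule uge[OF x])
            fix k assume k: "k \<in> C"
            \<comment> \<open>The smaller of the two chain members bounds both, which makes the
              infimum over the chain subadditive.\<close>
            obtain l where l: "l \<in> C" "\<And>w. l w \<le> h w" "\<And>w. l w \<le> k w"
              using chain[OF h k] h k unfolding P_def by blast
            have "u (x + z) \<le> l (x + z)" using x z l S by (intro ule subspace_add) auto
            also have "\<dots> \<le> l x + l z" using l CA x z by (intro A1) auto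
            finally show "u (x + z) - h z \<le> k x" using l(2)[of z] l(3)[of x] by simp
          qed
          then show "u (x + z) - u x \<le> h z" by simp
        qed
        then show ?thesis by simp
      qed
      moreover have "u (s (of_real t) x) = t * u x" if x: "x \<in> S" and t: "0 \<le> t" for x t
      proof (cases "t = 0")
        case True
        have "h 0 = 0" if "h \<in> C" for h
          using A2[OF _ subspace_0[OF S], of h 0] CA that by auto
        then have "(\<lambda>h. h 0) ` C = {0}" using False by force
        then have "u 0 = 0" using subspace_0[OF S] by (simp add: u_def)
        then show ?thesis using True by simp
      next
        case False
        then have t: "0 < t" using t by simp
        have sx: "s (of_real t) x \<in> S" using S x by (rule subspace_scale)
        have "u (s (of_real t) x) / t \<le> u x"
        proof (rule uge[OF x])
          fix h assume h: "h \<in> C"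
          then show "u (s (of_real t) x) / t \<le> h x"
            using t ule[OF sx h] A2[OF _ x, of h t] CA by (auto simp: field_simps)
        qed
        moreover have "t * u x \<le> u (s (of_real t) x)"
        proof (rule uge[OF sx])
          fix h assume h: "h \<in> C"
          then show "t * u x \<le> h (s (of_real t) x)"
            using t ule[OF x h] A2[OF _ x, of h t] CA by auto
        qed
        ultimately show ?thesis using t by (simp add: field_simps)
      qed
      moreover have "u x \<le> q x" if "x \<in> S" for x
        using False ule[OF that] CA that unfolding A_def by fastforce
      ultimately have "u \<in> A"
        unfolding A_def sublinear_on_def by (auto simp: u_def)
      moreover have "P h u" if "h \<in> C" for h
        unfolding P_def using ule[OF _ that] CA that unfolding A_def u_def by auto
      ultimately show ?thesis by blast
    qed
  qed
  then obtain h where hA: "h \<in> A" and min: "\<And>k. k \<in> A \<Longrightarrow> P h k \<Longrightarrow> k = h" by blast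
  have hsub: "sublinear_on s S h" using hA unfolding A_def by blast
  have add: "h (x + y) = h x + h y" if x: "x \<in> S" and y: "y \<in> S" for x y
  proof -
    define r where "r = descent S h y"
    note r = sublinear_on_descent[OF S hsub y, folded r_def]
    have "P h r" unfolding P_def using r(2) hA unfolding A_def by (auto simp: r_def descent_def)
    moreover have "r \<in> A" using r(1,2) hA unfolding A_def by (auto simp: r_def descent_def intro: order_trans)
    ultimately have "r = h" by (rule min[rotated])
    then have "h x \<le> h (x + y) - h y" using r(3)[OF x, of 1] by simp
    then show ?thesis using A1[OF hA x y] by simp
  qed
  have neg: "h (- x) = - h x" if x: "x \<in> S" for x
    using add[OF x subspace_neg[OF S x]] A2[OF hA subspace_0[OF S], of 0] by simp
  have "h (s (of_real t) x) = t * h x" if x: "x \<in> S" for x t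
  proof (cases "0 \<le> t")
    case False
    have "h (s (of_real (- t)) x) = - t * h x" using A2[OF hA x, of "- t"] False by linarith
    moreover have "s (of_real (- t)) x = - s (of_real t) x" by simp
    ultimately show ?thesis using neg[OF subspace_scale[OF S x]] by simp
  qed (use A2[OF hA x] in simp)
  moreover have "h x \<le> q x" if "x \<in> S" for x using hA that unfolding A_def by blast
  ultimately show ?thesis using that add by blast
qed

text \<open>The real part determines a complex linear function: f(x) = h(x) - i h(ix).\<close>

lemma complexify:
  assumes S: "subspace S" and add: "\<And>x y. x \<in> S \<Longrightarrow> y \<in> S \<Longrightarrow> h (x + y) = h x + h y"
    and sc: "\<And>x t. x \<in> S \<Longrightarrow> h (s (of_real t) x) = t * h x"
  obtains f where "linear_on s S f" "\<And>x. x \<in> S \<Longrightarrow> Re (f x) = (h x :: real)"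
proof
  define f where "f = (\<lambda>x. if x \<in> S then Complex (h x) (- h (s \<i> x)) else 0)"
  show "Re (f x) = h x" if "x \<in> S" for x using that by (simp add: f_def)
  have hi: "h (s \<i> (s \<i> x)) = - h x" if "x \<in> S" for x
    using sc[OF that, of "-1"] by simp
  have "f (s c x) = c * f x" if x: "x \<in> S" for c x
  proof -
    have dec: "h (s c y) = Re c * h y + Im c * h (s \<i> y)" if y: "y \<in> S" for y
    proof -
      have "s c y = s (of_real (Re c)) y + s (of_real (Im c)) (s \<i> y)"
        by (subst complex_eq[of c]) (simp add: scale_left_distrib mult.commute)
      then show ?thesis
        using S y sc[OF subspace_scale[OF S y, of \<i>], of "Im c"]
        by (simp add: add sc subspace_scale)
    qed
    have "s \<i> (s c x) = s c (s \<i> x)" by (simp add: mult.commute)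
    then show ?thesis
      using dec[OF x] dec[of "s \<i> x"] x S hi[OF x]
      by (simp add: f_def subspace_scale complex_eq_iff algebra_simps)
  qed
  moreover have "f (x + y) = f x + f y" if x: "x \<in> S" and y: "y \<in> S" for x y
    using add[OF x y] add[of "s \<i> x" "s \<i> y"] S x y
    by (simp add: f_def subspace_add subspace_scale scale_right_distrib complex_eq_iff)
  ultimately show "linear_on s S f"
    unfolding linear_on_def by (simp add: f_def)
qed

text \<open>Rotate x by a unimodular scalar so that f becomes nonnegative at it; the seminorm does
  not see the rotation.\<close>

lemma norm_le_seminorm_if_Re_le:
  assumes S: "subspace S" and f: "linear_on s S f" and p: "seminorm_on s S p"
    and le: "\<And>x. x \<in> S \<Longrightarrow> Re (f x) \<le> p x" and x: "x \<in> S"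
  shows "norm (f x) \<le> p x"
proof (cases "f x = 0")
  case False
  define c where "c = cnj (sgn (f x))"
  have nc: "norm c = 1" using False by (simp add: c_def norm_sgn)
  have "c * f x = of_real (norm (f x))"
    using False by (simp add: c_def sgn_eq mult.commute complex_norm_square[symmetric] power2_eq_square)
  then have "norm (f x) = Re (f (s c x))" using linear_onD(2)[OF f x] by simp
  also have "\<dots> \<le> p (s c x)" using S x by (intro le subspace_scale)
  finally show ?thesis using seminorm_onD(3)[OF p x] nc by simp
qed (use seminorm_onD(1)[OF p x] in simp)

text \<open>Instead of extending a functional from the line through y, a linear minorant of the
  descent of \<open>p\<close> at y is taken. The descent is at most \<open>- p y\<close> at
  \<open>- y\<close>, which forces the real part at y to be \<open>p y\<close>; then
  \<open>norm (f y) \<le> p y\<close> leaves no room for an imaginary part.\<close>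

lemma norming_functional:
  assumes S: "subspace S" and p: "seminorm_on s S p" and y: "y \<in> S"
  obtains f where "linear_on s S f" "\<And>x. x \<in> S \<Longrightarrow> norm (f x) \<le> p x" "f y = of_real (p y)"
proof -
  define r where "r = descent S p y"
  note r = sublinear_on_descent[OF S seminorm_on_sublinear[OF p] y, folded r_def]
  obtain h where h: "\<And>x y. x \<in> S \<Longrightarrow> y \<in> S \<Longrightarrow> h (x + y) = h x + h y"
    "\<And>x t. x \<in> S \<Longrightarrow> h (s (of_real t) x) = t * h x" "\<And>x. x \<in> S \<Longrightarrow> h x \<le> r x"
    using sublinear_on_dominates_additive[OF S r(1)] by metis
  obtain f where f: "linear_on s S f" "\<And>x. x \<in> S \<Longrightarrow> Re (f x) = h x"
    using complexify[OF S, of h] h by metis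
  have le: "norm (f x) \<le> p x" if "x \<in> S" for x
  proof (rule norm_le_seminorm_if_Re_le[OF S f(1) p _ that])
    show "Re (f z) \<le> p z" if "z \<in> S" for z
      using f(2)[OF that] h(3)[OF that] r(2)[OF that] by simp
  qed
  have ny: "- y \<in> S" using S y by (rule subspace_neg)
  have "h (- y) \<le> - p y"
    using h(3)[OF ny] r(3)[OF ny, of 1] seminorm_on_zero[OF p S] by simp
  moreover have "h (- y) = - h y" using h(2)[OF y, of "-1"] by simp
  ultimately have "p y \<le> Re (f y)" using f(2)[OF y] by simp
  moreover have "(Re (f y))\<^sup>2 + (Im (f y))\<^sup>2 \<le> (p y)\<^sup>2"
    using le[OF y] power_mono[OF le[OF y], of 2] by (simp add: cmod_power2)
  moreover have "0 \<le> p y" using seminorm_onD(1)[OF p y] .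
  moreover have "Re (f y) \<le> p y" using le[OF y] complex_Re_le_cmod[of "f y"] by linarith
  ultimately have "Re (f y) = p y" "(Im (f y))\<^sup>2 \<le> 0" by auto
  then have "f y = of_real (p y)" by (simp add: complex_eq_iff)
  then show ?thesis using that f(1) le by blast
qed

text \<open>Let q(x) be the infimum over y of a(x + y) + b(y) - Re f(y). The hypothesis on f makes
  it finite, and it is sublinear. For a linear minorant k, the choice y = 0 gives k \<le> a, and
  evaluating q at -z with y = z gives Re f - k \<le> b. The complexification of k is the first
  summand.\<close>

lemma functional_decomposition:
  assumes S: "subspace S" and f: "linear_on s S f"
    and a: "seminorm_on s S a" and b: "seminorm_on s S b"
    and le: "\<And>x. x \<in> S \<Longrightarrow> norm (f x) \<le> a x + b x"
  obtains g h where "linear_on s S g" "linear_on s S h" "\<And>x. f x = g x + h x"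
    "\<And>x. x \<in> S \<Longrightarrow> norm (g x) \<le> a x" "\<And>x. x \<in> S \<Longrightarrow> norm (h x) \<le> b x"
proof -
  define q where "q = (\<lambda>x. INF y\<in>S. a (x + y) + b y - Re (f y))"
  have low: "- a x \<le> a (x + y) + b y - Re (f y)" if "x \<in> S" "y \<in> S" for x y
  proof -
    have "Re (f y) \<le> a y + b y" using le[OF that(2)] complex_Re_le_cmod[of "f y"] by linarith
    moreover have "a y \<le> a (x + y) + a x"
      using seminorm_on_diff(1)[OF a S, of "x + y" x] that S by (simp add: subspace_add)
    ultimately show ?thesis by simp
  qed
  have qle: "q x \<le> a (x + y) + b y - Re (f y)" if "x \<in> S" "y \<in> S" for x y
    unfolding q_def using that low by (intro cINF_lower bdd_belowI2[where m = "- a x"]) auto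
  have qge: "m \<le> q x" if "x \<in> S" "\<And>y. y \<in> S \<Longrightarrow> m \<le> a (x + y) + b y - Re (f y)" for x m
    unfolding q_def using that subspace_0[OF S] by (intro cINF_greatest) auto
  have add: "q (x + z) \<le> q x + q z" if x: "x \<in> S" and z: "z \<in> S" for x z
  proof -
    have "q (x + z) - q x \<le> q z"
    proof (rule qge[OF z])
      fix v assume v: "v \<in> S"
      have "q (x + z) - (a (z + v) + b v - Re (f v)) \<le> q x"
      proof (rule qge[OF x])
        fix u assume u: "u \<in> S"
        have "q (x + z) \<le> a (x + z + (u + v)) + b (u + v) - Re (f (u + v))"
          using S x z u v by (intro qle subspace_add)
        moreover have "a (x + z + (u + v)) \<le> a (x + u) + a (z + v)"
          using seminorm_onD(2)[OF a, of "x + u" "z + v"] S x z u v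
          by (simp add: subspace_add algebra_simps)
        moreover have "b (u + v) \<le> b u + b v" using b u v by (intro seminorm_onD(2))
        moreover have "Re (f (u + v)) = Re (f u) + Re (f v)" using linear_onD(1)[OF f u v] by simp
        ultimately show "q (x + z) - (a (z + v) + b v - Re (f v)) \<le> a (x + u) + b u - Re (f u)"
          by simp
      qed
      then show "q (x + z) - q x \<le> a (z + v) + b v - Re (f v)" by simp
    qed
    then show ?thesis by simp
  qed
  have sc_le: "q (s (of_real t) x) \<le> t * q x" if x: "x \<in> S" and t: "0 < t" for t x
  proof -
    have "q (s (of_real t) x) / t \<le> q x"
    proof (rule qge[OF x])
      fix y assume y: "y \<in> S"
      have "q (s (of_real t) x) \<le> a (s (of_real t) x + s (of_real t) y) + b (s (of_real t) y) - Re (f (s (of_real t) y))"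
        using S x y by (intro qle subspace_scale)
      also have "\<dots> = t * (a (x + y) + b y - Re (f y))"
        using seminorm_onD(3)[OF a subspace_add[OF S x y], of "of_real t"] seminorm_onD(3)[OF b y, of "of_real t"]
          linear_onD(2)[OF f y, of "of_real t"] t
        by (simp add: scale_right_distrib algebra_simps)
      finally show "q (s (of_real t) x) / t \<le> a (x + y) + b y - Re (f y)"
        using t by (simp add: field_simps)
    qed
    then show ?thesis using t by (simp add: field_simps)
  qed
  have z0: "q 0 = 0"
  proof (rule antisym)
    show "q 0 \<le> 0"
      using qle[OF subspace_0[OF S] subspace_0[OF S]] seminorm_on_zero[OF a S] seminorm_on_zero[OF b S]
        linear_on_zero[OF f S] by simp
    show "0 \<le> q 0"
      using low[OF subspace_0[OF S]] seminorm_on_zero[OF a S] by (intro qge subspace_0 S) auto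
  qed
  have "sublinear_on s S q" by (rule sublinear_onI[OF S add sc_le z0])
  then obtain k where k: "\<And>x y. x \<in> S \<Longrightarrow> y \<in> S \<Longrightarrow> k (x + y) = k x + k y"
    "\<And>x t. x \<in> S \<Longrightarrow> k (s (of_real t) x) = t * k x" "\<And>x. x \<in> S \<Longrightarrow> k x \<le> q x"
    using sublinear_on_dominates_additive[OF S] by metis
  obtain g where g: "linear_on s S g" "\<And>x. x \<in> S \<Longrightarrow> Re (g x) = k x"
    using complexify[OF S, of k] k by metis
  define h where "h = (\<lambda>x. f x - g x)"
  have h: "linear_on s S h"
    using f g unfolding h_def linear_on_def by (auto simp: algebra_simps)
  have "norm (g x) \<le> a x" if "x \<in> S" for x
  proof (rule norm_le_seminorm_if_Re_le[OF S g(1) a _ that])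
    fix z assume z: "z \<in> S"
    show "Re (g z) \<le> a z"
      using g(2)[OF z] k(3)[OF z] qle[OF z subspace_0[OF S]] seminorm_on_zero[OF b S]
        linear_on_zero[OF f S] by simp
  qed
  moreover have "norm (h x) \<le> b x" if "x \<in> S" for x
  proof (rule norm_le_seminorm_if_Re_le[OF S h b _ that])
    fix z assume z: "z \<in> S"
    have "k (- z) = - k z" using k(2)[OF z, of "-1"] by simp
    then show "Re (h z) \<le> b z"
      using g(2)[OF z] k(3)[OF subspace_neg[OF S z]] qle[OF subspace_neg[OF S z] z]
        seminorm_on_zero[OF a S] by (simp add: h_def)
  qed
  ultimately show ?thesis using that[OF g(1) h] by (simp add: h_def)
qed

section \<open>Disks and their gauges\<close>

text \<open>Sizes of elements are recorded as membership in \<open>dil t B\<close> rather than as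
  gauge bounds: disks need not be closed, so a gauge equal to t does not give membership.\<close>

definition dil :: "real \<Rightarrow> 'a set \<Rightarrow> 'a set" where
  "dil t B = s (of_real t) ` B"

lemma dil_one [simp]: "dil 1 B = B"
  by (auto simp: dil_def)

lemma dilI: "b \<in> B \<Longrightarrow> x = s (of_real t) b \<Longrightarrow> x \<in> dil t B"
  unfolding dil_def by (rule image_eqI)

lemma dil_mono: "A \<subseteq> B \<Longrightarrow> dil t A \<subseteq> dil t B"
  by (auto simp: dil_def)

lemma dil_iff: "t \<noteq> 0 \<Longrightarrow> x \<in> dil t B \<longleftrightarrow> s (of_real (1 / t)) x \<in> B"
  by (auto simp: dil_def image_iff divide_simps intro!: bexI[of _ "s (of_real (1 / t)) x"])

lemma abs_convex_comb:
  "abs_convex s B \<Longrightarrow> x \<in> B \<Longrightarrow> y \<in> B \<Longrightarrow> norm a + norm b \<le> 1 \<Longrightarrow> s a x + s b y \<in> B"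
  unfolding abs_convex_def by blast

lemma abs_convex_scale: "abs_convex s B \<Longrightarrow> x \<in> B \<Longrightarrow> norm a \<le> 1 \<Longrightarrow> s a x \<in> B"
  using abs_convex_comb[of B x x a 0] by simp

lemma abs_convex_zero: "abs_convex s B \<Longrightarrow> 0 \<in> B"
  using abs_convex_scale[of B _ 0] unfolding abs_convex_def by fastforce

lemma abs_convex_zero_dil: "abs_convex s B \<Longrightarrow> 0 \<in> dil t B"
  using abs_convex_zero by (force simp: dil_def)

lemma abs_convex_dil_mono:
  assumes "abs_convex s B" "0 \<le> t" "t \<le> u"
  shows "dil t B \<subseteq> dil u B"
proof (cases "u = 0")
  case False
  show ?thesis
  proof
    fix x assume "x \<in> dil t B"
    then obtain b where b: "b \<in> B" "x = s (of_real t) b" by (auto simp: dil_def)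
    have "norm (complex_of_real (t / u)) \<le> 1" using assms False by (simp add: norm_divide)
    then have "s (of_real (t / u)) b \<in> B" using abs_convex_scale assms(1) b(1) by blast
    moreover have "x = s (of_real u) (s (of_real (t / u)) b)" using b False by simp
    ultimately show "x \<in> dil u B" by (rule dilI)
  qed
qed (use assms in auto)

lemma abs_convex_dil_scale:
  assumes "abs_convex s B" "0 \<le> t" "x \<in> dil t B"
  shows "s c x \<in> dil (norm c * t) B"
proof -
  obtain b where b: "b \<in> B" "x = s (of_real t) b" using assms by (auto simp: dil_def)
  have "s (sgn c) b \<in> B" using assms(1) b(1) by (rule abs_convex_scale) (simp add: norm_sgn)
  moreover have "s c x = s (of_real (norm c * t)) (s (sgn c) b)"
    using b by (simp add: sgn_eq mult.commute)
  ultimately show ?thesis by (rule dilI)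
qed

lemma abs_convex_dil_add:
  assumes "abs_convex s B" "0 \<le> t" "0 \<le> u" "x \<in> dil t B" "y \<in> dil u B"
  shows "x + y \<in> dil (t + u) B"
proof (cases "t + u = 0")
  case True
  then have "t = 0" "u = 0" using assms by auto
  then show ?thesis using assms by (auto simp: dil_def)
next
  case False
  obtain b c where b: "b \<in> B" "x = s (of_real t) b" "c \<in> B" "y = s (of_real u) c"
    using assms by (auto simp: dil_def)
  have "norm (complex_of_real (t / (t + u))) + norm (complex_of_real (u / (t + u))) \<le> 1"
    using assms False unfolding norm_of_real by (simp add: add_divide_distrib[symmetric])
  then have "s (of_real (t / (t + u))) b + s (of_real (u / (t + u))) c \<in> B"
    using abs_convex_comb assms(1) b by blast
  moreover have "x + y = s (of_real (t + u)) (s (of_real (t / (t + u))) b + s (of_real (u / (t + u))) c)"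
    using b False
    by (simp only: scale_right_distrib scale_scale flip: of_real_mult) simp
  ultimately show ?thesis by (rule dilI)
qed

lemma abs_convex_dil_minus:
  assumes "abs_convex s B" "0 \<le> t" "x \<in> dil t B"
  shows "- x \<in> dil t B"
  using abs_convex_dil_scale[OF assms, of "-1"] by simp

lemma abs_convex_dil_diff:
  assumes "abs_convex s B" "0 \<le> t" "0 \<le> u" "x \<in> dil t B" "y \<in> dil u B"
  shows "x - y \<in> dil (t + u) B"
  using abs_convex_dil_add[OF assms(1-4) abs_convex_dil_minus[OF assms(1,3,5)]] by simp

lemma abs_convex_dil_sum:
  assumes "abs_convex s B" "finite I" "\<And>i. i \<in> I \<Longrightarrow> 0 \<le> t i" "\<And>i. i \<in> I \<Longrightarrow> x i \<in> dil (t i) B"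
  shows "(\<Sum>i\<in>I. x i) \<in> dil (\<Sum>i\<in>I. t i) B"
  using assms(2-)
proof (induction I rule: finite_induct)
  case empty
  then show ?case using abs_convex_zero[OF assms(1)] by (force simp: dil_def)
next
  case (insert i I)
  then have "x i + sum x I \<in> dil (t i + sum t I) B"
    by (intro abs_convex_dil_add assms(1) sum_nonneg) auto
  then show ?case using insert.hyps by simp
qed

lemma abs_convex_dil:
  assumes "abs_convex s B"
  shows "abs_convex s (dil t B)"
proof -
  have "s a (s (of_real t) x) + s b (s (of_real t) y) \<in> dil t B"
    if "x \<in> B" "y \<in> B" "norm a + norm b \<le> 1" for x y a b
    using abs_convex_comb[OF assms that]
    by (auto simp: dil_def image_iff scale_right_distrib mult.commute intro!: bexI[of _ "s a x + s b y"])
  then show ?thesis using assms unfolding abs_convex_def by (auto simp: dil_def)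
qed

lemma span_abs_convex_iff:
  assumes "abs_convex s B"
  shows "x \<in> span B \<longleftrightarrow> (\<exists>t>0. x \<in> dil t B)"
proof
  have "subspace {x. \<exists>t>0. x \<in> dil t B}"
    unfolding subspace_def
  proof (intro conjI ballI allI)
    show "0 \<in> {x. \<exists>t>0. x \<in> dil t B}"
      using abs_convex_zero_dil[OF assms, of 1] by (auto intro: exI[of _ 1])
    show "x + y \<in> {x. \<exists>t>0. x \<in> dil t B}"
      if "x \<in> {x. \<exists>t>0. x \<in> dil t B}" "y \<in> {x. \<exists>t>0. x \<in> dil t B}" for x y
    proof -
      obtain t u where "t > 0" "u > 0" "x \<in> dil t B" "y \<in> dil u B" using \<open>x \<in> _\<close> \<open>y \<in> _\<close> by blast
      then have "x + y \<in> dil (t + u) B" using abs_convex_dil_add[OF assms, of t u] by simp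
      then show ?thesis using \<open>t > 0\<close> \<open>u > 0\<close> by (auto intro!: exI[of _ "t + u"])
    qed
    show "s c x \<in> {x. \<exists>t>0. x \<in> dil t B}" if x: "x \<in> {x. \<exists>t>0. x \<in> dil t B}" for c x
    proof -
      obtain t where t: "t > 0" "x \<in> dil t B" using x by blast
      have "s c x \<in> dil (norm c * t) B" using abs_convex_dil_scale[OF assms _ t(2)] t(1) by simp
      moreover have "dil (norm c * t) B \<subseteq> dil (norm c * t + 1) B"
        using t(1) by (intro abs_convex_dil_mono assms) auto
      moreover have "0 < norm c * t + 1" using t(1) by (simp add: add_nonneg_pos)
      ultimately show ?thesis by blast
    qed
  qed
  moreover have "B \<subseteq> {x. \<exists>t>0. x \<in> dil t B}" by (auto intro!: exI[of _ 1])
  ultimately show "x \<in> span B \<Longrightarrow> \<exists>t>0. x \<in> dil t B"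
    using span_minimal by blast
  show "\<exists>t>0. x \<in> dil t B \<Longrightarrow> x \<in> span B" by (auto simp: dil_def intro: span_scale span_base)
qed

lemma minkowski_nonneg: "x \<in> span B \<Longrightarrow> abs_convex s B \<Longrightarrow> 0 \<le> minkowski s B x"
  unfolding minkowski_def span_abs_convex_iff by (rule cInf_greatest) (auto simp: dil_def)

lemma minkowski_le: "0 < t \<Longrightarrow> x \<in> dil t B \<Longrightarrow> minkowski s B x \<le> t"
  unfolding minkowski_def by (rule cInf_lower) (auto simp: dil_def intro: bdd_belowI[of _ 0])

text \<open>The inequality is strict because the infimum in the gauge need not be attained.\<close>

lemma minkowski_less_imp_dil:
  assumes "abs_convex s B" "x \<in> span B" "minkowski s B x < t"
  shows "x \<in> dil t B"
proof -
  have "{t. 0 < t \<and> x \<in> dil t B} \<noteq> {}" using assms span_abs_convex_iff by blast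
  then obtain u where "0 < u" "x \<in> dil u B" "u < t"
    using cInf_lessD[of "{t. 0 < t \<and> x \<in> dil t B}" t] assms(3) unfolding minkowski_def dil_def[symmetric] by auto
  then show ?thesis using abs_convex_dil_mono[OF assms(1), of u t] by auto
qed

lemma minkowski_seminorm_on:
  assumes B: "abs_convex s B"
  shows "seminorm_on s (span B) (minkowski s B)"
proof -
  let ?p = "minkowski s B"
  have nn: "0 \<le> ?p x" if "x \<in> span B" for x using minkowski_nonneg that B .
  have add: "?p (x + y) \<le> ?p x + ?p y" if x: "x \<in> span B" and y: "y \<in> span B" for x y
  proof (rule field_le_epsilon)
    fix e :: real assume e: "0 < e"
    have "x \<in> dil (?p x + e/2) B" "y \<in> dil (?p y + e/2) B"
      using e x y by (auto intro!: minkowski_less_imp_dil[OF B])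
    then have "x + y \<in> dil ((?p x + e/2) + (?p y + e/2)) B"
      using e nn x y by (intro abs_convex_dil_add B) (auto intro: add_nonneg_nonneg)
    then show "?p (x + y) \<le> ?p x + ?p y + e"
      using e nn[OF x] nn[OF y]
      by (intro order_trans[OF minkowski_le[of "(?p x + e/2) + (?p y + e/2)"]]) (auto simp: add_nonneg_pos)
  qed
  have le: "?p (s c x) \<le> norm c * ?p x" if x: "x \<in> span B" and c: "c \<noteq> 0" for x c
  proof -
    have "?p (s c x) / norm c \<le> t" if t: "?p x < t" for t
    proof -
      have t0: "0 < t" using nn[OF x] t by simp
      have "s c x \<in> dil (norm c * t) B"
        using t t0 x by (intro abs_convex_dil_scale B minkowski_less_imp_dil) auto
      then show ?thesis using minkowski_le[of "norm c * t"] t0 c by (simp add: field_simps)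
    qed
    then have "?p (s c x) / norm c \<le> ?p x" by (rule dense_ge)
    then show ?thesis using c by (simp add: field_simps)
  qed
  have "?p 0 \<le> t" if "0 < t" for t using minkowski_le[OF that] abs_convex_zero_dil[OF B] .
  then have "?p 0 \<le> 0" by (rule dense_ge)
  with subspace_span nn add le show ?thesis by (rule seminorm_onI)
qed

end

section \<open>Seminorms describe the topology\<close>

locale lcs = cvs s for s :: "complex \<Rightarrow> 'a::ab_group_add \<Rightarrow> 'a" +
  fixes T :: "'a topology"
  assumes lcHs: "lcHs s T"
begin

abbreviation S where "S \<equiv> topspace T"

lemma subspace_S: "subspace S"
  using lcHs unfolding lcHs_def by blast

lemmas S_add = subspace_add[OF subspace_S] and S_diff = subspace_diff[OF subspace_S]
  and S_scale = subspace_scale[OF subspace_S] and S_zero = subspace_0[OF subspace_S]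
  and S_neg = subspace_neg[OF subspace_S] and S_sum = subspace_sum[OF subspace_S]

lemma continuous_map_translate: "a \<in> S \<Longrightarrow> continuous_map T T (\<lambda>x. a + x)"
proof -
  assume "a \<in> S"
  then have "continuous_map T (prod_topology T T) (\<lambda>x. (a, x))"
    by (simp add: continuous_map_pairwise o_def)
  moreover have "continuous_map (prod_topology T T) T (\<lambda>(x, y). x + y)"
    using lcHs unfolding lcHs_def by blast
  ultimately show ?thesis
    using continuous_map_compose by (fastforce simp: o_def)
qed

lemma continuous_map_dilate: "continuous_map T T (s c)"
proof -
  have "continuous_map T (prod_topology euclidean T) (\<lambda>x. (c, x))"
    by (simp add: continuous_map_pairwise o_def)
  moreover have "continuous_map (prod_topology euclidean T) T (\<lambda>(c, x). s c x)"
    using lcHs unfolding lcHs_def by blast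
  ultimately show ?thesis
    using continuous_map_compose by (fastforce simp: o_def)
qed

lemma continuous_map_orbit: "x \<in> S \<Longrightarrow> continuous_map euclidean T (\<lambda>c. s c x)"
proof -
  assume "x \<in> S"
  then have "continuous_map euclidean (prod_topology euclidean T) (\<lambda>c::complex. (c, x))"
    by (simp add: continuous_map_pairwise o_def)
  moreover have "continuous_map (prod_topology euclidean T) T (\<lambda>(c, x). s c x)"
    using lcHs unfolding lcHs_def by blast
  ultimately show ?thesis
    using continuous_map_compose by (fastforce simp: o_def)
qed

lemma zero_nhd_absorbs:
  assumes "zero_nhd T U" "x \<in> S"
  obtains t where "0 < t" "s (of_real t) x \<in> U"
proof -
  obtain W where W: "openin T W" "0 \<in> W" "W \<subseteq> U" using assms unfolding zero_nhd_def by blast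
  have "openin euclidean {c \<in> topspace euclidean. s c x \<in> W}"
    using openin_continuous_map_preimage[OF continuous_map_orbit[OF assms(2)] W(1)] .
  then have "open {c. s c x \<in> W}" by simp
  moreover have "(0::complex) \<in> {c. s c x \<in> W}" using W by simp
  ultimately obtain e where e: "e > 0" "ball (0::complex) e \<subseteq> {c. s c x \<in> W}"
    using openE by blast
  then have "s (of_real (e/2)) x \<in> W" by (auto simp: subset_iff)
  then show ?thesis using that[of "e/2"] e W by auto
qed

lemma zero_nhd_span: "zero_nhd T U \<Longrightarrow> abs_convex s U \<Longrightarrow> span U = S"
proof
  assume U: "zero_nhd T U" "abs_convex s U"
  then show "span U \<subseteq> S"
    unfolding zero_nhd_def using span_minimal[OF _ subspace_S] by blast
  show "S \<subseteq> span U"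
  proof
    fix x assume "x \<in> S"
    then obtain t where "0 < t" "s (of_real t) x \<in> U" using zero_nhd_absorbs U by blast
    then have "x \<in> dil (1 / t) U" by (subst dil_iff) auto
    then show "x \<in> span U" using span_abs_convex_iff[OF U(2)] \<open>0 < t\<close> by (auto intro!: exI[of _ "1/t"])
  qed
qed

lemma cont_seminorm_seminorm_on: "cont_seminorm s T p \<Longrightarrow> seminorm_on s S p"
  unfolding cont_seminorm_def seminorm_on_def by blast

text \<open>By translation and homogeneity, a bound on one zero neighbourhood controls the
  oscillation of \<open>p\<close> near every point.\<close>

lemma cont_seminormI:
  assumes p: "seminorm_on s S p" and U: "zero_nhd T U" and le: "\<And>x. x \<in> U \<Longrightarrow> p x \<le> 1"
  shows "cont_seminorm s T p"
proof -
  obtain W where W: "openin T W" "0 \<in> W" "W \<subseteq> U" using U unfolding zero_nhd_def by blast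
  have "continuous_map T euclideanreal p"
    unfolding continuous_map_def
  proof (intro conjI allI impI)
    fix V :: "real set" assume "openin euclideanreal V"
    then have V: "open V" by simp
    show "openin T {x \<in> S. p x \<in> V}"
    proof (subst openin_subopen, intro ballI)
      fix x assume x: "x \<in> {x \<in> S. p x \<in> V}"
      then obtain e where e: "e > 0" "ball (p x) e \<subseteq> V" using V openE by blast
      \<comment> \<open>With this factor, c (y - x) in W forces p (y - x) \<le> e / 2, strictly
        below e.\<close>
      define c where "c = complex_of_real (2 / e)"
      have "continuous_map T T (\<lambda>y. s c (- x + y))"
        using continuous_map_compose[OF continuous_map_translate[OF S_neg] continuous_map_dilate, of x c] x
        by (simp add: o_def)
      then have op: "openin T {y \<in> S. s c (- x + y) \<in> W}"
        using W(1) by (rule openin_continuous_map_preimage)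
      have "p y \<in> V" if y: "y \<in> S" "s c (- x + y) \<in> W" for y
      proof -
        have d: "y - x \<in> S" using x y by (auto intro: S_diff)
        have "p (s c (y - x)) \<le> 1" using le W y by auto
        then have "2 / e * p (y - x) \<le> 1"
          using seminorm_onD(3)[OF p d, of c] e by (simp add: c_def norm_divide)
        then have "p (y - x) < e" using e by (simp add: field_simps)
        then have "\<bar>p y - p x\<bar> < e" using seminorm_on_diff(2)[OF p subspace_S y(1), of x] x by auto
        then show ?thesis using e by (auto simp: subset_iff dist_real_def)
      qed
      then show "\<exists>O'. openin T O' \<and> x \<in> O' \<and> O' \<subseteq> {x \<in> S. p x \<in> V}"
        using op x W(2) by (intro exI[of _ "{y \<in> S. s c (- x + y) \<in> W}"]) auto
    qed
  qed auto
  then show ?thesis using p unfolding cont_seminorm_def seminorm_on_def by blast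
qed

lemma minkowski_cont_seminorm:
  assumes "zero_nhd T U" "abs_convex s U"
  shows "cont_seminorm s T (minkowski s U)"
proof (rule cont_seminormI[OF _ assms(1)])
  show "seminorm_on s S (minkowski s U)"
    using minkowski_seminorm_on[OF assms(2)] zero_nhd_span[OF assms] by simp
  show "minkowski s U x \<le> 1" if "x \<in> U" for x
    using that by (intro minkowski_le) auto
qed

lemma zero_nhd_seminorm:
  assumes "zero_nhd T U"
  obtains p where "cont_seminorm s T p" "\<And>x. x \<in> S \<Longrightarrow> p x < 1 \<Longrightarrow> x \<in> U"
proof -
  obtain V where V: "zero_nhd T V" "abs_convex s V" "V \<subseteq> U"
    using assms lcHs unfolding lcHs_def by blast
  have "x \<in> U" if "x \<in> S" "minkowski s V x < 1" for x
    using minkowski_less_imp_dil[OF V(2) _ that(2)] zero_nhd_span[OF V(1,2)] that V(3) by auto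
  then show ?thesis using that minkowski_cont_seminorm[OF V(1,2)] by blast
qed

lemma cont_seminorm_openin:
  assumes "cont_seminorm s T p" "a \<in> S"
  shows "openin T {x \<in> S. p (x - a) < e}"
proof -
  have "continuous_map T euclideanreal (p \<circ> (\<lambda>x. - a + x))"
    using assms continuous_map_translate[OF S_neg] unfolding cont_seminorm_def
    by (blast intro: continuous_map_compose)
  then have "openin T {x \<in> S. (p \<circ> (\<lambda>x. - a + x)) x \<in> {..<e}}"
    by (rule openin_continuous_map_preimage) auto
  then show ?thesis by simp
qed

lemma cont_seminorm_zero_nhd:
  assumes "cont_seminorm s T p" "0 < e"
  shows "zero_nhd T {x \<in> S. p x < e}"
  using cont_seminorm_openin[OF assms(1) S_zero, of e] assms S_zero
    seminorm_on_zero[OF cont_seminorm_seminorm_on[OF assms(1)] subspace_S]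
  unfolding zero_nhd_def by (auto intro!: exI[of _ "{x \<in> S. p x < e}"])

lemma openin_seminorm:
  assumes "openin T W" "a \<in> W"
  obtains p where "cont_seminorm s T p" "\<And>x. x \<in> S \<Longrightarrow> p (x - a) < 1 \<Longrightarrow> x \<in> W"
proof -
  have a: "a \<in> S" using assms openin_subset by blast
  define U where "U = {x \<in> S. a + x \<in> W}"
  have "openin T U"
    unfolding U_def by (rule openin_continuous_map_preimage[OF continuous_map_translate[OF a] assms(1)])
  then have "zero_nhd T U"
    unfolding zero_nhd_def U_def using assms(2) S_zero by auto
  then obtain p where p: "cont_seminorm s T p" "\<And>x. x \<in> S \<Longrightarrow> p x < 1 \<Longrightarrow> x \<in> U"
    using zero_nhd_seminorm by blast
  have "x \<in> W" if "x \<in> S" "p (x - a) < 1" for x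
    using p(2)[OF S_diff[OF that(1) a] that(2)] unfolding U_def by simp
  then show ?thesis using that p(1) by blast
qed

lemma cont_seminorm_scale: "cont_seminorm s T p \<Longrightarrow> 0 \<le> c \<Longrightarrow> cont_seminorm s T (\<lambda>x. c * p x)"
  using seminorm_on_scale[OF cont_seminorm_seminorm_on]
  unfolding cont_seminorm_def seminorm_on_def by (auto intro!: continuous_map_real_mult_left)

lemma limitin_seminormI:
  assumes "l \<in> S" "\<forall>\<^sub>F n in F. f n \<in> S"
    "\<And>p. cont_seminorm s T p \<Longrightarrow> ((\<lambda>n. p (f n - l)) \<longlongrightarrow> 0) F"
  shows "limitin T f l F"
  unfolding limitin_def
proof (intro conjI allI impI assms(1))
  fix W assume "openin T W \<and> l \<in> W"
  then obtain p where p: "cont_seminorm s T p" "\<And>x. x \<in> S \<Longrightarrow> p (x - l) < 1 \<Longrightarrow> x \<in> W"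
    using openin_seminorm by blast
  have "\<forall>\<^sub>F n in F. p (f n - l) < 1"
    using assms(3)[OF p(1)] by (rule order_tendstoD) simp
  with assms(2) show "\<forall>\<^sub>F n in F. f n \<in> W"
    by eventually_elim (use p in blast)
qed

lemma limitin_seminormD:
  assumes "limitin T f l F" "cont_seminorm s T p"
  shows "((\<lambda>n. p (f n - l)) \<longlongrightarrow> 0) F"
proof (rule order_tendstoI)
  have l: "l \<in> S" using assms unfolding limitin_def by blast
  have p: "seminorm_on s S p" using cont_seminorm_seminorm_on assms(2) .
  have p0: "p 0 = 0" using seminorm_on_zero[OF p subspace_S] .
  show "\<forall>\<^sub>F n in F. p (f n - l) < e" if "0 < e" for e
  proof -
    have "\<forall>\<^sub>F n in F. f n \<in> {x \<in> S. p (x - l) < e}"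
      using assms(1) cont_seminorm_openin[OF assms(2) l, of e] l p0 that
      unfolding limitin_def by auto
    then show ?thesis by (rule eventually_mono) auto
  qed
  show "\<forall>\<^sub>F n in F. e < p (f n - l)" if "e < 0" for e
  proof -
    have "\<forall>\<^sub>F n in F. f n \<in> S" using assms(1) unfolding limitin_def by auto
    then show ?thesis by (rule eventually_mono) (use seminorm_onD(1)[OF p S_diff[OF _ l]] that in force)
  qed
qed

lemma tvs_bounded_seminorm:
  assumes "tvs_bounded s T B" "cont_seminorm s T p"
  obtains M where "0 < M" "\<And>x. x \<in> B \<Longrightarrow> p x \<le> M"
proof -
  obtain r where r: "r > 0" "\<And>c. r \<le> norm c \<Longrightarrow> B \<subseteq> s c ` {x \<in> S. p x < 1}"
    using assms(1) cont_seminorm_zero_nhd[OF assms(2), of 1] unfolding tvs_bounded_def by auto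
  have "p x \<le> r" if "x \<in> B" for x
  proof -
    have "x \<in> s (of_real r) ` {x \<in> S. p x < 1}" using r(2)[of "of_real r"] r(1) that by auto
    then obtain y where y: "y \<in> S" "p y < 1" "x = s (of_real r) y" by blast
    then show ?thesis
      using seminorm_onD(3)[OF cont_seminorm_seminorm_on[OF assms(2)] y(1), of "of_real r"] r(1)
      by simp
  qed
  then show ?thesis using that r(1) by blast
qed

lemma tvs_boundedI:
  assumes "B \<subseteq> S" "\<And>p. cont_seminorm s T p \<Longrightarrow> \<exists>M. \<forall>x\<in>B. p x \<le> M"
  shows "tvs_bounded s T B"
  unfolding tvs_bounded_def
proof (intro conjI allI impI assms(1))
  fix U assume "zero_nhd T U"
  then obtain p where p: "cont_seminorm s T p" "\<And>x. x \<in> S \<Longrightarrow> p x < 1 \<Longrightarrow> x \<in> U"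
    using zero_nhd_seminorm by blast
  obtain M where M: "\<And>x. x \<in> B \<Longrightarrow> p x \<le> M" using assms(2)[OF p(1)] by blast
  have "x \<in> s c ` U" if c: "max M 0 + 1 \<le> norm c" and x: "x \<in> B" for c x
  proof -
    have c0: "c \<noteq> 0" using c by auto
    have xS: "x \<in> S" using x assms(1) by blast
    have "p (s (inverse c) x) = p x / norm c"
      using seminorm_onD(3)[OF cont_seminorm_seminorm_on[OF p(1)] xS, of "inverse c"]
      by (simp only: norm_inverse divide_inverse mult.commute)
    moreover have "p x < norm c" using M[OF x] c by linarith
    ultimately have "s (inverse c) x \<in> U" using c0 xS by (intro p(2) S_scale) auto
    moreover have "x = s c (s (inverse c) x)" using c0 by simp
    ultimately show ?thesis by blast
  qed
  \<comment> \<open>The added 1 makes the quotient of p x by the norm of c strictly less than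
    1.\<close>
  then show "\<exists>r>0. \<forall>c. r \<le> norm c \<longrightarrow> B \<subseteq> s c ` U"
    by (intro exI[of _ "max M 0 + 1"]) auto
qed

lemma tvs_bounded_Un:
  assumes "tvs_bounded s T A" "tvs_bounded s T B"
  shows "tvs_bounded s T (A \<union> B)"
proof (rule tvs_boundedI)
  show "A \<union> B \<subseteq> S" using assms unfolding tvs_bounded_def by blast
  fix p assume p: "cont_seminorm s T p"
  obtain M N where "\<And>x. x \<in> A \<Longrightarrow> p x \<le> M" "\<And>x. x \<in> B \<Longrightarrow> p x \<le> N"
    using tvs_bounded_seminorm[OF assms(1) p] tvs_bounded_seminorm[OF assms(2) p] by metis
  then show "\<exists>M. \<forall>x\<in>A \<union> B. p x \<le> M" by (intro exI[of _ "max M N"]) fastforce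
qed

lemma tvs_bounded_dil:
  assumes "tvs_bounded s T B"
  shows "tvs_bounded s T (dil t B)"
proof (rule tvs_boundedI)
  have BS: "B \<subseteq> S" using assms unfolding tvs_bounded_def by blast
  then show "dil t B \<subseteq> S" by (auto simp: dil_def intro: S_scale)
  fix p assume p: "cont_seminorm s T p"
  then obtain M where M: "0 < M" "\<And>x. x \<in> B \<Longrightarrow> p x \<le> M" using tvs_bounded_seminorm assms by blast
  have "p (s (of_real t) x) \<le> \<bar>t\<bar> * M" if "x \<in> B" for x
    using seminorm_onD(3)[OF cont_seminorm_seminorm_on[OF p], of x "of_real t"] M(2)[OF that] that BS
      mult_left_mono[OF M(2)[OF that], of "\<bar>t\<bar>"] by auto
  then show "\<exists>M. \<forall>x\<in>dil t B. p x \<le> M" by (auto simp: dil_def)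
qed

lemma dual_iff: "f \<in> dual s T \<longleftrightarrow> linear_on s S f \<and> cont_seminorm s T (\<lambda>x. norm (f x))"
proof
  assume "f \<in> dual s T"
  then have f: "linear_on s S f" "continuous_map T euclidean f"
    unfolding dual_def cont_linear_def linear_on_def by auto
  have "continuous_map T euclideanreal (\<lambda>x. norm (f x))"
    using f(2) by (rule continuous_map_norm)
  then show "linear_on s S f \<and> cont_seminorm s T (\<lambda>x. norm (f x))"
    using f(1) linear_on_seminorm[OF f(1)] unfolding cont_seminorm_def seminorm_on_def by blast
next
  assume f: "linear_on s S f \<and> cont_seminorm s T (\<lambda>x. norm (f x))"
  have "continuous_map T euclidean f"
    unfolding continuous_map_def
  proof (intro conjI allI impI)
    fix V :: "complex set" assume "openin euclidean V"
    then have V: "open V" by simp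
    show "openin T {x \<in> S. f x \<in> V}"
    proof (subst openin_subopen, intro ballI)
      fix x assume x: "x \<in> {x \<in> S. f x \<in> V}"
      then obtain e where e: "e > 0" "ball (f x) e \<subseteq> V" using V openE by blast
      have "f y \<in> V" if y: "y \<in> S" "norm (f (y - x)) < e" for y
        using linear_on_diff[of S f y x] f subspace_S x y e
        by (auto simp: subset_iff dist_norm norm_minus_commute)
      moreover have "openin T {y \<in> S. norm (f (y - x)) < e}"
        using cont_seminorm_openin[of "\<lambda>x. norm (f x)" x e] f x by simp
      moreover have "norm (f (x - x)) < e" using linear_on_zero[of S f] f subspace_S e by simp
      ultimately show "\<exists>O'. openin T O' \<and> x \<in> O' \<and> O' \<subseteq> {x \<in> S. f x \<in> V}"
        using x by (intro exI[of _ "{y \<in> S. norm (f (y - x)) < e}"]) auto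
    qed
  qed auto
  then show "f \<in> dual s T"
    using f unfolding dual_def cont_linear_def linear_on_def by auto
qed

lemma dualI:
  assumes f: "linear_on s S f" and p: "cont_seminorm s T p" and C: "0 \<le> C"
    and le: "\<And>x. x \<in> S \<Longrightarrow> norm (f x) \<le> C * p x"
  shows "f \<in> dual s T"
  unfolding dual_iff
proof
  show "cont_seminorm s T (\<lambda>x. norm (f x))"
  proof (rule cont_seminormI[OF linear_on_seminorm[OF f]])
    show "zero_nhd T {x \<in> S. C * p x < 1}"
      by (rule cont_seminorm_zero_nhd[OF cont_seminorm_scale[OF p C]]) simp
    show "norm (f x) \<le> 1" if "x \<in> {x \<in> S. C * p x < 1}" for x
      using le[of x] that by auto
  qed
qed (rule f)

text \<open>The constant sequence x would also converge to 0, against uniqueness of limits in a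
  Hausdorff space.\<close>

lemma seminorms_separate:
  assumes "x \<in> S" "\<And>p. cont_seminorm s T p \<Longrightarrow> p x = 0"
  shows "x = 0"
proof -
  have "limitin T (\<lambda>n::nat. x) x sequentially"
    using assms(1) by (simp add: limitin_const_iff)
  moreover have "limitin T (\<lambda>n::nat. x) 0 sequentially"
  proof (rule limitin_seminormI)
    show "(\<lambda>n::nat. p (x - 0)) \<longlonglongrightarrow> 0" if "cont_seminorm s T p" for p
      using assms(2)[OF that] by simp
  qed (use assms(1) S_zero in auto)
  moreover have "Hausdorff_space T" using lcHs unfolding lcHs_def by blast
  ultimately show ?thesis using limitin_Hausdorff_unique by fastforce
qed

section \<open>Banach disks\<close>

lemma banach_disk_abs_convex: "banach_disk s T D \<Longrightarrow> abs_convex s D"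
  and banach_disk_bounded: "banach_disk s T D \<Longrightarrow> tvs_bounded s T D"
  unfolding banach_disk_def by blast+

lemma tvs_bounded_subset_S: "tvs_bounded s T B \<Longrightarrow> B \<subseteq> S"
  unfolding tvs_bounded_def by blast

lemma banach_disk_span: "banach_disk s T D \<Longrightarrow> span D \<subseteq> S"
  using span_minimal[OF tvs_bounded_subset_S[OF banach_disk_bounded] subspace_S] .

text \<open>Continuity of the inclusion of the normed space spanned by D. Both forms occur below:
  dilations for explicit estimates, the gauge for limits.\<close>

lemma banach_disk_dominates:
  assumes D: "banach_disk s T D" and p: "cont_seminorm s T p"
  obtains M where "0 < M" "\<And>t x. 0 \<le> t \<Longrightarrow> x \<in> dil t D \<Longrightarrow> p x \<le> t * M"
    "\<And>x. x \<in> span D \<Longrightarrow> p x \<le> M * minkowski s D x"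
proof -
  have DS: "D \<subseteq> S" by (rule tvs_bounded_subset_S[OF banach_disk_bounded[OF D]])
  obtain M where M: "0 < M" "\<And>x. x \<in> D \<Longrightarrow> p x \<le> M"
    using tvs_bounded_seminorm[OF banach_disk_bounded[OF D] p] by blast
  have le: "p x \<le> t * M" if t: "0 \<le> t" and x: "x \<in> dil t D" for t x
  proof -
    obtain d where d: "d \<in> D" "x = s (of_real t) d" using x by (auto simp: dil_def)
    then have "p x = t * p d"
      using seminorm_onD(3)[OF cont_seminorm_seminorm_on[OF p], of d "of_real t"] DS t by auto
    then show ?thesis using M(2)[OF d(1)] t by (simp add: mult_left_mono)
  qed
  have "p x \<le> M * minkowski s D x" if x: "x \<in> span D" for x
  proof -
    have "p x / M \<le> t" if "minkowski s D x < t" for t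
    proof -
      have "0 \<le> t" using that minkowski_nonneg[OF x banach_disk_abs_convex[OF D]] by simp
      then show ?thesis
        using le[of t x] minkowski_less_imp_dil[OF banach_disk_abs_convex[OF D] x that] M(1)
        by (simp add: field_simps)
    qed
    then have "p x / M \<le> minkowski s D x" by (rule dense_ge)
    then show ?thesis using M(1) by (simp add: field_simps)
  qed
  then show ?thesis using that M(1) le by blast
qed

text \<open>Each new Banach disk is chosen around the previous disk together with the next bounded
  set, which makes the sequence increasing.\<close>

lemma banach_disk_sequence:
  assumes lc: "locally_complete s T" and B: "fundamental_bounded s T B"
  obtains D where "\<And>n. banach_disk s T (D n)" "incseq D" "fundamental_bounded s T D"
proof -
  have *: "\<exists>D. banach_disk s T D \<and> A \<subseteq> D" if "tvs_bounded s T A" for A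
    using lc that unfolding locally_complete_def by blast
  have Bb: "tvs_bounded s T (B n)" for n using B unfolding fundamental_bounded_def by blast
  have "\<exists>D. \<forall>n. (banach_disk s T (D n) \<and> B n \<subseteq> D n) \<and> D n \<subseteq> D (Suc n)"
  proof (rule dependent_nat_choice)
    show "\<exists>D. banach_disk s T D \<and> B 0 \<subseteq> D" using *[OF Bb] .
    show "\<exists>E. (banach_disk s T E \<and> B (Suc n) \<subseteq> E) \<and> D \<subseteq> E"
      if "banach_disk s T D \<and> B n \<subseteq> D" for D n
      using *[OF tvs_bounded_Un[OF banach_disk_bounded[of D] Bb[of "Suc n"]]] that by blast
  qed
  then obtain D where D: "\<And>n. banach_disk s T (D n)" "\<And>n. B n \<subseteq> D n" "\<And>n. D n \<subseteq> D (Suc n)"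
    by blast
  have "fundamental_bounded s T D"
    unfolding fundamental_bounded_def
  proof (intro conjI allI impI)
    show "tvs_bounded s T (D n)" for n using banach_disk_bounded D(1) .
    show "\<exists>n. A \<subseteq> D n" if "tvs_bounded s T A" for A
      using B that D(2) unfolding fundamental_bounded_def by (meson order_trans)
  qed
  then show ?thesis using that D(1) incseq_SucI[of D] D(3) by blast
qed

text \<open>By Baire's theorem in the Banach space spanned by D, the closure of some A n contains a
  ball. Symmetry and convexity move the ball to the origin. Since only closures are controlled, the
  conclusion carries an arbitrarily small error from D.\<close>

lemma banach_disk_Baire:
  assumes D: "banach_disk s T D" and A: "\<And>n::nat. abs_convex s (A n)"
    and cover: "span D \<subseteq> (\<Union>n. A n)"
  obtains n t where "0 < t" "\<And>x e. x \<in> D \<Longrightarrow> 0 < e \<Longrightarrow> \<exists>y\<in>dil t (A n). x - y \<in> dil e D"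
proof -
  let ?p = "minkowski s D"
  \<comment> \<open>\<open>Metric_space\<close> asks for nonnegativity and symmetry at all points of
    the type, hence a default value off the span.\<close>
  define d where "d = (\<lambda>x y. if x \<in> span D \<and> y \<in> span D then ?p (x - y) else 0)"
  have Da: "abs_convex s D" by (rule banach_disk_abs_convex[OF D])
  have p: "seminorm_on s (span D) ?p" by (rule minkowski_seminorm_on[OF Da])
  \<comment> \<open>The gauge is a norm: it dominates every continuous seminorm up to a factor, and
    these separate points.\<close>
  have p0: "z = 0" if z: "z \<in> span D" "?p z = 0" for z
  proof (rule seminorms_separate)
    show zS: "z \<in> S" using z banach_disk_span[OF D] by blast
    fix q assume q: "cont_seminorm s T q"
    obtain M where "q z \<le> M * ?p z" using banach_disk_dominates[OF D q] z by metis
    then show "q z = 0"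
      using z seminorm_onD(1)[OF cont_seminorm_seminorm_on[OF q] zS] by simp
  qed
  interpret M: Metric_space "span D" d
  proof
    show "0 \<le> d x y" for x y
      unfolding d_def using seminorm_onD(1)[OF p span_diff] by auto
    show "d x y = d y x" for x y
      unfolding d_def using seminorm_on_diff(3)[OF p subspace_span] by auto
    show "d x y = 0 \<longleftrightarrow> x = y" if "x \<in> span D" "y \<in> span D" for x y
      using p0[OF span_diff[OF that]] seminorm_on_zero[OF p subspace_span] that unfolding d_def by auto
    show "d x z \<le> d x y + d y z" if "x \<in> span D" "y \<in> span D" "z \<in> span D" for x y z
      using seminorm_onD(2)[OF p span_diff[OF that(1,2)] span_diff[OF that(2,3)]] that
      unfolding d_def by simp
  qed
  have complete: "M.mcomplete"
    unfolding M.mcomplete_def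
  proof (intro allI impI)
    fix x assume x: "M.MCauchy x"
    then have xS: "\<And>n. x n \<in> span D" unfolding M.MCauchy_def by blast
    have "\<forall>\<epsilon>>0. \<exists>n0. \<forall>m\<ge>n0. \<forall>n\<ge>n0. ?p (x m - x n) < \<epsilon>"
      using x xS unfolding M.MCauchy_def by (simp add: d_def)
    then obtain l where l: "l \<in> span D" "(\<lambda>n. ?p (x n - l)) \<longlonglongrightarrow> 0"
      using D xS unfolding banach_disk_def by blast
    have "limitin M.mtopology x l sequentially"
      unfolding M.limitin_metric
    proof (intro conjI l(1) allI impI)
      fix e :: real assume "0 < e"
      then have "\<forall>\<^sub>F n in sequentially. ?p (x n - l) < e" using order_tendstoD(2)[OF l(2)] by blast
      then show "\<forall>\<^sub>F n in sequentially. x n \<in> span D \<and> d (x n) l < e"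
        by (rule eventually_mono) (use xS l(1) in \<open>simp add: d_def\<close>)
    qed
    then show "\<exists>l. limitin M.mtopology x l sequentially" by blast
  qed
  define C where "C = (\<lambda>n. M.mtopology closure_of (A n))"
  have "\<exists>n. M.mtopology interior_of (C n) \<noteq> {}"
  proof (rule ccontr)
    assume "\<nexists>n. M.mtopology interior_of (C n) \<noteq> {}"
    then have "M.mtopology interior_of (\<Union>(range C)) = {}"
      by (intro M.metric_Baire_category_alt complete) (auto simp: C_def)
    moreover have "span D \<subseteq> \<Union>(range C)"
    proof
      fix x assume x: "x \<in> span D"
      then obtain n where "x \<in> A n" using cover by blast
      then have "x \<in> C n"
        unfolding C_def using closure_of_subset_Int[of M.mtopology "A n"] x by auto
      then show "x \<in> \<Union>(range C)" by blast
    qed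
    then have "M.mtopology interior_of (\<Union>(range C)) = span D"
      by (metis M.topspace_mtopology interior_of_maximal_eq interior_of_subset_topspace
          openin_topspace subset_antisym)
    ultimately show False using span_zero by blast
  qed
  then obtain n a \<rho> where a: "a \<in> span D" "0 < \<rho>" "M.mball a \<rho> \<subseteq> C n"
    unfolding M.metric_interior_of by blast
  have approx: "\<exists>y\<in>A n. z - y \<in> dil e D" if z: "z \<in> span D" "?p (z - a) < \<rho>" and e: "0 < e" for z e
  proof -
    have "z \<in> M.mball a \<rho>"
      using z a(1) seminorm_on_diff(3)[OF p subspace_span z(1) a(1)]
      unfolding M.in_mball by (simp add: d_def)
    then obtain y where y: "y \<in> A n" "y \<in> M.mball z e"
      using a(3) e unfolding C_def M.metric_closure_of by blast
    then have "?p (z - y) < e" "y \<in> span D" using z unfolding M.in_mball by (auto simp: d_def)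
    then show ?thesis using y minkowski_less_imp_dil[OF Da span_diff[OF z(1)]] by blast
  qed
  have "\<exists>y\<in>dil (2/\<rho>) (A n). x - y \<in> dil e D" if x: "x \<in> D" and e: "0 < e" for x e
  proof -
    \<comment> \<open>Half the radius, so that both a + c x and a - c x lie inside the ball around
      a.\<close>
    define c where "c = complex_of_real (\<rho>/2)"
    have xs: "s c x \<in> span D" using x by (intro span_scale span_base)
    have "?p x \<le> 1" using x by (intro minkowski_le) auto
    then have "\<rho> * ?p x \<le> \<rho> * 1" using a(2) by (intro mult_left_mono) auto
    moreover have "2 * ?p (s c x) = \<rho> * ?p x"
      using seminorm_onD(3)[OF p span_base[OF x], of c] a(2) by (simp add: c_def)
    ultimately have psx: "?p (s c x) < \<rho>" using a(2) by linarith
    obtain y where y: "y \<in> A n" "(a + s c x) - y \<in> dil (e * \<rho>/2) D"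
      using approx[of "a + s c x" "e * \<rho>/2"] a(1,2) xs psx e by (auto intro: span_add)
    obtain z where z: "z \<in> A n" "(a - s c x) - z \<in> dil (e * \<rho>/2) D"
      using approx[of "a - s c x" "e * \<rho>/2"] a(1,2) xs psx e seminorm_on_minus[OF p xs]
      by (auto intro: span_diff)
    \<comment> \<open>Half the difference of the two approximants approximates c x: the centre a
      cancels. Dilating by 2/\<rho> returns to x, and the two errors e \<rho>/2 become e.\<close>
    define w where "w = s (1/2) y + s (-1/2) z"
    have w: "w \<in> A n" unfolding w_def by (rule abs_convex_comb[OF A y(1) z(1)]) simp
    have "((a + s c x) - y) - ((a - s c x) - z) \<in> dil (e * \<rho>/2 + e * \<rho>/2) D"
      using a(2) e by (intro abs_convex_dil_diff[OF Da _ _ y(2) z(2)]) auto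
    then have "s (of_real (1/\<rho>)) (((a + s c x) - y) - ((a - s c x) - z)) \<in> dil (norm (complex_of_real (1/\<rho>)) * (e * \<rho>/2 + e * \<rho>/2)) D"
      using a(2) e by (intro abs_convex_dil_scale[OF Da]) auto
    moreover have "s (of_real (1/\<rho>)) (((a + s c x) - y) - ((a - s c x) - z)) = x - s (of_real (2/\<rho>)) w"
    proof -
      have "s (of_real (1/\<rho>)) (((a + s c x) - y) - ((a - s c x) - z)) = s (of_real (1/\<rho>)) (s c x + s c x) - s (of_real (1/\<rho>)) (y - z)"
        by (simp add: scale_right_diff_distrib scale_right_distrib algebra_simps)
      also have "s (of_real (1/\<rho>)) (s c x + s c x) = x"
        using a(2) by (simp add: c_def scale_right_distrib flip: scale_left_distrib)
      also have "s (of_real (1/\<rho>)) (y - z) = s (of_real (2/\<rho>)) w"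
        by (simp add: w_def scale_right_diff_distrib scale_right_distrib)
      finally show ?thesis .
    qed
    moreover have "norm (complex_of_real (1/\<rho>)) * (e * \<rho>/2 + e * \<rho>/2) = e"
      using a(2) by (simp add: norm_divide)
    ultimately have "x - s (of_real (2/\<rho>)) w \<in> dil e D" by (simp only:)
    then show ?thesis using dilI[OF w refl] by blast
  qed
  then show ?thesis using that[of "2/\<rho>" n] a(2) by simp
qed

section \<open>The dual with the topology of uniform convergence on absolutely convex compact sets\<close>

lemma dual_add: "f \<in> dual s T \<Longrightarrow> g \<in> dual s T \<Longrightarrow> (\<lambda>x. f x + g x) \<in> dual s T"
  using continuous_map_add[of T f g] unfolding dual_def cont_linear_def
  by (simp add: distrib_left)

lemma dual_scale: "f \<in> dual s T \<Longrightarrow> (\<lambda>x. c * f x) \<in> dual s T"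
  using continuous_map_compose[of T euclidean f euclidean "\<lambda>z. c * z"]
  unfolding dual_def cont_linear_def
  by (simp add: distrib_left o_def mult.left_commute continuous_intros)

lemma dual_zero: "(\<lambda>x. 0) \<in> dual s T"
  unfolding dual_def cont_linear_def by auto

lemma compactin_zero: "compactin T {0}" "abs_convex s {0}"
  by (auto simp: S_zero abs_convex_def finite_imp_compactin)

text \<open>The carrier is the union of the generating sets; those with K = {0} already cover the
  dual.\<close>

lemma topspace_dual_c: "topspace (dual_c s T) = dual s T"
proof -
  let ?B = "{{g \<in> dual s T. \<forall>x\<in>K. norm (g x - f x) < \<epsilon>} | f K \<epsilon>.
    f \<in> dual s T \<and> compactin T K \<and> abs_convex s K \<and> (0::real) < \<epsilon>}"
  have "f \<in> \<Union> ?B" if "f \<in> dual s T" for f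
    by (rule UnionI[of "{g \<in> dual s T. \<forall>x\<in>{0}. norm (g x - f x) < 1}"])
      (use that compactin_zero in \<open>blast intro: zero_less_one, simp\<close>)
  then show ?thesis unfolding dual_c_def by auto
qed

lemma dual_c_basic_openin:
  assumes "f \<in> dual s T" "compactin T K" "abs_convex s K" "0 < e"
  shows "openin (dual_c s T) {g \<in> dual s T. \<forall>x\<in>K. norm (g x - f x) < e}"
  unfolding dual_c_def by (rule topology_generated_by_Basis) (use assms in blast)

lemma compactin_bounded_above:
  assumes "compactin T K" "continuous_map T euclideanreal h" "K \<noteq> {}"
  obtains x where "x \<in> K" "\<And>y. y \<in> K \<Longrightarrow> h y \<le> h x"
proof -
  have "compact (h ` K)" using image_compactin[OF assms(1,2)] by simp
  then obtain m where "m \<in> h ` K" "\<And>t. t \<in> h ` K \<Longrightarrow> t \<le> m"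
    using compact_attains_sup[of "h ` K"] assms(3) by blast
  then show ?thesis using that by blast
qed

text \<open>Functionals dominated by \<open>p\<close> form a bounded set of \<open>dual_c\<close>.
  As the topology is given by generators, this is an induction over generated open sets containing
  0.\<close>

lemma dual_c_absorbs_polars:
  assumes W: "openin (dual_c s T) W" "(\<lambda>x. 0) \<in> W" and p: "cont_seminorm s T p"
  obtains \<delta> where "0 < \<delta>"
    "\<And>f c. f \<in> dual s T \<Longrightarrow> (\<And>x. x \<in> S \<Longrightarrow> norm (f x) \<le> p x) \<Longrightarrow> norm c \<le> \<delta> \<Longrightarrow> (\<lambda>x. c * f x) \<in> W"
proof -
  define P where "P = (\<lambda>W. \<exists>\<delta>>0. \<forall>f\<in>dual s T. (\<forall>x\<in>S. norm (f x) \<le> p x) \<longrightarrow>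
    (\<forall>c. norm c \<le> \<delta> \<longrightarrow> (\<lambda>x. c * f x) \<in> W))"
  have "(\<lambda>x. 0) \<in> W \<Longrightarrow> P W"
    using openin_topology_generated_by[OF W(1)[unfolded dual_c_def]]
  proof (induction rule: generate_topology_on.induct)
    case Empty
    then show ?case by simp
  next
    case (Int a b)
    then obtain \<delta> \<epsilon> where
      "\<delta> > 0" "\<forall>f\<in>dual s T. (\<forall>x\<in>S. norm (f x) \<le> p x) \<longrightarrow> (\<forall>c. norm c \<le> \<delta> \<longrightarrow> (\<lambda>x. c * f x) \<in> a)"
      "\<epsilon> > 0" "\<forall>f\<in>dual s T. (\<forall>x\<in>S. norm (f x) \<le> p x) \<longrightarrow> (\<forall>c. norm c \<le> \<epsilon> \<longrightarrow> (\<lambda>x. c * f x) \<in> b)"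
      unfolding P_def by blast
    then show ?case unfolding P_def by (intro exI[of _ "min \<delta> \<epsilon>"]) auto
  next
    case (UN K)
    then obtain k where "k \<in> K" "P k" by blast
    then show ?case unfolding P_def by blast
  next
    case (Basis V)
    then obtain f K e where V: "V = {g \<in> dual s T. \<forall>x\<in>K. norm (g x - f x) < e}"
      "f \<in> dual s T" "compactin T K" "abs_convex s K" "0 < e" by blast
    have K: "K \<noteq> {}" "K \<subseteq> S"
      using V compactin_subset_topspace unfolding abs_convex_def by auto
    have "continuous_map T euclideanreal (\<lambda>x. norm (f x))"
      using V(2) unfolding dual_iff cont_seminorm_def by blast
    then obtain a where a: "a \<in> K" "\<And>x. x \<in> K \<Longrightarrow> norm (f x) \<le> norm (f a)"
      using compactin_bounded_above[OF V(3) _ K(1)] by metis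
    have "norm (f a) < e" using Basis(2) a(1) unfolding V(1) by auto
    obtain b where b: "b \<in> K" "\<And>x. x \<in> K \<Longrightarrow> p x \<le> p b"
      using compactin_bounded_above[OF V(3) _ K(1)] p unfolding cont_seminorm_def by metis
    have pb: "0 \<le> p b" using b(1) K p unfolding cont_seminorm_def by blast
    \<comment> \<open>A generator containing 0 may be centred at f \<noteq> 0, so the room left is e
      minus the maximum of the norm of f on K, attained at a by compactness. Half of this gap is
      spent; the 1 guards against p b = 0.\<close>
    define \<delta> where "\<delta> = (e - norm (f a)) / (2 * (p b + 1))"
    have \<delta>: "0 < \<delta>" using \<open>norm (f a) < e\<close> pb by (simp add: \<delta>_def)
    have "(\<lambda>x. c * g x) \<in> V" if g: "g \<in> dual s T" "\<forall>x\<in>S. norm (g x) \<le> p x" "norm c \<le> \<delta>" for g c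
    proof -
      have "norm (c * g x - f x) < e" if x: "x \<in> K" for x
      proof -
        have "norm (g x) \<le> p b" using g(2) b(2)[OF x] K x by force
        then have "norm c * norm (g x) \<le> \<delta> * p b" using g(3) \<delta> by (intro mult_mono) auto
        also have "\<dots> \<le> \<delta> * (p b + 1)" using \<delta> by simp
        also have "\<dots> = (e - norm (f a)) / 2" using pb by (simp add: \<delta>_def field_simps)
        finally have "norm (c * g x) < e - norm (f a)" using \<open>norm (f a) < e\<close> by (simp add: norm_mult)
        then show ?thesis
          using norm_triangle_ineq4[of "c * g x" "f x"] a(2)[OF x] by linarith
      qed
      then show ?thesis using dual_scale[OF g(1), of c] unfolding V(1) by blast
    qed
    then show ?case unfolding P_def using \<delta> by blast
  qed
  then show ?thesis using W(2) that unfolding P_def by blast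
qed

end

section \<open>Elements of the epsilon product and their values on polars\<close>

locale lcs_pair = G: lcs sG TG + E: lcs sE TE
  for sG :: "complex \<Rightarrow> 'g::ab_group_add \<Rightarrow> 'g" and TG
    and sE :: "complex \<Rightarrow> 'e::ab_group_add \<Rightarrow> 'e" and TE
begin

lemma eps_productD:
  assumes "R \<in> eps_product sG TG sE TE"
  shows "continuous_map (dual_c sG TG) TE R"
    "f \<in> dual sG TG \<Longrightarrow> g \<in> dual sG TG \<Longrightarrow> R (\<lambda>x. f x + g x) = R f + R g"
    "f \<in> dual sG TG \<Longrightarrow> R (\<lambda>x. c * f x) = sE c (R f)"
    "f \<in> dual sG TG \<Longrightarrow> R f \<in> E.S"
proof -
  show c: "continuous_map (dual_c sG TG) TE R"
    using assms unfolding eps_product_def cont_linear_def by blast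
  show "f \<in> dual sG TG \<Longrightarrow> R f \<in> E.S"
    using continuous_map_funspace[OF c] unfolding G.topspace_dual_c by blast
  show "R (\<lambda>x. c * f x) = sE c (R f)" if "f \<in> dual sG TG"
    using assms that unfolding eps_product_def cont_linear_def G.topspace_dual_c fun_scale_def by blast
  have "R (f + g) = R f + R g" if "f \<in> dual sG TG" "g \<in> dual sG TG"
    using assms that unfolding eps_product_def cont_linear_def G.topspace_dual_c by blast
  then show "f \<in> dual sG TG \<Longrightarrow> g \<in> dual sG TG \<Longrightarrow> R (\<lambda>x. f x + g x) = R f + R g"
    by (simp add: plus_fun_def)
qed

text \<open>A continuous linear map preserves boundedness, and the polar is absorbed by zero
  neighbourhoods of \<open>dual_c\<close>. This places R of a whole polar in one member of a
  fundamental sequence of bounded sets.\<close>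

lemma eps_product_image_polar_bounded:
  assumes R: "R \<in> eps_product sG TG sE TE" and p: "cont_seminorm sG TG p"
  shows "tvs_bounded sE TE (R ` {f \<in> dual sG TG. \<forall>x\<in>G.S. norm (f x) \<le> p x})"
proof (rule E.tvs_boundedI)
  show "R ` {f \<in> dual sG TG. \<forall>x\<in>G.S. norm (f x) \<le> p x} \<subseteq> E.S"
    using eps_productD(4)[OF R] by blast
  fix q assume q: "cont_seminorm sE TE q"
  note q' = E.cont_seminorm_seminorm_on[OF q]
  define W where "W = {f \<in> topspace (dual_c sG TG). R f \<in> {e \<in> E.S. q (e - 0) < 1}}"
  have "openin (dual_c sG TG) W"
    unfolding W_def using eps_productD(1)[OF R] E.cont_seminorm_openin[OF q E.S_zero]
    by (rule openin_continuous_map_preimage)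
  moreover have "R (\<lambda>x. 0) = 0" using eps_productD(3)[OF R G.dual_zero, of 0] by simp
  then have "(\<lambda>x. 0) \<in> W"
    using E.seminorm_on_zero[OF q' E.subspace_S]
    unfolding W_def G.topspace_dual_c by (simp add: G.dual_zero E.S_zero)
  ultimately obtain \<delta> where \<delta>: "0 < \<delta>" "\<And>f c. f \<in> dual sG TG \<Longrightarrow>
      (\<And>x. x \<in> G.S \<Longrightarrow> norm (f x) \<le> p x) \<Longrightarrow> norm c \<le> \<delta> \<Longrightarrow> (\<lambda>x. c * f x) \<in> W"
    using G.dual_c_absorbs_polars[OF _ _ p] by metis
  have "q (R f) \<le> 1 / \<delta>" if f: "f \<in> dual sG TG" "\<forall>x\<in>G.S. norm (f x) \<le> p x" for f
  proof -
    have "(\<lambda>x. of_real \<delta> * f x) \<in> W" using \<delta> f by auto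
    then have "q (sE (of_real \<delta>) (R f)) < 1"
      using eps_productD(3)[OF R f(1), of "of_real \<delta>"] unfolding W_def by simp
    then have "\<delta> * q (R f) < 1"
      using E.seminorm_onD(3)[OF q' eps_productD(4)[OF R f(1)], of "of_real \<delta>"] \<delta> by simp
    then show ?thesis using \<delta> by (simp add: field_simps)
  qed
  then show "\<exists>M. \<forall>x\<in>R ` {f \<in> dual sG TG. \<forall>x\<in>G.S. norm (f x) \<le> p x}. q x \<le> M" by blast
qed

end

section \<open>Necessity of condition (A)\<close>

context lcs
begin

text \<open>The underlined (DN) fixes n before m, so the seminorm \<open>p\<close> can precede f.
  Once f is bounded by some p m, interpolation between p n and p k bounds it, for every r, by a sum
  of two seminorms, and \<open>functional_decomposition\<close> splits it accordingly.\<close>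

lemma dual_split_uDN:
  assumes "cond_uDN s T"
  obtains p where "cont_seminorm s T p"
    "\<And>f. f \<in> dual s T \<Longrightarrow> \<exists>\<nu>>0. \<exists>C>0. \<exists>q. cont_seminorm s T q \<and> (\<forall>r>0. \<exists>g\<in>dual s T. \<exists>h\<in>dual s T.
      f = (\<lambda>x. g x + h x) \<and> (\<forall>x\<in>S. norm (g x) \<le> C * r * q x) \<and> (\<forall>x\<in>S. norm (h x) \<le> C / r powr \<nu> * p x))"
proof -
  obtain p n where p: "fundamental_seminorms s T p" "\<And>n x. x \<in> S \<Longrightarrow> p n x \<le> p (Suc n) x"
    and DN: "\<And>m. n \<le> m \<Longrightarrow> \<exists>\<theta>\<in>{0<..<1}. \<exists>k\<ge>m. \<exists>C>0. \<forall>x\<in>S.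
        p m x \<le> C * p n x powr \<theta> * p k x powr (1 - \<theta>)"
    using assms unfolding cond_uDN_def by blast
  have pc: "cont_seminorm s T (p n)" for n using p(1) unfolding fundamental_seminorms_def by blast
  note psem = cont_seminorm_seminorm_on[OF pc]
  have mono: "p a x \<le> p b x" if "a \<le> b" "x \<in> S" for a b x
    using that(1) by (rule lift_Suc_mono_le[of "\<lambda>n. p n x", rotated]) (rule p(2)[OF that(2)])
  have "\<exists>\<nu>>0. \<exists>C>0. \<exists>q. cont_seminorm s T q \<and> (\<forall>r>0. \<exists>g\<in>dual s T. \<exists>h\<in>dual s T.
      f = (\<lambda>x. g x + h x) \<and> (\<forall>x\<in>S. norm (g x) \<le> C * r * q x) \<and>
      (\<forall>x\<in>S. norm (h x) \<le> C / r powr \<nu> * p n x))"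
    if f: "f \<in> dual s T" for f
  proof -
    have flin: "linear_on s S f" using f dual_iff by blast
    obtain m' C1 where C1: "C1 > 0" "\<And>x. x \<in> S \<Longrightarrow> norm (f x) \<le> C1 * p m' x"
      using f p(1) unfolding dual_iff fundamental_seminorms_def by blast
    define m where "m = max m' n"
    obtain \<theta> k C2 where \<theta>: "0 < \<theta>" "\<theta> < 1" "k \<ge> m" "C2 > 0"
      and le2: "\<And>x. x \<in> S \<Longrightarrow> p m x \<le> C2 * p n x powr \<theta> * p k x powr (1 - \<theta>)"
      using DN[of m] unfolding m_def by auto
    \<comment> \<open>The exponent for which the powers of r in the geometric mean cancel: \<nu>
      \<theta> = 1 - \<theta>.\<close>
    define \<nu> where "\<nu> = (1 - \<theta>) / \<theta>"
    define C where "C = C1 * C2"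
    have \<nu>: "\<nu> > 0" and C: "C > 0" using \<theta> C1 by (auto simp: \<nu>_def C_def)
    have "\<exists>g\<in>dual s T. \<exists>h\<in>dual s T.
      f = (\<lambda>x. g x + h x) \<and> (\<forall>x\<in>S. norm (g x) \<le> C * r * p k x) \<and>
      (\<forall>x\<in>S. norm (h x) \<le> C / r powr \<nu> * p n x)" if r: "0 < r" for r
    proof -
      have le: "norm (f x) \<le> C * r * p k x + C / r powr \<nu> * p n x" if x: "x \<in> S" for x
      proof -
        have nn: "0 \<le> p n x" "0 \<le> p k x" using seminorm_onD(1)[OF psem x] by auto
        have "(p n x / r powr \<nu>) powr \<theta> * (r * p k x) powr (1 - \<theta>) =
            p n x powr \<theta> * p k x powr (1 - \<theta>) * (r powr (1 - \<theta>) / r powr (\<nu> * \<theta>))"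
          using nn r by (simp add: powr_divide powr_mult powr_powr)
        also have "r powr (1 - \<theta>) / r powr (\<nu> * \<theta>) = 1" using \<theta> r by (simp add: \<nu>_def)
        finally have "p n x powr \<theta> * p k x powr (1 - \<theta>) \<le> max (p n x / r powr \<nu>) (r * p k x)"
          using mult_powr_le_max[of "p n x / r powr \<nu>" "r * p k x" \<theta>] nn r \<theta> by simp
        also have "\<dots> \<le> p n x / r powr \<nu> + r * p k x" using nn r by simp
        finally have "p m x \<le> C2 * (p n x / r powr \<nu> + r * p k x)"
          using le2[OF x] \<theta>(4) by (smt (verit, ccfv_SIG) mult.assoc mult_left_mono)
        then have "C1 * p m x \<le> C * r * p k x + C / r powr \<nu> * p n x"
          using C1(1) mult_left_mono[of "p m x" _ C1] by (fastforce simp: C_def algebra_simps)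
        moreover have "norm (f x) \<le> C1 * p m x"
          using C1(2)[OF x] mult_left_mono[OF mono[of m' m, OF _ x], of C1] C1(1)
          unfolding m_def by linarith
        ultimately show ?thesis by linarith
      qed
      obtain g h where gh: "linear_on s S g" "linear_on s S h" "\<And>x. f x = g x + h x"
        "\<And>x. x \<in> S \<Longrightarrow> norm (g x) \<le> C * r * p k x"
        "\<And>x. x \<in> S \<Longrightarrow> norm (h x) \<le> C / r powr \<nu> * p n x"
        using functional_decomposition[OF subspace_S flin seminorm_on_scale[OF psem, of "C * r" k]
          seminorm_on_scale[OF psem, of "C / r powr \<nu>" n] le] C r by auto
      have "g \<in> dual s T" "h \<in> dual s T"
        using dualI[OF gh(1) pc _ gh(4)] dualI[OF gh(2) pc _ gh(5)] C r by auto
      moreover have "f = (\<lambda>x. g x + h x)" using gh(3) by (rule ext)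
      ultimately show ?thesis using gh(4,5) by blast
    qed
    then show ?thesis
      using \<nu> C pc by (intro exI[of _ \<nu>] exI[of _ C] exI[of _ "p k"] conjI allI impI)
  qed
  then show ?thesis using that pc by blast
qed

section \<open>Interpolation between Banach disks\<close>

abbreviation dil_sum :: "real \<Rightarrow> 'a set \<Rightarrow> real \<Rightarrow> 'a set \<Rightarrow> 'a set" where
  "dil_sum t A u B \<equiv> {x + y | x y. x \<in> dil t A \<and> y \<in> dil u B}"

lemma dil_sum_abs_convex:
  assumes "abs_convex s A" "abs_convex s B"
  shows "abs_convex s (dil_sum t A u B)"
  unfolding abs_convex_def
proof (intro conjI ballI allI impI)
  show "dil_sum t A u B \<noteq> {}"
    using abs_convex_zero_dil[OF assms(1)] abs_convex_zero_dil[OF assms(2)] by blast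
  fix v w and a b :: complex
  assume "v \<in> dil_sum t A u B" "w \<in> dil_sum t A u B" and ab: "norm a + norm b \<le> (1::real)"
  then obtain x y x' y' where v: "v = x + y" "x \<in> dil t A" "y \<in> dil u B"
    and w: "w = x' + y'" "x' \<in> dil t A" "y' \<in> dil u B" by blast
  have "s a v + s b w = (s a x + s b x') + (s a y + s b y')"
    by (simp add: v w scale_right_distrib algebra_simps)
  moreover have "s a x + s b x' \<in> dil t A"
    using abs_convex_comb[OF abs_convex_dil[OF assms(1)] v(2) w(2) ab] .
  moreover have "s a y + s b y' \<in> dil u B"
    using abs_convex_comb[OF abs_convex_dil[OF assms(2)] v(3) w(3) ab] .
  ultimately show "s a v + s b w \<in> dil_sum t A u B" by blast
qed

lemma dil_sum_mono:
  assumes "abs_convex s A'" "abs_convex s B'" "A \<subseteq> A'" "B \<subseteq> B'" "0 \<le> t" "t \<le> t'" "0 \<le> u" "u \<le> u'"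
  shows "dil_sum t A u B \<subseteq> dil_sum t' A' u' B'"
proof -
  have "dil t A \<subseteq> dil t' A'" "dil u B \<subseteq> dil u' B'"
    using dil_mono[OF assms(3), of t] dil_mono[OF assms(4), of u]
      abs_convex_dil_mono[OF assms(1,5,6)] abs_convex_dil_mono[OF assms(2,7,8)] by blast+
  then show ?thesis by blast
qed

text \<open>In the hypothesis K and C depend on x; Baire's theorem makes them uniform on D M. Its
  contrapositive produces a single element that cannot be split, whatever K and C are.\<close>

lemma uniform_interpolation:
  assumes D: "\<And>n::nat. banach_disk s T (D n)" "incseq D"
    and pt: "\<And>x. x \<in> span (D M) \<Longrightarrow>
      \<exists>K. \<exists>C>0. \<forall>r>0. x \<in> dil_sum (C * r) (D K) (C / r powr \<nu>) (D N)"
  shows "\<exists>K\<ge>M. \<exists>C>0. \<forall>r>0. D M \<subseteq> dil_sum r (D K) (C / r powr \<nu>) (D N)"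
proof -
  note Da = banach_disk_abs_convex[OF D(1)]
  \<comment> \<open>One integer n plays the role of both the disk index K and the constant C, so
    that countably many sets cover the span.\<close>
  define A where "A = (\<lambda>n::nat. {x. \<forall>r::real. r > 0 \<longrightarrow>
    x \<in> dil_sum (real n * r) (D n) (real n / r powr \<nu>) (D N)})"
  have "abs_convex s (A n)" for n
  proof -
    have "0 \<in> A n"
      unfolding A_def using abs_convex_zero[OF dil_sum_abs_convex[OF Da Da]] by blast
    moreover have "s a x + s b y \<in> A n" if "x \<in> A n" "y \<in> A n" "norm a + norm b \<le> 1"
      for x y and a b :: complex
      unfolding A_def mem_Collect_eq
    proof (intro allI impI)
      fix r :: real assume r: "r > 0"
      have "x \<in> dil_sum (real n * r) (D n) (real n / r powr \<nu>) (D N)" "y \<in> dil_sum (real n * r) (D n) (real n / r powr \<nu>) (D N)"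
        using that(1,2) r unfolding A_def by blast+
      from abs_convex_comb[OF dil_sum_abs_convex[OF Da Da] this that(3)]
      show "\<exists>u v. s a x + s b y = u + v \<and> u \<in> dil (real n * r) (D n) \<and> v \<in> dil (real n / r powr \<nu>) (D N)"
        by blast
    qed
    ultimately show ?thesis unfolding abs_convex_def by blast
  qed
  moreover have "span (D M) \<subseteq> (\<Union>n. A n)"
  proof
    fix x assume "x \<in> span (D M)"
    then obtain K C where KC: "C > 0" "\<And>r. r > 0 \<Longrightarrow> x \<in> dil_sum (C * r) (D K) (C / r powr \<nu>) (D N)"
      using pt by blast
    define n where "n = max K (nat \<lceil>C\<rceil>)"
    have n: "K \<le> n" "C \<le> real n" unfolding n_def by linarith+
    have "x \<in> dil_sum (real n * r) (D n) (real n / r powr \<nu>) (D N)" if r: "r > 0" for r :: real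
    proof -
      have "D K \<subseteq> D n" using D(2) n(1) by (simp add: incseq_def)
      moreover have "C * r \<le> n * r" "C / r powr \<nu> \<le> n / r powr \<nu>"
        using n(2) r by (auto intro: divide_right_mono mult_right_mono)
      moreover have "0 \<le> C * r" "0 \<le> C / r powr \<nu>" using KC(1) r by auto
      ultimately have "dil_sum (C * r) (D K) (C / r powr \<nu>) (D N)
          \<subseteq> dil_sum (real n * r) (D n) (real n / r powr \<nu>) (D N)"
        using dil_sum_mono[OF Da Da _ subset_refl] by simp
      then show ?thesis using KC(2)[OF r] by blast
    qed
    then show "x \<in> (\<Union>n. A n)" unfolding A_def by blast
  qed
  ultimately obtain n t where t: "0 < t" and appr:
    "\<And>x e. x \<in> D M \<Longrightarrow> 0 < e \<Longrightarrow> \<exists>y\<in>dil t (A n). x - y \<in> dil e (D M)"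
    using banach_disk_Baire[OF D(1)] by metis
  define K where "K = max n M"
  have sub: "D n \<subseteq> D K" "D M \<subseteq> D K" using D(2) by (auto simp: incseq_def K_def)
  \<comment> \<open>With r' = r / c, the D n part after dilation by t has size t n r' \<le> r / 2;
    the other r / 2 is reserved for the Baire error. Using n + 1 keeps c positive when n =
    0.\<close>
  define c where "c = 2 * t * (real n + 1)"
  have c: "c > 0" using t by (simp add: c_def)
  define C where "C = t * (n + 1) * c powr \<nu>"
  have "x \<in> dil_sum r (D K) (C / r powr \<nu>) (D N)" if r: "r > 0" and x: "x \<in> D M" for r x
  proof -
    define r' where "r' = r / c"
    have r': "r' > 0" using r c by (simp add: r'_def)
    obtain y where y: "y \<in> dil t (A n)" "x - y \<in> dil (r/2) (D M)" using appr[OF x, of "r/2"] r by auto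
    then obtain a where a: "a \<in> A n" "y = s (of_real t) a" by (auto simp: dil_def)
    have "a \<in> dil_sum (n * r') (D n) (n / r' powr \<nu>) (D N)" using a(1) r' unfolding A_def by blast
    then obtain u v where uv: "a = u + v" "u \<in> dil (n * r') (D n)" "v \<in> dil (n / r' powr \<nu>) (D N)"
      by blast
    have "s (of_real t) u \<in> dil (norm (complex_of_real t) * (n * r')) (D n)"
      using r' by (intro abs_convex_dil_scale[OF Da _ uv(2)]) auto
    then have u': "s (of_real t) u \<in> dil (t * n * r') (D K)"
      using t dil_mono[OF sub(1)] by (auto simp: mult.assoc)
    have "t * n * r' \<le> t * (n + 1) * r'" using t r' by (intro mult_right_mono mult_left_mono) auto
    also have "t * (n + 1) * r' = r / 2" using t by (simp add: r'_def c_def divide_simps)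
    finally have le: "t * n * r' \<le> r / 2" .
    have "0 \<le> t * n * r'" using t r' by simp
    from subsetD[OF abs_convex_dil_mono[OF Da this le] u']
    have u: "s (of_real t) u \<in> dil (r/2) (D K)" .
    have "s (of_real t) v \<in> dil (norm (complex_of_real t) * (n / r' powr \<nu>)) (D N)"
      by (intro abs_convex_dil_scale[OF Da _ uv(3)]) auto
    moreover have "norm (complex_of_real t) * (n / r' powr \<nu>) \<le> C / r powr \<nu>"
      using t r c by (simp add: C_def r'_def powr_divide field_simps)
    ultimately have v: "s (of_real t) v \<in> dil (C / r powr \<nu>) (D N)"
      using abs_convex_dil_mono[OF Da, of "norm (complex_of_real t) * (n / r' powr \<nu>)"] t by auto
    have "(x - y) + s (of_real t) u \<in> dil (r/2 + r/2) (D K)"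
      using r y(2) dil_mono[OF sub(2)] by (intro abs_convex_dil_add[OF Da _ _ _ u]) auto
    moreover have "x = ((x - y) + s (of_real t) u) + s (of_real t) v"
      using a(2) uv(1) by (simp add: scale_right_distrib algebra_simps)
    ultimately show ?thesis using v by (auto intro!: exI)
  qed
  moreover have "C > 0" using t c by (simp add: C_def)
  moreover have "K \<ge> M" by (simp add: K_def)
  ultimately show ?thesis by blast
qed

text \<open>For r \<ge> 1 the inclusion is trivial by monotonicity of D. For r < 1 larger exponents
  are weaker, and splitting the first summand once more halves the exponent, so one positive
  exponent yields all of them.\<close>

lemma interpolation_exponent:
  assumes D: "\<And>n::nat. abs_convex s (D n)" "incseq D"
    and \<nu>: "0 < \<nu>" "\<And>M. M \<ge> N \<Longrightarrow> \<exists>K\<ge>M. \<exists>C>0. \<forall>r>0. D M \<subseteq> dil_sum r (D K) (C / r powr \<nu>) (D N)"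
    and "0 < \<mu>" "M \<ge> N"
  shows "\<exists>K\<ge>M. \<exists>C>0. \<forall>r>0. D M \<subseteq> dil_sum r (D K) (C / r powr \<mu>) (D N)"
proof -
  define P where "P = (\<lambda>\<nu>. \<forall>M\<ge>N. \<exists>K\<ge>M. \<exists>C>0. \<forall>r>0. D M \<subseteq> dil_sum r (D K) (C / r powr \<nu>) (D N))"
  have trivial: "D M \<subseteq> dil_sum r (D K) u (D N)" if "M \<le> K" "1 \<le> r" for M K r u
  proof
    fix x assume "x \<in> D M"
    then have "x \<in> D K" using D(2) that(1) by (auto simp: incseq_def)
    then have "x \<in> dil r (D K)" using abs_convex_dil_mono[OF D(1)[of K], of 1 r] that(2) by auto
    then show "x \<in> dil_sum r (D K) u (D N)"
      using abs_convex_zero_dil[OF D(1)[of N], of u] by (auto intro!: exI)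
  qed
  have mono: "P b" if Pa: "P a" and ab: "a \<le> b" for a b
    unfolding P_def
  proof (intro allI impI)
    fix M assume "N \<le> M"
    then obtain K C where KC: "M \<le> K" "0 < C" "\<And>r. r > 0 \<Longrightarrow> D M \<subseteq> dil_sum r (D K) (C / r powr a) (D N)"
      using Pa unfolding P_def by blast
    have "D M \<subseteq> dil_sum r (D K) (C / r powr b) (D N)" if r: "r > 0" for r
    proof (cases "1 \<le> r")
      case False
      then have "r powr b \<le> r powr a" using r ab by (intro powr_mono') auto
      then have "C / r powr a \<le> C / r powr b" using KC(2) r by (intro divide_left_mono) auto
      then have "dil_sum r (D K) (C / r powr a) (D N) \<subseteq> dil_sum r (D K) (C / r powr b) (D N)"
        using dil_sum_mono[OF D(1)[of K] D(1)[of N] subset_refl subset_refl] KC(2) r by simp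
      with KC(3)[OF r] show ?thesis by (rule order_trans)
    qed (use trivial KC(1) in blast)
    then show "\<exists>K\<ge>M. \<exists>C>0. \<forall>r>0. D M \<subseteq> dil_sum r (D K) (C / r powr b) (D N)"
      using KC by blast
  qed
  have half: "P (a / 2)" if Pa: "P a" and a: "0 < a" for a
    unfolding P_def
  proof (intro allI impI)
    fix M assume "N \<le> M"
    then obtain K C where KC: "M \<le> K" "0 < C" "\<And>r. r > 0 \<Longrightarrow> D M \<subseteq> dil_sum r (D K) (C / r powr a) (D N)"
      using Pa unfolding P_def by blast
    have "N \<le> K" using KC \<open>N \<le> M\<close> by simp
    then obtain L C' where L: "K \<le> L" "0 < C'" "\<And>r. r > 0 \<Longrightarrow> D K \<subseteq> dil_sum r (D L) (C' / r powr a) (D N)"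
      using Pa unfolding P_def by blast
    have "D M \<subseteq> dil_sum r (D L) ((C + C') / r powr (a/2)) (D N)" if r: "r > 0" for r
    proof (cases "1 \<le> r")
      case False
      \<comment> \<open>Two successive splittings with t give the factor t * t = r for the large
        disk, while the multiples of D N involve only t powr a = r powr (a / 2).\<close>
      define t where "t = sqrt r"
      have t: "0 < t" "t \<le> 1" "t * t = r" using r False by (auto simp: t_def)
      have ta: "t powr a = r powr (a/2)" using r by (simp add: t_def powr_half_sqrt[symmetric] powr_powr)
      show ?thesis
      proof
        fix x assume "x \<in> D M"
        then obtain u v where uv: "x = u + v" "u \<in> dil t (D K)" "v \<in> dil (C / t powr a) (D N)"
          using KC(3)[OF t(1)] by blast
        then obtain w where w: "u = s (of_real t) w" "w \<in> D K" by (auto simp: dil_def)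
        obtain y z where yz: "w = y + z" "y \<in> dil t (D L)" "z \<in> dil (C' / t powr a) (D N)"
          using L(3)[OF t(1)] w(2) by blast
        have y: "s (of_real t) y \<in> dil r (D L)"
          using abs_convex_dil_scale[OF D(1) _ yz(2), of "of_real t"] t by simp
        have "s (of_real t) z \<in> dil (norm (complex_of_real t) * (C' / t powr a)) (D N)"
          using L(2) by (intro abs_convex_dil_scale[OF D(1) _ yz(3)]) auto
        moreover have "norm (complex_of_real t) * (C' / t powr a) \<le> C' / t powr a"
          using t L(2) mult_right_mono[of t 1 "C' / t powr a"] by simp
        ultimately have "s (of_real t) z \<in> dil (C' / t powr a) (D N)"
          using abs_convex_dil_mono[OF D(1), of "norm (complex_of_real t) * (C' / t powr a)"] L(2) by auto
        then have "v + s (of_real t) z \<in> dil (C / t powr a + C' / t powr a) (D N)"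
          using KC(2) L(2) by (intro abs_convex_dil_add[OF D(1) _ _ uv(3)]) simp_all
        then have "v + s (of_real t) z \<in> dil ((C + C') / r powr (a/2)) (D N)"
          by (simp add: ta add_divide_distrib)
        moreover have "x = s (of_real t) y + (v + s (of_real t) z)"
          using uv(1) w(1) yz(1) by (simp add: scale_right_distrib algebra_simps)
        ultimately show "x \<in> dil_sum r (D L) ((C + C') / r powr (a/2)) (D N)"
          using y by blast
      qed
    next
      case True
      then show ?thesis using trivial[of M L] KC(1) L(1) by simp
    qed
    then show "\<exists>K\<ge>M. \<exists>C>0. \<forall>r>0. D M \<subseteq> dil_sum r (D K) (C / r powr (a / 2)) (D N)"
      using KC L by (intro exI[of _ L] conjI exI[of _ "C + C'"]) auto
  qed
  have "P (\<nu> / 2 ^ n)" for n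
  proof (induction n)
    case 0
    then show ?case using \<nu>(2) unfolding P_def by simp
  next
    case (Suc n)
    have "P (\<nu> / 2 ^ n / 2)" by (rule half[OF Suc.IH]) (use \<nu>(1) in simp)
    then show ?case by (simp add: mult.commute)
  qed
  moreover obtain n where "\<nu> / \<mu> < 2 ^ n" using real_arch_pow[of 2 "\<nu> / \<mu>"] by auto
  then have "\<nu> / 2 ^ n \<le> \<mu>" using \<open>0 < \<mu>\<close> by (simp add: field_simps)
  ultimately have "P \<mu>" using mono by blast
  then show ?thesis using \<open>M \<ge> N\<close> unfolding P_def by blast
qed

end

context lcs_pair
begin

theorem valued_eidelheit_imp_cond_A:
  fixes J :: "'j set"
  assumes J: "infinite J" and dual: "\<forall>j\<in>J. x' j \<in> dual sG TG"
    and DN: "cond_uDN sG TG" and lc: "locally_complete sE TE" and fb: "fundamental_bounded sE TE B"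
    and ve: "valued_eidelheit sG TG sE TE J x'"
  shows "cond_A sE TE"
proof -
  obtain D where D: "\<And>n. banach_disk sE TE (D n)" "incseq D" "fundamental_bounded sE TE D"
    using E.banach_disk_sequence[OF lc fb] by blast
  note Da = E.banach_disk_abs_convex[OF D(1)]
  obtain p where p: "cont_seminorm sG TG p"
    and split: "\<And>f. f \<in> dual sG TG \<Longrightarrow> \<exists>\<nu>>0. \<exists>C>0. \<exists>q. cont_seminorm sG TG q \<and>
      (\<forall>r>0. \<exists>g\<in>dual sG TG. \<exists>h\<in>dual sG TG. f = (\<lambda>x. g x + h x) \<and>
        (\<forall>x\<in>G.S. norm (g x) \<le> C * r * q x) \<and> (\<forall>x\<in>G.S. norm (h x) \<le> C / r powr \<nu> * p x))"
    using G.dual_split_uDN[OF DN] by blast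
  obtain \<iota> :: "nat \<Rightarrow> 'j" where \<iota>: "inj \<iota>" "range \<iota> \<subseteq> J" using infinite_countable_subset[OF J] by blast
  have "\<forall>i. \<exists>\<nu>. 0 < \<nu> \<and> (\<exists>C>0. \<exists>q. cont_seminorm sG TG q \<and>
      (\<forall>r>0. \<exists>g\<in>dual sG TG. \<exists>h\<in>dual sG TG. x' (\<iota> i) = (\<lambda>x. g x + h x) \<and>
        (\<forall>x\<in>G.S. norm (g x) \<le> C * r * q x) \<and> (\<forall>x\<in>G.S. norm (h x) \<le> C / r powr \<nu> * p x)))"
    by (rule allI, rule split) (use dual \<iota>(2) in blast)
  from choice[OF this] obtain \<nu> where \<nu>': "\<forall>i. 0 < \<nu> i \<and> (\<exists>C>0. \<exists>q. cont_seminorm sG TG q \<and>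
      (\<forall>r>0. \<exists>g\<in>dual sG TG. \<exists>h\<in>dual sG TG. x' (\<iota> i) = (\<lambda>x. g x + h x) \<and>
        (\<forall>x\<in>G.S. norm (g x) \<le> C * r * q x) \<and> (\<forall>x\<in>G.S. norm (h x) \<le> C / r powr \<nu> i * p x)))" ..
  note \<nu> = \<nu>'[rule_format, THEN conjunct1] and split' = \<nu>'[rule_format, THEN conjunct2]
  \<comment> \<open>One exponent is enough, by \<open>interpolation_exponent\<close>. The negation
    therefore holds for every exponent and every N, in particular for the exponents \<nu> i imposed
    by the functionals.\<close>
  have "\<exists>N a. 0 < a \<and> (\<forall>M\<ge>N. \<exists>K\<ge>M. \<exists>C>0. \<forall>r>0. D M \<subseteq> E.dil_sum r (D K) (C / r powr a) (D N))"
  proof (rule ccontr)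
    assume neg: "\<not> ?thesis"
    \<comment> \<open>Diagonal choice: i names both the functional, through its exponent \<nu> i,
      and the disk D i. The negated statement is used at N = i and a = \<nu> i.\<close>
    have "\<forall>i. \<exists>e. e \<in> E.S \<and> (\<forall>K. \<forall>C>0. \<exists>r>0. e \<notin> E.dil_sum (C * r) (D K) (C / r powr \<nu> i) (D i))"
    proof
      fix i
      obtain M where "\<not> (\<exists>K\<ge>M. \<exists>C>0. \<forall>r>0. D M \<subseteq> E.dil_sum r (D K) (C / r powr \<nu> i) (D i))"
        using neg \<nu>[of i] by blast
      then obtain e where "e \<in> E.span (D M)"
        "\<And>K C. 0 < C \<Longrightarrow> \<exists>r>0. e \<notin> E.dil_sum (C * r) (D K) (C / r powr \<nu> i) (D i)"
        using E.uniform_interpolation[OF D(1,2), of M "\<nu> i" i] by blast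
      then show "\<exists>e. e \<in> E.S \<and> (\<forall>K. \<forall>C>0. \<exists>r>0. e \<notin> E.dil_sum (C * r) (D K) (C / r powr \<nu> i) (D i))"
        using E.banach_disk_span[OF D(1)] by blast
    qed
    from choice[OF this] obtain e where e': "\<forall>i. e i \<in> E.S \<and> (\<forall>K. \<forall>C>0. \<exists>r>0.
        e i \<notin> E.dil_sum (C * r) (D K) (C / r powr \<nu> i) (D i))" ..
    note e = e'[rule_format, THEN conjunct1] e'[rule_format, THEN conjunct2, rule_format]
    \<comment> \<open>Indices of J outside the range of \<iota> also receive some value of e; only
      membership in the carrier matters for them.\<close>
    have "\<exists>R\<in>eps_product sG TG sE TE. \<forall>j\<in>J. R (x' j) = e (inv \<iota> j)"
      using ve[unfolded valued_eidelheit_def eps_id_def, rule_format, of "\<lambda>j. e (inv \<iota> j)"] e(1) by simp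
    then obtain R where R: "R \<in> eps_product sG TG sE TE" "\<And>j. j \<in> J \<Longrightarrow> R (x' j) = e (inv \<iota> j)"
      by blast
    have polar: "\<exists>n. R ` {f \<in> dual sG TG. \<forall>x\<in>G.S. norm (f x) \<le> q x} \<subseteq> D n"
      if "cont_seminorm sG TG q" for q
      using eps_product_image_polar_bounded[OF R(1) that] D(3) unfolding fundamental_bounded_def by blast
    have dilR: "R f \<in> E.dil t (D n)" if f: "f \<in> dual sG TG" "\<forall>x\<in>G.S. norm (f x) \<le> t * q x" "0 < t"
      and n: "R ` {f \<in> dual sG TG. \<forall>x\<in>G.S. norm (f x) \<le> q x} \<subseteq> D n" for f t q n
    proof -
      define g where "g = (\<lambda>x. of_real (1/t) * f x)"
      have g: "g \<in> dual sG TG" unfolding g_def by (rule G.dual_scale[OF f(1)])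
      have "\<forall>x\<in>G.S. norm (g x) \<le> q x" using f by (simp add: g_def norm_divide field_simps)
      then have "R g \<in> D n" using g n by blast
      moreover have "R f = sE (of_real t) (R g)"
        using eps_productD(3)[OF R(1) f(1), of "of_real (1/t)"] f(3) unfolding g_def by simp
      ultimately show ?thesis by (rule E.dilI)
    qed
    obtain N where N: "R ` {f \<in> dual sG TG. \<forall>x\<in>G.S. norm (f x) \<le> p x} \<subseteq> D N" using polar[OF p] by blast
    obtain C q where C: "C > 0" and q: "cont_seminorm sG TG q"
      and dec: "\<And>r. r > 0 \<Longrightarrow> \<exists>g\<in>dual sG TG. \<exists>h\<in>dual sG TG. x' (\<iota> N) = (\<lambda>x. g x + h x) \<and>
        (\<forall>x\<in>G.S. norm (g x) \<le> C * r * q x) \<and> (\<forall>x\<in>G.S. norm (h x) \<le> C / r powr \<nu> N * p x)"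
      using split'[of N] by blast
    obtain K where K: "R ` {f \<in> dual sG TG. \<forall>x\<in>G.S. norm (f x) \<le> q x} \<subseteq> D K" using polar[OF q] by blast
    obtain r where r: "r > 0" "e N \<notin> E.dil_sum (C * r) (D K) (C / r powr \<nu> N) (D N)"
      using e(2)[OF C] by blast
    obtain g h where gh: "g \<in> dual sG TG" "h \<in> dual sG TG" "x' (\<iota> N) = (\<lambda>x. g x + h x)"
      "\<forall>x\<in>G.S. norm (g x) \<le> C * r * q x" "\<forall>x\<in>G.S. norm (h x) \<le> C / r powr \<nu> N * p x"
      using dec[OF r(1)] by blast
    have "e N = R (x' (\<iota> N))" using R(2)[of "\<iota> N"] \<iota> by (simp add: range_subsetD)
    also have "\<dots> = R g + R h" using eps_productD(2)[OF R(1) gh(1,2)] gh(3) by simp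
    finally have "e N = R g + R h" .
    moreover have "R g \<in> E.dil (C * r) (D K)" by (rule dilR[OF gh(1,4) _ K]) (use C r(1) in simp)
    moreover have "R h \<in> E.dil (C / r powr \<nu> N) (D N)" by (rule dilR[OF gh(2,5) _ N]) (use C r(1) in simp)
    ultimately show False using r(2) by blast
  qed
  then obtain N a where a: "0 < a"
    and int: "\<And>M. M \<ge> N \<Longrightarrow> \<exists>K\<ge>M. \<exists>C>0. \<forall>r>0. D M \<subseteq> E.dil_sum r (D K) (C / r powr a) (D N)"
    by blast
  have ds: "E.dil_sum t X u Y = {sE (of_real t) x + sE (of_real u) y | x y. x \<in> X \<and> y \<in> Y}" for t u X Y
    unfolding E.dil_def by blast
  have "\<forall>M\<ge>N. \<forall>\<nu>>0. \<exists>K\<ge>M. \<exists>C>0. \<forall>r>0.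
      D M \<subseteq> {sE (of_real r) x + sE (of_real (C / r powr \<nu>)) y | x y. x \<in> D K \<and> y \<in> D N}"
    using E.interpolation_exponent[OF Da D(2) a int] unfolding ds by blast
  then show ?thesis unfolding cond_A_def using D(2,3) by blast
qed

end

section \<open>Approximation in the kernel\<close>

context cvs
begin

definition quotient_seminorm :: "'a set \<Rightarrow> ('a \<Rightarrow> real) \<Rightarrow> 'a \<Rightarrow> real" where
  "quotient_seminorm L p x = (INF z\<in>L. p (x - z))"

text \<open>A functional bounded by this seminorm vanishes on L, so norming functionals for it
  detect the distance to L.\<close>

lemma quotient_seminorm_on:
  assumes S: "subspace S" and L: "subspace L" "L \<subseteq> S" and p: "seminorm_on s S p"
  defines "q \<equiv> quotient_seminorm L p"
  shows "seminorm_on s S q" "\<And>x z. x \<in> S \<Longrightarrow> z \<in> L \<Longrightarrow> q x \<le> p (x - z)"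
proof -
  have nn: "0 \<le> p (x - z)" if "x \<in> S" "z \<in> L" for x z
    using that L by (intro seminorm_onD(1)[OF p] subspace_diff[OF S]) auto
  show le: "q x \<le> p (x - z)" if "x \<in> S" "z \<in> L" for x z
    unfolding q_def quotient_seminorm_def using that nn by (intro cINF_lower bdd_belowI2[where m = 0]) auto
  have ge: "m \<le> q x" if "x \<in> S" "\<And>z. z \<in> L \<Longrightarrow> m \<le> p (x - z)" for x m
    unfolding q_def quotient_seminorm_def using that subspace_0[OF L(1)] by (intro cINF_greatest) auto
  have add: "q (x + y) \<le> q x + q y" if x: "x \<in> S" and y: "y \<in> S" for x y
  proof -
    have "q (x + y) - q x \<le> q y"
    proof (rule ge[OF y])
      fix v assume v: "v \<in> L"
      have "q (x + y) - p (y - v) \<le> q x"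
      proof (rule ge[OF x])
        fix u assume u: "u \<in> L"
        have "q (x + y) \<le> p (x + y - (u + v))"
          using x y u v by (intro le subspace_add S L)
        also have "x + y - (u + v) = (x - u) + (y - v)" by simp
        also have "p \<dots> \<le> p (x - u) + p (y - v)"
          using x y u v L(2) by (intro seminorm_onD(2)[OF p] subspace_diff[OF S]) auto
        finally show "q (x + y) - p (y - v) \<le> p (x - u)" by simp
      qed
      then show "q (x + y) - q x \<le> p (y - v)" by simp
    qed
    then show ?thesis by simp
  qed
  have sc: "q (s c x) \<le> norm c * q x" if x: "x \<in> S" and c: "c \<noteq> 0" for x c
  proof -
    have "q (s c x) / norm c \<le> q x"
    proof (rule ge[OF x])
      fix z assume z: "z \<in> L"
      have "q (s c x) \<le> p (s c x - s c z)"
        using x z by (intro le subspace_scale S L)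
      also have "\<dots> = norm c * p (x - z)"
        using seminorm_onD(3)[OF p subspace_diff[OF S x], of z c] z L(2)
        by (auto simp: scale_right_diff_distrib)
      finally show "q (s c x) / norm c \<le> p (x - z)" using c by (simp add: field_simps)
    qed
    then show ?thesis using c by (simp add: field_simps)
  qed
  have "q 0 \<le> p (0 - 0)" by (intro le subspace_0 S L)
  then have "q 0 \<le> 0" using seminorm_on_zero[OF p S] by simp
  moreover have "0 \<le> q x" if "x \<in> S" for x using that by (intro ge nn)
  ultimately show "seminorm_on s S q" using S add sc by (intro seminorm_onI)
qed

end

lemma lcs_subtopology:
  assumes "lcs s T" "module.subspace s F" "F \<subseteq> topspace T"
  shows "lcs s (subtopology T F)"
proof -
  interpret lcs s T by fact
  have top: "topspace (subtopology T F) = F" using assms(3) by auto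
  have "continuous_map (prod_topology (subtopology T F) (subtopology T F)) (subtopology T F) (\<lambda>(x, y). x + y)"
    unfolding subtopology_Times[symmetric] continuous_map_in_subtopology
  proof
    show "continuous_map (subtopology (prod_topology T T) (F \<times> F)) T (\<lambda>(x, y). x + y)"
      using lcHs unfolding lcHs_def by (blast intro: continuous_map_from_subtopology)
    show "(\<lambda>(x, y). x + y) \<in> topspace (subtopology (prod_topology T T) (F \<times> F)) \<rightarrow> F"
      using subspace_add[OF assms(2)] by auto
  qed
  moreover have "continuous_map (prod_topology euclidean (subtopology T F)) (subtopology T F) (\<lambda>(c, x). s c x)"
  proof -
    have "prod_topology (euclidean :: complex topology) (subtopology T F)
        = subtopology (prod_topology euclidean T) (UNIV \<times> F)"
      by (simp add: subtopology_Times)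
    moreover have "continuous_map (subtopology (prod_topology euclidean T) (UNIV \<times> F)) T (\<lambda>(c, x). s c x)"
      using lcHs unfolding lcHs_def by (blast intro: continuous_map_from_subtopology)
    ultimately show ?thesis
      unfolding continuous_map_in_subtopology using subspace_scale[OF assms(2)] by auto
  qed
  moreover have "\<exists>V. zero_nhd (subtopology T F) V \<and> abs_convex s V \<and> V \<subseteq> U"
    if U: "zero_nhd (subtopology T F) U" for U
  proof -
    obtain W where W: "openin T W" "0 \<in> W" "W \<inter> F \<subseteq> U"
      using U unfolding zero_nhd_def openin_subtopology by blast
    then have "zero_nhd T W" unfolding zero_nhd_def using openin_subset by blast
    then obtain V where V: "zero_nhd T V" "abs_convex s V" "V \<subseteq> W"
      using lcHs unfolding lcHs_def by blast
    have F0: "0 \<in> F" using subspace_0[OF assms(2)] .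
    obtain O' where O': "openin T O'" "0 \<in> O'" "O' \<subseteq> V" using V(1) unfolding zero_nhd_def by blast
    have "openin (subtopology T F) (O' \<inter> F)" using O'(1) openin_subtopology by blast
    then have "zero_nhd (subtopology T F) (V \<inter> F)"
      unfolding zero_nhd_def top using O' F0 by (intro conjI exI[of _ "O' \<inter> F"]) auto
    moreover have "abs_convex s (V \<inter> F)"
      unfolding abs_convex_def
    proof (intro conjI ballI allI impI)
      show "V \<inter> F \<noteq> {}" using abs_convex_zero[OF V(2)] F0 by blast
      show "s a x + s b y \<in> V \<inter> F" if "x \<in> V \<inter> F" "y \<in> V \<inter> F" "norm a + norm b \<le> 1"
        for x y and a b :: complex
        using that abs_convex_comb[OF V(2)] by (auto intro: subspace_add subspace_scale assms(2))
    qed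
    ultimately show ?thesis using V(3) W(3) by blast
  qed
  moreover have "Hausdorff_space (subtopology T F)"
    using lcHs unfolding lcHs_def by (blast intro: Hausdorff_space_subtopology)
  ultimately have "Defs.lcHs s (subtopology T F)"
    unfolding lcHs_def top using assms(2) vector_space_axioms by blast
  then show ?thesis by unfold_locales
qed

lemma cont_seminorm_subtopology:
  "cont_seminorm s T p \<Longrightarrow> cont_seminorm s (subtopology T F) p"
  unfolding cont_seminorm_def by (auto intro: continuous_map_from_subtopology)

text \<open>At most exponential growth in l, at some rate. The class survives powers and
  multiplication by exponentials, which is what iterating (\<Omega>) requires.\<close>

definition tame :: "('a \<Rightarrow> real) \<Rightarrow> (nat \<Rightarrow> 'a) \<Rightarrow> bool" where
  "tame q x \<longleftrightarrow> (\<exists>C c. \<forall>l. q (x l) \<le> C * 2 ^ (c * l))"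

lemma tameE:
  assumes "tame q x"
  obtains C c where "1 \<le> C" "\<And>l. q (x l) \<le> C * 2 ^ (c * l)"
proof -
  obtain C c where "\<And>l. q (x l) \<le> C * 2 ^ (c * l)" using assms unfolding tame_def by blast
  moreover have "C * 2 ^ (c * l) \<le> max C 1 * 2 ^ (c * l)" for l by (intro mult_right_mono) auto
  ultimately have "\<And>l. q (x l) \<le> max C 1 * 2 ^ (c * l)" using order_trans by blast
  then show ?thesis using that[of "max C 1"] by auto
qed

lemma tameI: "(\<And>l. q (x l) \<le> C * 2 ^ (c * l)) \<Longrightarrow> tame q x"
  unfolding tame_def by blast

lemma tame_const: "tame q (\<lambda>l. x)"
  by (rule tameI[where C = "q x" and c = 0]) simp

lemma tame_bounded: "(\<And>l. q (x l) \<le> C) \<Longrightarrow> tame q x"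
  by (rule tameI[where C = C and c = 0]) simp

context lcs
begin

text \<open>The dual inequality (\<Omega>) becomes a splitting in the space itself. If w were
  outside W = \<kappa> U k' + \<mu> U n', a norming functional f for the gauge of W would have f w
  \<ge> 1 and dual gauges at most 1/\<kappa> and 1/\<mu>. With \<kappa> polynomial in r, (\<Omega>)
  then makes its gauge for U m' less than 1, although w lies in U m'.\<close>

lemma Omega_decomposition:
  assumes Om: "cond_Omega s T" and p: "\<And>n::nat. cont_seminorm s T (p n)"
    and basis: "\<And>U. zero_nhd T U \<Longrightarrow> \<exists>n. \<exists>d>0. {x \<in> S. p n x < d} \<subseteq> U"
  obtains m where "\<And>k. \<exists>C>0. \<exists>a::nat. \<forall>r::real. 1 \<le> r \<longrightarrow> (\<forall>x\<in>S. p m x \<le> 1 \<longrightarrow>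
      (\<exists>y\<in>S. p k y \<le> C * r ^ a \<and> p n (x - y) \<le> 1 / r))"
proof -
  obtain U where U: "fundamental_zero_nhds s T U" "decseq U"
    and Om': "\<And>n. \<exists>m\<ge>n. \<forall>k\<ge>m. \<exists>\<theta>\<in>{0<..<1}. \<exists>C>0. \<forall>z\<in>module.span fun_scale (polar s T (U n)).
        minkowski fun_scale (polar s T (U m)) z \<le>
          C * minkowski fun_scale (polar s T (U n)) z powr \<theta>
            * minkowski fun_scale (polar s T (U k)) z powr (1 - \<theta>)"
    using Om unfolding cond_Omega_def by blast
  have Uz: "zero_nhd T (U i)" and Ua: "abs_convex s (U i)" for i
    using U(1) unfolding fundamental_zero_nhds_def by auto
  have Usub: "\<exists>i. U i \<subseteq> V" if "zero_nhd T V" for V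
    using U(1) that unfolding fundamental_zero_nhds_def by blast
  have Udec: "U j \<subseteq> U i" if "i \<le> j" for i j using U(2) that by (simp add: decseq_def)
  obtain n' where n': "U n' \<subseteq> {x \<in> S. p n x < 1}" using Usub[OF cont_seminorm_zero_nhd[OF p, of 1]] by auto
  obtain m' where m': "m' \<ge> n'" and Om'': "\<And>k. k \<ge> m' \<Longrightarrow> \<exists>\<theta>\<in>{0<..<1}. \<exists>C>0.
      \<forall>z\<in>module.span fun_scale (polar s T (U n')).
        minkowski fun_scale (polar s T (U m')) z \<le>
          C * minkowski fun_scale (polar s T (U n')) z powr \<theta>
            * minkowski fun_scale (polar s T (U k)) z powr (1 - \<theta>)"
    using Om' by blast
  obtain m d where d: "d > 0" "{x \<in> S. p m x < d} \<subseteq> U m'" using basis[OF Uz] by blast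
  interpret D: cvs fun_scale by (rule cvs.intro) (rule vector_space_fun_scale)
  have pa: "abs_convex fun_scale (polar s T (U i))" for i
    unfolding abs_convex_def
  proof (intro conjI ballI allI impI)
    show "polar s T (U i) \<noteq> {}" using dual_zero unfolding polar_def by force
    fix f g and a b :: complex
    assume fg: "f \<in> polar s T (U i)" "g \<in> polar s T (U i)" and ab: "norm a + norm b \<le> (1::real)"
    have "(\<lambda>x. a * f x + b * g x) \<in> dual s T"
      using fg unfolding polar_def by (intro dual_add dual_scale) auto
    moreover have "norm (a * f x + b * g x) \<le> 1" if "x \<in> U i" for x
    proof -
      have "norm (a * f x + b * g x) \<le> norm a * norm (f x) + norm b * norm (g x)"
        by (metis norm_mult norm_triangle_ineq)
      also have "\<dots> \<le> norm a * 1 + norm b * 1"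
        using fg that unfolding polar_def by (intro add_mono mult_left_mono) auto
      finally show ?thesis using ab by simp
    qed
    ultimately show "fun_scale a f + fun_scale b g \<in> polar s T (U i)"
      unfolding polar_def fun_scale_def by (auto simp: plus_fun_def)
  qed
  have polar_dil: "f \<in> D.dil t (polar s T (U i))"
    if "f \<in> dual s T" "0 < t" "\<And>x. x \<in> U i \<Longrightarrow> norm (f x) \<le> t" for f t i
  proof (rule D.dilI)
    show "(\<lambda>x. of_real (1/t) * f x) \<in> polar s T (U i)"
      using that dual_scale[OF that(1), of "of_real (1/t)"]
      unfolding polar_def by (auto simp: norm_divide norm_mult)
    show "f = fun_scale (of_real t) (\<lambda>x. of_real (1/t) * f x)"
      using that(2) by (simp add: fun_scale_def)
  qed
  have "\<exists>C>0. \<exists>a::nat. \<forall>r::real. 1 \<le> r \<longrightarrow> (\<forall>x\<in>S. p m x \<le> 1 \<longrightarrow> (\<exists>y\<in>S. p k y \<le> C * r ^ a \<and> p n (x - y) \<le> 1 / r))" for k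
  proof -
    obtain k'' where k'': "U k'' \<subseteq> {x \<in> S. p k x < 1}" using Usub[OF cont_seminorm_zero_nhd[OF p, of 1]] by auto
    define k' where "k' = max k'' m'"
    have k': "U k' \<subseteq> {x \<in> S. p k x < 1}" using k'' Udec[of k'' k'] by (auto simp: k'_def)
    have "k' \<ge> m'" by (simp add: k'_def)
    then obtain \<theta> C where \<theta>: "0 < \<theta>" "\<theta> < 1" "C > 0" and est: "\<And>z. z \<in> D.span (polar s T (U n')) \<Longrightarrow>
        minkowski fun_scale (polar s T (U m')) z \<le>
          C * minkowski fun_scale (polar s T (U n')) z powr \<theta>
            * minkowski fun_scale (polar s T (U k')) z powr (1 - \<theta>)"
      using Om'' by force
    \<comment> \<open>Then w = e x satisfies p m w \<le> e < d and so lies in U m'.\<close>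
    define e where "e = d / 2"
    have e: "e > 0" using d by (simp add: e_def)
    \<comment> \<open>Rounding the exponent up is harmless because r \<ge> 1.\<close>
    define a where "a = nat \<lceil>\<theta> / (1 - \<theta>)\<rceil>"
    \<comment> \<open>Chosen so that the bound from (\<Omega>) with \<mu> = e / r and \<kappa> = B r
      powr (\<theta> / (1 - \<theta>)) equals exactly 1 / 2.\<close>
    define B where "B = (2 * C * e powr (- \<theta>)) powr (1 / (1 - \<theta>))"
    have B: "B > 0" using \<theta> e by (simp add: B_def)
    have "\<exists>y\<in>S. p k y \<le> B / e * r ^ a \<and> p n (x - y) \<le> 1 / r"
      if r: "r \<ge> 1" and x: "x \<in> S" "p m x \<le> 1" for r :: real and x
    proof -
      define \<mu> where "\<mu> = e / r"
      define \<kappa> where "\<kappa> = B * r powr (\<theta> / (1 - \<theta>))"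
      have \<mu>: "\<mu> > 0" and \<kappa>: "\<kappa> > 0" using e r B by (auto simp: \<mu>_def \<kappa>_def)
      have small: "C * (1 / \<mu>) powr \<theta> * (1 / \<kappa>) powr (1 - \<theta>) < 1"
      proof -
        have "\<kappa> powr (1 - \<theta>) = 2 * C * e powr (- \<theta>) * r powr \<theta>"
          using \<theta> e r by (simp add: \<kappa>_def B_def powr_mult powr_powr)
        moreover have "(1 / \<mu>) powr \<theta> = r powr \<theta> * e powr (- \<theta>)"
          using e r by (simp add: \<mu>_def powr_divide powr_minus_divide)
        moreover have "(1 / \<kappa>) powr (1 - \<theta>) = 1 / \<kappa> powr (1 - \<theta>)" using \<kappa> by (simp add: powr_divide)
        ultimately have "C * (1 / \<mu>) powr \<theta> * (1 / \<kappa>) powr (1 - \<theta>) = 1 / 2"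
          using \<theta> e r by simp
        then show ?thesis by simp
      qed
      define W where "W = dil_sum \<kappa> (U k') \<mu> (U n')"
      have Wa: "abs_convex s W" unfolding W_def by (rule dil_sum_abs_convex[OF Ua Ua])
      have dilS: "dil t (U i) \<subseteq> S" for t i
        using Uz[of i] unfolding zero_nhd_def dil_def by (auto intro: S_scale)
      have WS: "W \<subseteq> S" unfolding W_def using dilS by (auto intro!: S_add)
      have sub1: "dil \<kappa> (U k') \<subseteq> W" and sub2: "dil \<mu> (U n') \<subseteq> W"
        unfolding W_def using abs_convex_zero_dil[OF Ua] by force+
      have "W \<supseteq> {x \<in> S. (1 / \<mu>) * minkowski s (U n') x < 1}"
      proof
        fix x assume x: "x \<in> {x \<in> S. (1 / \<mu>) * minkowski s (U n') x < 1}"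
        then have "minkowski s (U n') x < \<mu>" using \<mu> by (simp add: field_simps)
        then have "x \<in> dil \<mu> (U n')"
          using x zero_nhd_span[OF Uz Ua, of n'] by (intro minkowski_less_imp_dil Ua) auto
        then show "x \<in> W" using sub2 by blast
      qed
      moreover have "zero_nhd T {x \<in> S. (1 / \<mu>) * minkowski s (U n') x < 1}"
        using \<mu> by (intro cont_seminorm_zero_nhd cont_seminorm_scale minkowski_cont_seminorm Uz Ua) auto
      ultimately have Wz: "zero_nhd T W" using WS unfolding zero_nhd_def by blast
      define w where "w = s (of_real e) x"
      have wS: "w \<in> S" unfolding w_def using x by (intro S_scale)
      have "w \<in> W"
      proof (rule ccontr)
        assume "w \<notin> W"
        then have "1 \<le> minkowski s W w"
          using minkowski_less_imp_dil[OF Wa, of w 1] zero_nhd_span[OF Wz Wa] wS by fastforce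
        moreover obtain f where f: "linear_on s S f" "\<And>x. x \<in> S \<Longrightarrow> norm (f x) \<le> minkowski s W x"
          "f w = of_real (minkowski s W w)"
          using norming_functional[OF subspace_S
            cont_seminorm_seminorm_on[OF minkowski_cont_seminorm[OF Wz Wa]] wS] by metis
        ultimately have fw: "1 \<le> norm (f w)" by simp
        have fd: "f \<in> dual s T"
          using dualI[OF f(1) minkowski_cont_seminorm[OF Wz Wa], of 1] f(2) by simp
        have fW: "norm (f z) \<le> 1" if "z \<in> W" for z
          using f(2)[of z] minkowski_le[of 1 z W] that WS by force
        have bd: "norm (f z) \<le> 1 / t" if t: "t > 0" "dil t (U i) \<subseteq> W" and z: "z \<in> U i" for t i z
        proof -
          have "z \<in> S" using z Uz unfolding zero_nhd_def by blast
          have "norm (f (s (of_real t) z)) \<le> 1" using t z by (intro fW) (auto simp: dil_def)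
          then show ?thesis
            using linear_onD(2)[OF f(1) \<open>z \<in> S\<close>, of "of_real t"] t by (simp add: norm_mult field_simps)
        qed
        have fk: "f \<in> D.dil (1 / \<kappa>) (polar s T (U k'))"
          using \<kappa> by (intro polar_dil[OF fd] bd[OF _ sub1]) auto
        have fn: "f \<in> D.dil (1 / \<mu>) (polar s T (U n'))"
          using \<mu> by (intro polar_dil[OF fd] bd[OF _ sub2]) auto
        have fspan: "f \<in> D.span (polar s T (U n'))"
          using fn D.span_abs_convex_iff[OF pa] \<mu> by (meson zero_less_divide_1_iff)
        \<comment> \<open>Polars grow as the neighbourhoods shrink, so f lies in the spans for m'
          and k' as well; the gauge lemmas require membership in the span.\<close>
        have "polar s T (U n') \<subseteq> polar s T (U i)" if "n' \<le> i" for i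
          using Udec[OF that] unfolding polar_def by blast
        then have fspan': "f \<in> D.span (polar s T (U m'))" "f \<in> D.span (polar s T (U k'))"
          using fspan D.span_mono m' \<open>k' \<ge> m'\<close> by (meson order_trans subsetD)+
        have "minkowski fun_scale (polar s T (U m')) f \<le>
          C * minkowski fun_scale (polar s T (U n')) f powr \<theta>
            * minkowski fun_scale (polar s T (U k')) f powr (1 - \<theta>)" by (rule est[OF fspan])
        also have "\<dots> \<le> C * (1 / \<mu>) powr \<theta> * (1 / \<kappa>) powr (1 - \<theta>)"
          using \<theta> \<kappa> \<mu> D.minkowski_nonneg[OF _ pa] fspan fspan'
          by (intro mult_mono powr_mono2 D.minkowski_le fk fn) auto
        finally have "minkowski fun_scale (polar s T (U m')) f < 1" using small by simp
        \<comment> \<open>A value strictly between the gauge and 1: membership in the dilation by t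
          gives norm (f w) \<le> t < 1.\<close>
        then obtain t where t: "minkowski fun_scale (polar s T (U m')) f < t" "t < 1" using dense by blast
        then have t0: "0 < t" using D.minkowski_nonneg[OF fspan'(1) pa] by linarith
        have "f \<in> D.dil t (polar s T (U m'))" by (rule D.minkowski_less_imp_dil[OF pa fspan'(1) t(1)])
        then obtain g where g: "g \<in> polar s T (U m')" "f = fun_scale (of_real t) g" by (auto simp: D.dil_def)
        have "p m w = e * p m x"
          using seminorm_onD(3)[OF cont_seminorm_seminorm_on[OF p] x(1), of m "of_real e"] e by (simp add: w_def)
        also have "\<dots> \<le> e * 1" using e x(2) by (intro mult_left_mono) auto
        also have "\<dots> < d" using d by (simp add: e_def)
        finally have "w \<in> U m'" using d(2) wS by blast
        then have "norm (g w) \<le> 1" using g(1) unfolding polar_def by blast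
        then have "norm (f w) \<le> t" using g(2) t0 by (simp add: fun_scale_def norm_mult)
        then show False using fw t by simp
      qed
      then obtain u v where uv: "w = u + v" "u \<in> dil \<kappa> (U k')" "v \<in> dil \<mu> (U n')" unfolding W_def by blast
      have uvS: "u \<in> S" "v \<in> S" using uv dilS by blast+
      have pd: "p i z \<le> t" if z: "z \<in> dil t (U j)" "U j \<subseteq> {x \<in> S. p i x < 1}" "0 < t" for i j t z
      proof -
        obtain b where b: "b \<in> U j" "z = s (of_real t) b" using z(1) by (auto simp: dil_def)
        then have "b \<in> S" "p i b < 1" using z(2) by auto
        then show ?thesis
          using seminorm_onD(3)[OF cont_seminorm_seminorm_on[OF p], of b i "of_real t"] b z(3) by simp
      qed
      define y where "y = s (of_real (1 / e)) u"
      have "x - y = s (of_real (1 / e)) v"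
      proof -
        have "x = s (of_real (1 / e)) w" using e by (simp add: w_def)
        then show ?thesis by (simp add: y_def uv(1) scale_right_distrib)
      qed
      then have "p n (x - y) = 1 / e * p n v"
        using seminorm_onD(3)[OF cont_seminorm_seminorm_on[OF p] uvS(2), of n "of_real (1 / e)"] e
        by (simp add: norm_divide)
      also have "\<dots> \<le> 1 / e * \<mu>" using e pd[OF uv(3) n' \<mu>] by (intro mult_left_mono) auto
      also have "\<dots> = 1 / r" using e by (simp add: \<mu>_def)
      finally have 1: "p n (x - y) \<le> 1 / r" .
      have "p k y = 1 / e * p k u"
        using seminorm_onD(3)[OF cont_seminorm_seminorm_on[OF p] uvS(1), of k "of_real (1 / e)"] e
        by (simp add: y_def norm_divide)
      also have "\<dots> \<le> 1 / e * \<kappa>" using e pd[OF uv(2) k' \<kappa>] by (intro mult_left_mono) auto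
      also have "\<kappa> \<le> B * r ^ a"
      proof -
        have "\<theta> / (1 - \<theta>) \<le> real a" unfolding a_def by linarith
        then have "r powr (\<theta> / (1 - \<theta>)) \<le> r powr real a" using r by (intro powr_mono) auto
        also have "\<dots> = r ^ a" using r by (simp add: powr_realpow)
        finally show ?thesis using B by (simp add: \<kappa>_def)
      qed
      finally have 2: "p k y \<le> B / e * r ^ a" using e by (simp add: field_simps)
      have "y \<in> S" unfolding y_def using uvS by (intro S_scale)
      with 1 2 show ?thesis by blast
    qed
    moreover have "B / e > 0" using B e by simp
    ultimately show ?thesis by blast
  qed
  then show ?thesis using that by blast
qed

text \<open>The decomposition is applied to each x l, scaled into the unit ball, with a parameter
  growing exponentially in l. The error can thus be made smaller than e / 4 ^ l, while the cost, a
  power of the parameter, is still exponential.\<close>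

lemma Omega_sequences:
  assumes Om: "cond_Omega s T" and p: "\<And>n::nat. cont_seminorm s T (p n)"
    and basis: "\<And>U. zero_nhd T U \<Longrightarrow> \<exists>n. \<exists>d>0. {x \<in> S. p n x < d} \<subseteq> U"
    and mono: "\<And>i j x. i \<le> j \<Longrightarrow> x \<in> S \<Longrightarrow> p i x \<le> p j x"
  obtains m where "n < m" "\<And>k e x. 0 < e \<Longrightarrow> (\<And>l. x l \<in> S) \<Longrightarrow> tame (p m) x \<Longrightarrow>
      \<exists>y. (\<forall>l. y l \<in> S) \<and> tame (p k) y \<and> (\<forall>l. p n (x l - y l) \<le> e / 4 ^ l)"
proof -
  obtain m where m: "\<And>k. \<exists>C>0. \<exists>a::nat. \<forall>r::real. 1 \<le> r \<longrightarrow> (\<forall>x\<in>S. p m x \<le> 1 \<longrightarrow>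
      (\<exists>y\<in>S. p k y \<le> C * r ^ a \<and> p n (x - y) \<le> 1 / r))"
    using Omega_decomposition[OF Om p basis] by blast
  \<comment> \<open>Taking the maximum with Suc n ensures that the level strictly increases.\<close>
  have "\<exists>y. (\<forall>l. y l \<in> S) \<and> tame (p k) y \<and> (\<forall>l. p n (x l - y l) \<le> e / 4 ^ l)"
    if e: "0 < e" and x: "\<And>l. x l \<in> S" and tame: "tame (p (max m (Suc n))) x" for k e x
  proof -
    obtain A c where A: "1 \<le> A" "\<And>l. p (max m (Suc n)) (x l) \<le> A * 2 ^ (c * l)" using tameE[OF tame] by blast
    obtain C a where C: "C > 0" "\<And>r x. 1 \<le> r \<Longrightarrow> x \<in> S \<Longrightarrow> p m x \<le> 1 \<Longrightarrow>
        \<exists>y\<in>S. p k y \<le> C * r ^ a \<and> p n (x - y) \<le> 1 / r"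
      using m[of k] by blast
    define E where "E = max 1 (1 / e)"
    have E: "1 \<le> E" "1 / E \<le> e" using e by (auto simp: E_def field_simps max_def)
    define R where "R = (\<lambda>l. A * 2 ^ (c * l))"
    have R: "1 \<le> R l" for l
      unfolding R_def using A(1) mult_mono[of 1 A 1 "2 ^ (c * l)"] by simp
    \<comment> \<open>After scaling back by R l the error R l / \<rho> l is 1 / (E * 4 ^ l), at most
      e / 4 ^ l. The maximum in E keeps \<rho> l \<ge> 1, as the decomposition demands.\<close>
    define \<rho> where "\<rho> = (\<lambda>l. R l * 4 ^ l * E)"
    have \<rho>: "1 \<le> \<rho> l" for l
      unfolding \<rho>_def using R[of l] E(1) mult_mono[of 1 "R l * 4 ^ l" 1 E] mult_mono[of 1 "R l" 1 "4 ^ l"] by simp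
    have "\<exists>y. y \<in> S \<and> p k y \<le> R l * (C * \<rho> l ^ a) \<and> p n (x l - y) \<le> e / 4 ^ l" for l
    proof -
      have R0: "0 < R l" using R[of l] by linarith
      have "p m (x l) \<le> R l" using mono[of m "max m (Suc n)", OF _ x] A(2)[of l] by (auto simp: R_def intro: order_trans)
      moreover have "R l * p m (s (of_real (1 / R l)) (x l)) = p m (x l)"
        using seminorm_onD(3)[OF cont_seminorm_seminorm_on[OF p] x, of m "of_real (1 / R l)" l] R0
        by (simp add: norm_divide)
      ultimately have "R l * p m (s (of_real (1 / R l)) (x l)) \<le> R l * 1" by simp
      then have "p m (s (of_real (1 / R l)) (x l)) \<le> 1"
        using R0 by (simp only: mult_le_cancel_left_pos)
      then obtain y where y: "y \<in> S" "p k y \<le> C * \<rho> l ^ a" "p n (s (of_real (1 / R l)) (x l) - y) \<le> 1 / \<rho> l"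
        using C(2)[OF \<rho>] S_scale[OF x] by blast
      define y' where "y' = s (of_real (R l)) y"
      have "p k y' = R l * p k y"
        using seminorm_onD(3)[OF cont_seminorm_seminorm_on[OF p] y(1), of k "of_real (R l)"] R0 by (simp add: y'_def)
      moreover have "R l * p k y \<le> R l * (C * \<rho> l ^ a)" using y(2) R0 by simp
      moreover have "x l - y' = s (of_real (R l)) (s (of_real (1 / R l)) (x l) - y)"
        using R0 by (simp add: y'_def scale_right_diff_distrib)
      then have "p n (x l - y') = R l * p n (s (of_real (1 / R l)) (x l) - y)"
        using seminorm_onD(3)[OF cont_seminorm_seminorm_on[OF p] S_diff[OF S_scale[OF x] y(1)], of n "of_real (R l)"] R0
        by simp
      moreover have "R l * p n (s (of_real (1 / R l)) (x l) - y) \<le> R l * (1 / \<rho> l)"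
        using y(3) R0 by (intro mult_left_mono) auto
      moreover have "R l * (1 / \<rho> l) = (1 / E) / 4 ^ l" using R0 by (simp add: \<rho>_def)
      moreover have "(1 / E) / 4 ^ l \<le> e / 4 ^ l" using E(2) by (intro divide_right_mono) auto
      moreover have "y' \<in> S" unfolding y'_def by (rule S_scale[OF y(1)])
      ultimately show ?thesis by (intro exI[of _ y'] conjI) linarith+
    qed
    then obtain y where y: "\<And>l. y l \<in> S" "\<And>l. p k (y l) \<le> R l * (C * \<rho> l ^ a)" "\<And>l. p n (x l - y l) \<le> e / 4 ^ l"
      by metis
    have Req: "R l * (C * \<rho> l ^ a) = (A * C * (A * E) ^ a) * 2 ^ ((c + (c + 2) * a) * l)" for l
    proof -
      have "\<rho> l = (A * E) * 2 ^ ((c + 2) * l)"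
      proof -
        have "(4::real) ^ l = (2 ^ 2) ^ l" by simp
        then have "(4::real) ^ l = 2 ^ (2 * l)" by (simp only: power_mult)
        moreover have "(2::real) ^ ((c + 2) * l) = 2 ^ (c * l) * 2 ^ (2 * l)"
          by (simp only: distrib_right power_add)
        ultimately show ?thesis by (simp add: \<rho>_def R_def)
      qed
      then have "\<rho> l ^ a = (A * E) ^ a * 2 ^ ((c + 2) * l * a)" by (simp add: power_mult_distrib power_mult)
      then have "R l * (C * \<rho> l ^ a) = (A * C * (A * E) ^ a) * (2 ^ (c * l) * 2 ^ ((c + 2) * l * a))"
        by (simp add: R_def)
      also have "2 ^ (c * l) * 2 ^ ((c + 2) * l * a) = (2::real) ^ ((c + (c + 2) * a) * l)"
        unfolding power_add[symmetric] by (simp add: algebra_simps)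
      finally show ?thesis .
    qed
    have "tame (p k) y" by (rule tameI) (rule y(2)[unfolded Req])
    then show ?thesis using y by blast
  qed
  then show ?thesis using that[of "max m (Suc n)"] by simp
qed

end

section \<open>Frechet spaces with an increasing sequence of seminorms\<close>

locale graded_frechet = lcs s T for s :: "complex \<Rightarrow> 'a::ab_group_add \<Rightarrow> 'a" and T +
  fixes p :: "nat \<Rightarrow> 'a \<Rightarrow> real"
  assumes complete: "tvs_Cauchy T u \<Longrightarrow> \<exists>l. limitin T u l sequentially"
    and fundamental: "fundamental_seminorms s T p"
    and increasing: "x \<in> topspace T \<Longrightarrow> p n x \<le> p (Suc n) x"
begin

lemma p_cont: "cont_seminorm s T (p n)"
  using fundamental unfolding fundamental_seminorms_def by blast

lemmas p_semi = cont_seminorm_seminorm_on[OF p_cont]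
lemmas p_nonneg = seminorm_onD(1)[OF p_semi] and p_triangle = seminorm_onD(2)[OF p_semi]
  and p_scale = seminorm_onD(3)[OF p_semi] and p_diff = seminorm_on_diff[OF p_semi subspace_S]
  and p_zero = seminorm_on_zero[OF p_semi subspace_S] and p_sum = seminorm_on_sum[OF p_semi subspace_S]

lemma p_mono: "i \<le> j \<Longrightarrow> x \<in> S \<Longrightarrow> p i x \<le> p j x"
  by (rule lift_Suc_mono_le[of "\<lambda>n. p n x"]) (auto intro: increasing)

lemma p_dominates:
  assumes "cont_seminorm s T q"
  obtains n C where "0 < C" "\<And>x. x \<in> S \<Longrightarrow> q x \<le> C * p n x"
  using fundamental assms unfolding fundamental_seminorms_def by blast

lemma p_basis:
  assumes "zero_nhd T U"
  obtains n d where "0 < d" "{x \<in> S. p n x < d} \<subseteq> U"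
proof -
  obtain q where q: "cont_seminorm s T q" "\<And>x. x \<in> S \<Longrightarrow> q x < 1 \<Longrightarrow> x \<in> U"
    using zero_nhd_seminorm[OF assms] by blast
  obtain n C where C: "0 < C" "\<And>x. x \<in> S \<Longrightarrow> q x \<le> C * p n x" using p_dominates[OF q(1)] by blast
  have "x \<in> U" if "x \<in> S" "p n x < 1 / C" for x
  proof (rule q(2)[OF that(1)])
    have "C * p n x < 1" using that(2) C(1) by (simp add: field_simps)
    then show "q x < 1" using C(2)[OF that(1)] by linarith
  qed
  then show ?thesis using that[of "1 / C" n] C(1) by auto
qed

lemma complete_seminorms:
  assumes "\<And>i. x i \<in> S" "\<And>n e. 0 < e \<Longrightarrow> \<exists>k. \<forall>i\<ge>k. \<forall>j\<ge>k. p n (x i - x j) < e"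
  obtains l where "l \<in> S" "limitin T x l sequentially" "\<And>n. (\<lambda>i. p n (x i - l)) \<longlonglongrightarrow> 0"
proof -
  have "tvs_Cauchy T x"
    unfolding tvs_Cauchy_def
  proof (intro conjI allI impI assms(1))
    fix U assume "zero_nhd T U"
    then obtain n d where "0 < d" "{x \<in> S. p n x < d} \<subseteq> U" using p_basis by blast
    then show "\<exists>n0. \<forall>m\<ge>n0. \<forall>n\<ge>n0. x m - x n \<in> U"
      using assms(2)[of d n] S_diff[OF assms(1) assms(1)] by blast
  qed
  then obtain l where l: "limitin T x l sequentially" using complete by blast
  moreover have "l \<in> S" using l unfolding limitin_def by blast
  ultimately show ?thesis using that limitin_seminormD[OF l p_cont] by blast
qed

text \<open>The i-th step is measured in the seminorm n + i, so every fixed seminorm eventually sees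
  a geometric series.\<close>

lemma fast_convergence:
  assumes x: "\<And>i. x i \<in> S" and fast: "\<And>i. p (n + i) (x i - x (Suc i)) \<le> e / 2 ^ i"
  obtains l where "l \<in> S" "\<And>m. (\<lambda>i. p m (x i - l)) \<longlonglongrightarrow> 0" "p n (x 0 - l) \<le> 2 * e"
proof -
  have e: "0 \<le> e" using p_nonneg[OF S_diff[OF x x], of "n + 0" 0 "Suc 0"] fast[of 0] by simp
  have tail: "p m (x i - x (i + j)) \<le> 2 * e / 2 ^ i" if "m \<le> n + i" for m i j
  proof -
    \<comment> \<open>The factor 1 - 1 / 2 ^ j records the exact partial geometric sum, without
      which the induction would not close.\<close>
    have "p m (x i - x (i + j)) \<le> 2 * e / 2 ^ i * (1 - 1 / 2 ^ j)"
    proof (induction j)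
      case 0
      then show ?case by (simp add: p_zero)
    next
      case (Suc j)
      have "p m (x (i + j) - x (Suc (i + j))) \<le> p (n + (i + j)) (x (i + j) - x (Suc (i + j)))"
        using that x by (intro p_mono S_diff) auto
      also have "\<dots> \<le> e / 2 ^ (i + j)" by (rule fast)
      finally have step: "p m (x (i + j) - x (Suc (i + j))) \<le> e / 2 ^ (i + j)" .
      have "p m (x i - x (i + Suc j)) = p m ((x i - x (i + j)) + (x (i + j) - x (Suc (i + j))))" by simp
      also have "\<dots> \<le> p m (x i - x (i + j)) + p m (x (i + j) - x (Suc (i + j)))"
        using x by (intro p_triangle S_diff) auto
      also have "\<dots> \<le> 2 * e / 2 ^ i * (1 - 1 / 2 ^ j) + e / 2 ^ (i + j)" using Suc.IH step by linarith
      also have "\<dots> = 2 * e / 2 ^ i * (1 - 1 / 2 ^ Suc j)" by (simp add: power_add field_simps)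
      finally show ?case .
    qed
    also have "\<dots> \<le> 2 * e / 2 ^ i * 1" using e by (intro mult_left_mono) auto
    finally show ?thesis by simp
  qed
  have "\<exists>k. \<forall>i\<ge>k. \<forall>j\<ge>k. p m (x i - x j) < d" if d: "0 < d" for m d
  proof -
    obtain k0 where k0: "4 * e / d < 2 ^ k0" using real_arch_pow[of 2 "4 * e / d"] by auto
    define k where "k = max k0 m"
    have "(2::real) ^ k0 \<le> 2 ^ k" by (intro power_increasing) (auto simp: k_def)
    then have "4 * e / d < 2 ^ k" using k0 by linarith
    then have small: "4 * e / 2 ^ k < d" using d by (simp add: field_simps)
    have "p m (x i - x j) < d" if "k \<le> i" "k \<le> j" for i j
    proof -
      have t: "p m (x k - x i) \<le> 2 * e / 2 ^ k" if "k \<le> i" for i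
        using tail[of m k "i - k"] that by (simp add: k_def)
      have "p m (x i - x j) = p m ((x k - x j) - (x k - x i))" by simp
      also have "\<dots> \<le> p m (x k - x j) + p m (x k - x i)" using x by (intro p_diff(1) S_diff)
      finally show ?thesis using t[OF that(1)] t[OF that(2)] small by simp
    qed
    then show ?thesis by blast
  qed
  then obtain l where l: "l \<in> S" "\<And>m. (\<lambda>i. p m (x i - l)) \<longlonglongrightarrow> 0"
    using complete_seminorms[of x] x by metis
  have "p n (x 0 - l) \<le> 2 * e + p n (x i - l)" for i
  proof -
    have "p n (x 0 - l) = p n ((x 0 - x (0 + i)) + (x i - l))" by simp
    also have "\<dots> \<le> p n (x 0 - x (0 + i)) + p n (x i - l)" using x l by (intro p_triangle S_diff) auto
    finally show ?thesis using tail[of n 0 i] by simp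
  qed
  moreover have "(\<lambda>i. 2 * e + p n (x i - l)) \<longlonglongrightarrow> 2 * e + 0" by (intro tendsto_intros l)
  ultimately have "p n (x 0 - l) \<le> 2 * e + 0"
    by (intro LIMSEQ_le_const[of "\<lambda>i. 2 * e + p n (x i - l)"]) auto
  then show ?thesis using that l by simp
qed

end

section \<open>Eidelheit sequences and their common kernel\<close>

locale eidelheit_sequence = graded_frechet s T p
  for s :: "complex \<Rightarrow> 'a::ab_group_add \<Rightarrow> 'a" and T p +
  fixes \<xi> :: "nat \<Rightarrow> 'a \<Rightarrow> complex"
  assumes \<xi>_dual: "\<xi> i \<in> dual s T"
    and \<xi>_surj: "\<exists>x\<in>topspace T. \<forall>i. \<xi> i x = a i"
begin

abbreviation F where "F \<equiv> {x \<in> S. \<forall>i. \<xi> i x = 0}"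

lemma \<xi>_linear: "linear_on s S (\<xi> i)"
  using \<xi>_dual dual_iff by blast

lemma common_kernel_subspace: "subspace {x \<in> S. \<forall>i\<in>I. \<xi> i x = 0}"
  unfolding subspace_def
  by (auto simp: S_zero S_add S_scale linear_on_zero[OF \<xi>_linear subspace_S] linear_onD[OF \<xi>_linear])

lemma F_subspace: "subspace F"
  using common_kernel_subspace[of UNIV] by simp

text \<open>Otherwise a triangular system of conditions \<open>\<phi>\<^sub>t x = t\<close> with \<open>\<bar>\<phi>\<^sub>t\<bar> \<le> q\<close>, for unboundedly
  many \<open>t\<close>, could be solved by surjectivity.\<close>

lemma bounded_combinations:
  obtains N where "\<And>c k i. (\<And>x. x \<in> S \<Longrightarrow> norm (\<Sum>i<k. c i * \<xi> i x) \<le> q x) \<Longrightarrow> i < k \<Longrightarrow> N \<le> i \<Longrightarrow> c i = 0"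
proof -
  \<comment> \<open>The possible top indices of combinations bounded by q.\<close>
  define A where "A = {t. \<exists>c. c t \<noteq> 0 \<and> (\<forall>x\<in>S. norm (\<Sum>i\<le>t. c i * \<xi> i x) \<le> q x)}"
  have "\<exists>N. \<forall>t\<in>A. t < N"
  proof (rule ccontr)
    assume "\<nexists>N. \<forall>t\<in>A. t < N"
    then have unb: "\<And>N. \<exists>t\<in>A. N \<le> t" by (meson not_less)
    have "\<forall>t\<in>A. \<exists>c. c t \<noteq> 0 \<and> (\<forall>x\<in>S. norm (\<Sum>i\<le>t. c i * \<xi> i x) \<le> q x)" unfolding A_def by blast
    from bchoice[OF this] obtain c where c: "\<forall>t\<in>A. c t t \<noteq> 0 \<and> (\<forall>x\<in>S. norm (\<Sum>i\<le>t. c t i * \<xi> i x) \<le> q x)" ..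
    \<comment> \<open>The equation for t involves only a i with i \<le> t, and its coefficient at a
      t is nonzero; indices outside A are unconstrained.\<close>
    define P where "P = (\<lambda>(a::nat \<Rightarrow> complex) t r. t \<in> A \<longrightarrow> (\<Sum>i<t. c t i * a i) + c t t * r = of_nat t)"
    have "\<exists>a. \<forall>t. P a t (a t)"
    proof (rule dependent_wf_choice[OF wf_less])
      show "P f t r = P g t r" if "\<And>z. (z, t) \<in> {(x, y). x < y} \<Longrightarrow> f z = g z" for f g t r
        using that unfolding P_def by simp
      show "\<exists>r. P f t r" for f t
        using c unfolding P_def by (intro exI[of _ "(of_nat t - (\<Sum>i<t. c t i * f i)) / c t t"]) auto
    qed
    then obtain a where a: "\<And>t. P a t (a t)" by blast
    obtain x where x: "x \<in> S" "\<And>i. \<xi> i x = a i" using \<xi>_surj[of a] by blast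
    have "real t \<le> q x" if "t \<in> A" for t
    proof -
      have "(\<Sum>i\<le>t. c t i * \<xi> i x) = of_nat t"
        using a[of t] that unfolding P_def by (simp add: x(2) lessThan_Suc_atMost[symmetric])
      then have "norm (of_nat t :: complex) \<le> q x" using c that x(1) by metis
      then show ?thesis by simp
    qed
    moreover obtain t where "t \<in> A" "nat \<lceil>q x\<rceil> + 1 \<le> t" using unb by blast
    ultimately show False using real_nat_ceiling_ge[of "q x"] by fastforce
  qed
  then obtain N where N: "\<And>t. t \<in> A \<Longrightarrow> t < N" by blast
  have "c i = 0" if b: "\<And>x. x \<in> S \<Longrightarrow> norm (\<Sum>i<k. c i * \<xi> i x) \<le> q x" and i: "i < k" "N \<le> i" for c k i
  proof (rule ccontr)
    assume ci: "c i \<noteq> 0"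
    \<comment> \<open>The genuine top index: all later coefficients vanish, so the combination
      truncated at t is unchanged.\<close>
    define t where "t = Max {i. i < k \<and> c i \<noteq> 0}"
    have fin: "finite {i. i < k \<and> c i \<noteq> 0}" by simp
    have t: "t < k" "c t \<noteq> 0" "i \<le> t"
      using Max_in[OF fin] Max_ge[OF fin, of i] ci i unfolding t_def[symmetric] by auto
    have "(\<Sum>i<k. c i * \<xi> i x) = (\<Sum>i\<le>t. c i * \<xi> i x)" for x
    proof (rule sum.mono_neutral_right)
      show "\<forall>i\<in>{..<k} - {..t}. c i * \<xi> i x = 0"
        using Max_ge[OF fin] unfolding t_def[symmetric] by fastforce
    qed (use t in auto)
    then have "t \<in> A" using t(2) b unfolding A_def by auto
    then show False using N[of t] i(2) t(3) by simp
  qed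
  then show ?thesis using that by blast
qed

lemma dual_basis:
  obtains g where "\<And>j. g j \<in> S" "\<And>i j. \<xi> i (g j) = (if i = j then 1 else 0)"
  using \<xi>_surj[of "\<lambda>i. if i = _ then 1 else 0"] by metis

text \<open>A functional that vanishes on L and is bounded by p n is a combination of the first N'
  functionals. By hypothesis the coefficients from N on vanish, so it also vanishes at y. A norming
  functional at y shows that y has distance 0 from L.\<close>

lemma kernel_density_step:
  assumes N: "\<And>c k i. (\<And>x. x \<in> S \<Longrightarrow> norm (\<Sum>i<k. c i * \<xi> i x) \<le> p n x) \<Longrightarrow> i < k \<Longrightarrow> N \<le> i \<Longrightarrow> c i = 0"
    and y: "y \<in> S" "\<And>i. i < N \<Longrightarrow> \<xi> i y = 0" and e: "0 < e"
  shows "\<exists>z\<in>S. (\<forall>i<N'. \<xi> i z = 0) \<and> p n (y - z) < e"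
proof -
  define L where "L = {x \<in> S. \<forall>i\<in>{..<N'}. \<xi> i x = 0}"
  have L: "subspace L" "L \<subseteq> S" unfolding L_def using common_kernel_subspace by auto
  define q where "q = quotient_seminorm L (p n)"
  note q = quotient_seminorm_on[OF subspace_S L p_semi[of n], folded q_def]
  obtain f where f: "linear_on s S f" "\<And>x. x \<in> S \<Longrightarrow> norm (f x) \<le> q x" "f y = of_real (q y)"
    using norming_functional[OF subspace_S q(1) y(1)] by blast
  have fL: "f z = 0" if "z \<in> L" for z
  proof -
    have z: "z \<in> S" using that L by blast
    show ?thesis using order_trans[OF f(2)[OF z] q(2)[OF z that]] by (simp add: p_zero)
  qed
  obtain g where g: "\<And>j. g j \<in> S" "\<And>i j. \<xi> i (g j) = (if i = j then 1 else 0)" using dual_basis by blast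
  have fsum: "f x = (\<Sum>i<N'. f (g i) * \<xi> i x)" if x: "x \<in> S" for x
  proof -
    \<comment> \<open>The dual basis reproduces the first N' values of x, so x - w lies in
      L.\<close>
    define w where "w = (\<Sum>i<N'. s (\<xi> i x) (g i))"
    have w: "w \<in> S" unfolding w_def using g(1) by (intro S_sum S_scale)
    have "\<xi> i w = \<xi> i x" if "i < N'" for i
    proof -
      have "\<xi> i w = (\<Sum>j<N'. \<xi> i (s (\<xi> j x) (g j)))"
        unfolding w_def using g(1) by (intro linear_on_sum[OF \<xi>_linear subspace_S] S_scale) auto
      also have "\<dots> = (\<Sum>j<N'. if i = j then \<xi> j x else 0)"
        by (intro sum.cong refl) (simp add: linear_onD(2)[OF \<xi>_linear g(1)] g(2))
      also have "\<dots> = \<xi> i x" using that by simp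
      finally show ?thesis .
    qed
    then have "x - w \<in> L"
      unfolding L_def using x w by (auto simp: S_diff linear_on_diff[OF \<xi>_linear subspace_S])
    then have "f x = f w" using fL[of "x - w"] linear_on_diff[OF f(1) subspace_S x w] by simp
    also have "\<dots> = (\<Sum>i<N'. f (s (\<xi> i x) (g i)))"
      unfolding w_def using g(1) by (intro linear_on_sum[OF f(1) subspace_S] S_scale) auto
    also have "\<dots> = (\<Sum>i<N'. f (g i) * \<xi> i x)"
      by (intro sum.cong refl) (simp add: linear_onD(2)[OF f(1) g(1)])
    finally show ?thesis .
  qed
  have le: "norm (\<Sum>i<N'. f (g i) * \<xi> i x) \<le> p n x" if "x \<in> S" for x
    using f(2)[OF that] q(2)[OF that subspace_0[OF L(1)]] fsum[OF that] by simp
  have "f (g i) = 0" if "i < N'" "N \<le> i" for i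
    using le that by (rule N[where k = N' and c = "\<lambda>i. f (g i)"])
  then have "f y = 0"
    unfolding fsum[OF y(1)] using y(2) by (intro sum.neutral) (metis lessThan_iff mult_eq_0_iff not_less)
  then have "q y < e" using f(3) e by simp
  moreover have "(\<lambda>z. p n (y - z)) ` L \<noteq> {}" using subspace_0[OF L(1)] by blast
  ultimately obtain z where "z \<in> L" "p n (y - z) < e"
    unfolding q_def quotient_seminorm_def using cInf_lessD by (metis (no_types, lifting) imageE)
  then show ?thesis unfolding L_def by auto
qed

text \<open>A Mittag-Leffler argument: each step makes further functionals vanish, at a small cost
  in an ever stronger seminorm. The limit lies in the kernel of all of them.\<close>

lemma kernel_density:
  obtains M where "\<And>y e. y \<in> S \<Longrightarrow> (\<And>i. i < M \<Longrightarrow> \<xi> i y = 0) \<Longrightarrow> 0 < e \<Longrightarrow> \<exists>z\<in>F. p n (y - z) \<le> e"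
proof -
  have "\<forall>m. \<exists>N. \<forall>c k i. (\<forall>x\<in>S. norm (\<Sum>i<k. c i * \<xi> i x) \<le> p m x) \<longrightarrow> i < k \<longrightarrow> N \<le> i \<longrightarrow> c i = 0"
  proof
    fix m
    show "\<exists>N. \<forall>c k i. (\<forall>x\<in>S. norm (\<Sum>i<k. c i * \<xi> i x) \<le> p m x) \<longrightarrow> i < k \<longrightarrow> N \<le> i \<longrightarrow> c i = 0"
      by (rule bounded_combinations[of "p m"]) blast
  qed
  from choice[OF this] obtain N0 where N0: "\<forall>m c k i.
      (\<forall>x\<in>S. norm (\<Sum>i<k. c i * \<xi> i x) \<le> p m x) \<longrightarrow> i < k \<longrightarrow> N0 m \<le> i \<longrightarrow> c i = 0" ..
  \<comment> \<open>The maximum with m guarantees i < N (n + k) whenever i < k, so every single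
    functional vanishes from some step on.\<close>
  define N where "N = (\<lambda>m. max m (N0 m))"
  have N: "c i = 0" if "\<And>x. x \<in> S \<Longrightarrow> norm (\<Sum>i<k. c i * \<xi> i x) \<le> p m x" "i < k" "N m \<le> i"
    for m k i and c :: "nat \<Rightarrow> complex"
    using N0[THEN spec[of _ m], THEN spec[of _ c], THEN spec[of _ k], THEN spec[of _ i]] that
    by (simp add: N_def)
  have "\<exists>z\<in>F. p n (y - z) \<le> e" if y: "y \<in> S" "\<And>i. i < N n \<Longrightarrow> \<xi> i y = 0" and e: "0 < e" for y e
  proof -
    \<comment> \<open>The last conjunct pins the start at y. The steps below start from e / 2
      because \<open>fast_convergence\<close> doubles the constant.\<close>
    define P where "P = (\<lambda>k z. z \<in> S \<and> (\<forall>i<N (n + k). \<xi> i z = 0) \<and> (k = 0 \<longrightarrow> z = y))"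
    have "\<exists>z. \<forall>k. P k (z k) \<and> p (n + k) (z k - z (Suc k)) \<le> (e / 2) / 2 ^ k"
    proof (rule dependent_nat_choice)
      show "\<exists>z. P 0 z" using y unfolding P_def by auto
      show "\<exists>w. P (Suc k) w \<and> p (n + k) (z - w) \<le> (e / 2) / 2 ^ k" if z: "P k z" for z k
      proof -
        have "\<exists>w\<in>S. (\<forall>i<N (n + Suc k). \<xi> i w = 0) \<and> p (n + k) (z - w) < (e / 2) / 2 ^ k"
        proof (rule kernel_density_step[where N = "N (n + k)"])
          show "c i = 0" if "\<And>x. x \<in> S \<Longrightarrow> norm (\<Sum>i<k'. c i * \<xi> i x) \<le> p (n + k) x" "i < k'" "N (n + k) \<le> i"
            for k' i and c :: "nat \<Rightarrow> complex"
            using that by (rule N)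
        qed (use z e in \<open>auto simp: P_def\<close>)
        then show ?thesis unfolding P_def by (auto intro: less_imp_le)
      qed
    qed
    then obtain z where z: "\<And>k. P k (z k)" "\<And>k. p (n + k) (z k - z (Suc k)) \<le> (e / 2) / 2 ^ k" by blast
    have zS: "\<And>k. z k \<in> S" and z0: "z 0 = y" using z(1) unfolding P_def by auto
    obtain l where l: "l \<in> S" "\<And>m. (\<lambda>i. p m (z i - l)) \<longlonglongrightarrow> 0" "p n (z 0 - l) \<le> 2 * (e / 2)"
      using fast_convergence[OF zS z(2)] by blast
    have "\<xi> i l = 0" for i
    proof -
      have "cont_seminorm s T (\<lambda>x. norm (\<xi> i x))" using \<xi>_dual dual_iff by blast
      then obtain m C where C: "0 < C" "\<And>x. x \<in> S \<Longrightarrow> norm (\<xi> i x) \<le> C * p m x" using p_dominates by blast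
      have "norm (\<xi> i l) \<le> C * p m (z k - l)" if "i < k" for k
      proof -
        have "i < N (n + k)" using that by (simp add: N_def)
        then have "\<xi> i (z k) = 0" using z(1)[of k] unfolding P_def by blast
        then have "norm (\<xi> i l) = norm (\<xi> i (z k - l))"
          using linear_on_diff[OF \<xi>_linear subspace_S zS l(1)] by simp
        then show ?thesis using C(2)[OF S_diff[OF zS l(1)]] by simp
      qed
      moreover have "(\<lambda>k. C * p m (z k - l)) \<longlonglongrightarrow> C * 0" by (intro tendsto_intros l)
      ultimately have "norm (\<xi> i l) \<le> C * 0"
        by (intro LIMSEQ_le_const[of "\<lambda>k. C * p m (z k - l)"]) (auto intro!: exI[of _ "Suc i"])
      then show ?thesis by simp
    qed
    then show ?thesis using l z0 by auto
  qed
  then show ?thesis using that by blast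
qed

lemma Omega_sequences_kernel:
  assumes Om: "cond_Omega s (subtopology T F)"
  obtains m where "n < m" "\<And>k e x. 0 < e \<Longrightarrow> (\<And>l. x l \<in> F) \<Longrightarrow> tame (p m) x \<Longrightarrow>
      \<exists>y. (\<forall>l. y l \<in> F) \<and> tame (p k) y \<and> (\<forall>l. p n (x l - y l) \<le> e / 4 ^ l)"
proof -
  have "F \<subseteq> S" by blast
  note sub = lcs_subtopology[OF lcs_axioms F_subspace this]
  have top: "topspace (subtopology T F) = F" by auto
  have basis: "\<exists>n. \<exists>d>0. {x \<in> F. p n x < d} \<subseteq> U" if U: "zero_nhd (subtopology T F) U" for U
  proof -
    obtain W where W: "openin T W" "0 \<in> W" "W \<inter> F \<subseteq> U"
      using U unfolding zero_nhd_def openin_subtopology by blast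
    then have "zero_nhd T W" unfolding zero_nhd_def using openin_subset by blast
    then obtain n d where "0 < d" "{x \<in> S. p n x < d} \<subseteq> W" by (rule p_basis)
    then show ?thesis using W(3) by blast
  qed
  show ?thesis
  proof (rule lcs.Omega_sequences[OF sub Om, of p n, unfolded top])
    show "cont_seminorm s (subtopology T F) (p i)" for i
      by (rule cont_seminorm_subtopology[OF p_cont])
    show "p i x \<le> p j x" if "i \<le> j" "x \<in> F" for i j x
      using that by (intro p_mono) auto
  qed (fact basis, fact that)
qed

text \<open>Density gives kernel elements Z l close to a solution \<gamma>, but controls them only
  in one seminorm. Repeated use of (\<Omega>) replaces Z by sequences Y i tame in stronger and
  stronger seminorms. Stopping at stage l for the l-th element makes the diagonal tame in all
  seminorms.\<close>

lemma interpolating_sequences: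
  assumes Om: "cond_Omega s (subtopology T F)"
  obtains M where "\<And>j e. M \<le> j \<Longrightarrow> 0 < e \<Longrightarrow> \<exists>g. (\<forall>l. g l \<in> S) \<and>
    (\<forall>i l. \<xi> i (g l) = (if i = j then 1 else 0)) \<and> (\<forall>l. p n (g l) \<le> e / 4 ^ l) \<and> (\<forall>k. tame (p k) g)"
proof -
  have "\<forall>n. \<exists>m. n < m \<and> (\<forall>k e x. 0 < e \<longrightarrow> (\<forall>l. x l \<in> F) \<longrightarrow> tame (p m) x \<longrightarrow>
      (\<exists>y. (\<forall>l. y l \<in> F) \<and> tame (p k) y \<and> (\<forall>l. p n (x l - y l) \<le> e / 4 ^ l)))"
  proof
    fix n
    show "\<exists>m. n < m \<and> (\<forall>k e x. 0 < e \<longrightarrow> (\<forall>l. x l \<in> F) \<longrightarrow> tame (p m) x \<longrightarrow>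
      (\<exists>y. (\<forall>l. y l \<in> F) \<and> tame (p k) y \<and> (\<forall>l. p n (x l - y l) \<le> e / 4 ^ l)))"
      by (rule Omega_sequences_kernel[OF Om, of n]) blast
  qed
  from choice[OF this] obtain \<mu> where \<mu>: "\<forall>n. n < \<mu> n \<and> (\<forall>k e x. 0 < e \<longrightarrow> (\<forall>l. x l \<in> F) \<longrightarrow> tame (p (\<mu> n)) x \<longrightarrow>
      (\<exists>y. (\<forall>l. y l \<in> F) \<and> tame (p k) y \<and> (\<forall>l. p n (x l - y l) \<le> e / 4 ^ l)))" ..
  \<comment> \<open>Iterating the level map of (\<Omega>) aligns consecutive steps: tameness at
    level \<nu> (Suc i) is the input for a correction measured at level \<nu> i.\<close>
  define \<nu> where "\<nu> = (\<lambda>i. (\<mu> ^^ i) n)"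
  have \<nu>0: "\<nu> 0 = n" and \<nu>S: "\<nu> (Suc i) = \<mu> (\<nu> i)" for i by (auto simp: \<nu>_def)
  have \<nu>_less: "\<nu> i < \<nu> (Suc i)" for i
    using \<mu>[THEN spec[of _ "\<nu> i"], THEN conjunct1] unfolding \<nu>S .
  have \<nu>_mono: "\<nu> i \<le> \<nu> j" if "i \<le> j" for i j
    by (rule lift_Suc_mono_le[of \<nu>, OF less_imp_le[OF \<nu>_less] that])
  have \<nu>_ge: "i \<le> \<nu> i" for i
  proof (induction i)
    case (Suc i)
    then show ?case using \<nu>_less[of i] by linarith
  qed simp
  \<comment> \<open>Density is taken one level above n, where the first (\<Omega>) step needs its
    input to be tame. For j \<ge> M the element \<gamma> satisfies the vanishing condition.\<close>
  obtain M where M: "\<And>y e. y \<in> S \<Longrightarrow> (\<And>i. i < M \<Longrightarrow> \<xi> i y = 0) \<Longrightarrow> 0 < e \<Longrightarrow> \<exists>z\<in>F. p (\<nu> 1) (y - z) \<le> e"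
  proof (rule kernel_density[of "\<nu> 1"])
    fix M assume "\<And>y e. y \<in> S \<Longrightarrow> (\<And>i. i < M \<Longrightarrow> \<xi> i y = 0) \<Longrightarrow> 0 < e \<Longrightarrow> \<exists>z\<in>F. p (\<nu> 1) (y - z) \<le> e"
    then show thesis by (rule that)
  qed
  have "\<exists>g. (\<forall>l. g l \<in> S) \<and> (\<forall>i l. \<xi> i (g l) = (if i = j then 1 else 0)) \<and>
      (\<forall>l. p n (g l) \<le> e / 4 ^ l) \<and> (\<forall>k. tame (p k) g)" if j: "M \<le> j" and e: "0 < e" for j e
  proof -
    obtain \<gamma> where \<gamma>: "\<gamma> \<in> S" "\<forall>i. \<xi> i \<gamma> = (if i = j then 1 else 0)"
      using \<xi>_surj[of "\<lambda>i. if i = j then 1 else 0"] by blast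
    have "\<exists>z\<in>F. p (\<nu> 1) (\<gamma> - z) \<le> e / 2 / 4 ^ l" for l
      by (rule M) (use \<gamma> j e in auto)
    then have "\<forall>l. \<exists>z. z \<in> F \<and> p (\<nu> 1) (\<gamma> - z) \<le> e / 2 / 4 ^ l" by blast
    from choice[OF this] obtain Z where Z': "\<forall>l. Z l \<in> F \<and> p (\<nu> 1) (\<gamma> - Z l) \<le> e / 2 / 4 ^ l" ..
    have Z: "Z l \<in> F" "p (\<nu> 1) (\<gamma> - Z l) \<le> e / 2 / 4 ^ l" for l
      using Z'[THEN spec[of _ l]] by blast+
    have tameZ: "tame (p (\<nu> 1)) Z"
    proof (rule tame_bounded)
      fix l
      have "p (\<nu> 1) (Z l) \<le> p (\<nu> 1) \<gamma> + p (\<nu> 1) (\<gamma> - Z l)"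
        using p_diff(1)[OF \<gamma>(1) S_diff[OF \<gamma>(1)], of "Z l" "\<nu> 1"] Z(1)[of l] by simp
      moreover have "e / 2 / 4 ^ l \<le> e / 2 / 1" using e by (intro divide_left_mono) auto
      ultimately show "p (\<nu> 1) (Z l) \<le> p (\<nu> 1) \<gamma> + e / 2" using Z(2)[of l] by simp
    qed
    \<comment> \<open>The costs e / 4 / 2 ^ i add up to e / 2; the other half of e goes to the
      density step.\<close>
    have "\<exists>Y. \<forall>i. ((\<forall>l. Y i l \<in> F) \<and> tame (p (\<nu> (Suc i))) (Y i) \<and> (i = 0 \<longrightarrow> Y i = Z)) \<and>
        (\<forall>l. p (\<nu> i) (Y i l - Y (Suc i) l) \<le> e / 4 / 2 ^ i / 4 ^ l)"
    proof (rule dependent_nat_choice)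
      show "\<exists>Y. (\<forall>l. Y l \<in> F) \<and> tame (p (\<nu> (Suc 0))) Y \<and> (0 = (0::nat) \<longrightarrow> Y = Z)"
        using Z tameZ by auto
      fix Y i assume Y: "(\<forall>l. Y l \<in> F) \<and> tame (p (\<nu> (Suc i))) Y \<and> (i = 0 \<longrightarrow> Y = Z)"
      have "0 < e / 4 / 2 ^ i" using e by simp
      then obtain Y' where "\<forall>l. Y' l \<in> F" "tame (p (\<nu> (Suc (Suc i)))) Y'"
        "\<forall>l. p (\<nu> i) (Y l - Y' l) \<le> e / 4 / 2 ^ i / 4 ^ l"
        using \<mu>[THEN spec[of _ "\<nu> i"], THEN conjunct2, rule_format, of "e / 4 / 2 ^ i" Y] Y
        unfolding \<nu>S[of i] by blast
      then show "\<exists>Y'. ((\<forall>l. Y' l \<in> F) \<and> tame (p (\<nu> (Suc (Suc i)))) Y' \<and> (Suc i = 0 \<longrightarrow> Y' = Z)) \<and>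
          (\<forall>l. p (\<nu> i) (Y l - Y' l) \<le> e / 4 / 2 ^ i / 4 ^ l)" by blast
    qed
    then obtain Y where Y: "\<forall>i. ((\<forall>l. Y i l \<in> F) \<and> tame (p (\<nu> (Suc i))) (Y i) \<and> (i = 0 \<longrightarrow> Y i = Z)) \<and>
        (\<forall>l. p (\<nu> i) (Y i l - Y (Suc i) l) \<le> e / 4 / 2 ^ i / 4 ^ l)" ..
    have YF: "Y i l \<in> F" and Yt: "tame (p (\<nu> (Suc i))) (Y i)" and Y0: "Y 0 = Z"
      and Yd: "p (\<nu> i) (Y i l - Y (Suc i) l) \<le> e / 4 / 2 ^ i / 4 ^ l" for i l
      using Y[THEN spec[of _ i]] Y[THEN spec[of _ 0]] by simp_all
    have YS: "Y i l \<in> S" for i l using YF by blast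
    have tele: "p m (Y a l - Y (a + k) l) \<le> e / 2 / 2 ^ a / 4 ^ l * (1 - 1 / 2 ^ k)" if m: "m \<le> \<nu> a" for m a k l
    proof (induction k)
      case 0
      then show ?case by (simp add: p_zero)
    next
      case (Suc k)
      have "p m (Y (a + k) l - Y (Suc (a + k)) l) \<le> p (\<nu> (a + k)) (Y (a + k) l - Y (Suc (a + k)) l)"
        using m \<nu>_mono[of a "a + k"] YS by (intro p_mono S_diff) auto
      also have "\<dots> \<le> e / 4 / 2 ^ (a + k) / 4 ^ l" by (rule Yd)
      finally have step: "p m (Y (a + k) l - Y (Suc (a + k)) l) \<le> e / 4 / 2 ^ (a + k) / 4 ^ l" .
      have "p m (Y a l - Y (a + Suc k) l) = p m ((Y a l - Y (a + k) l) + (Y (a + k) l - Y (Suc (a + k)) l))"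
        by simp
      also have "\<dots> \<le> p m (Y a l - Y (a + k) l) + p m (Y (a + k) l - Y (Suc (a + k)) l)"
        using YS by (intro p_triangle S_diff) auto
      also have "\<dots> \<le> e / 2 / 2 ^ a / 4 ^ l * (1 - 1 / 2 ^ k) + e / 4 / 2 ^ (a + k) / 4 ^ l"
        using Suc.IH step by linarith
      also have "\<dots> = e / 2 / 2 ^ a / 4 ^ l * (1 - 1 / 2 ^ Suc k)" by (simp add: power_add field_simps)
      finally show ?case .
    qed
    have tele': "p m (Y a l - Y (a + k) l) \<le> e / 2 / 4 ^ l" if m: "m \<le> \<nu> a" for m a k l
    proof -
      have "e / 2 / 2 ^ a / 4 ^ l * (1 - 1 / 2 ^ k) \<le> e / 2 / 2 ^ a / 4 ^ l * 1"
        using e by (intro mult_left_mono) auto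
      also have "e / 2 / 2 ^ a / 4 ^ l * 1 \<le> e / 2 / 4 ^ l" using e by (simp add: field_simps)
      finally show ?thesis using tele[OF m, of l k] by linarith
    qed
    \<comment> \<open>The diagonal: p k (Y l l) differs from p k (Y k l) by at most e / 2 for l
      \<ge> k, which leaves only finitely many exceptional l.\<close>
    define g where "g = (\<lambda>l. \<gamma> - Y l l)"
    have gS: "g l \<in> S" for l unfolding g_def using \<gamma> YS by (intro S_diff)
    moreover have "\<xi> i (g l) = (if i = j then 1 else 0)" for i l
      using linear_on_diff[OF \<xi>_linear subspace_S \<gamma>(1) YS] \<gamma>(2) YF[of l l] by (simp add: g_def)
    moreover have "p n (g l) \<le> e / 4 ^ l" for l
    proof -
      have "p n (g l) = p n ((\<gamma> - Z l) + (Y 0 l - Y (0 + l) l))" by (simp add: g_def Y0)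
      also have "\<dots> \<le> p n (\<gamma> - Z l) + p n (Y 0 l - Y (0 + l) l)"
        using YS Z(1)[of l] \<gamma> by (intro p_triangle S_diff) auto
      also have "p n (\<gamma> - Z l) \<le> p (\<nu> 1) (\<gamma> - Z l)"
        using \<nu>_less[of 0] Z(1)[of l] \<gamma> by (intro p_mono S_diff) (auto simp: \<nu>0)
      also have "\<dots> \<le> e / 2 / 4 ^ l" by (rule Z(2))
      finally show ?thesis using tele'[of n 0 l l] by (simp add: \<nu>0)
    qed
    moreover have "tame (p k) g" for k
    proof -
      \<comment> \<open>The sum takes care of the exceptional indices l < k.\<close>
      define C where "C = e / 2 + (\<Sum>l<k. p k (Y l l))"
      have C0: "0 \<le> (\<Sum>l<k. p k (Y l l))" using YS p_nonneg by (intro sum_nonneg) auto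
      have tk: "tame (p k) (Y k)"
      proof -
        obtain B c where "\<And>l. p (\<nu> (Suc k)) (Y k l) \<le> B * 2 ^ (c * l)" using Yt[of k] tameE by blast
        moreover have "p k (Y k l) \<le> p (\<nu> (Suc k)) (Y k l)" for l
          using \<nu>_ge[of "Suc k"] YS by (intro p_mono) auto
        ultimately show ?thesis by (intro tameI) (rule order_trans)
      qed
      have "p k (Y l l) \<le> p k (Y k l) + C" for l
      proof (cases "l < k")
        case True
        have "p k (Y l l) \<le> (\<Sum>l<k. p k (Y l l))"
          using True YS p_nonneg by (intro member_le_sum[of l]) auto
        then show ?thesis using e p_nonneg[OF YS, of k k l] by (simp add: C_def)
      next
        case False
        have "p k (Y l l) = p k (Y k l - (Y k l - Y (k + (l - k)) l))" using False by simp
        also have "\<dots> \<le> p k (Y k l) + p k (Y k l - Y (k + (l - k)) l)"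
          using YS by (intro p_diff(1) S_diff)
        also have "p k (Y k l - Y (k + (l - k)) l) \<le> e / 2 / 4 ^ l" by (rule tele'[OF \<nu>_ge])
        also have "e / 2 / 4 ^ l \<le> e / 2 / 1" using e by (intro divide_left_mono) auto
        finally show ?thesis using C0 by (simp add: C_def)
      qed
      moreover have "p k (g l) \<le> p k \<gamma> + p k (Y l l)" for l
        unfolding g_def using \<gamma> YS by (intro p_diff(1))
      ultimately have *: "p k (g l) \<le> p k (Y k l) + (p k \<gamma> + C)" for l by (smt (verit))
      obtain B c where B: "1 \<le> B" "\<And>l. p k (Y k l) \<le> B * 2 ^ (c * l)" using tk tameE by blast
      have "p k (g l) \<le> (B + (p k \<gamma> + C)) * 2 ^ (c * l)" for l
      proof -
        have "0 \<le> p k \<gamma> + C" using p_nonneg[OF \<gamma>(1), of k] C0 e by (simp add: C_def)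
        then have "p k \<gamma> + C \<le> (p k \<gamma> + C) * 2 ^ (c * l)" by (simp add: mult_le_cancel_left1)
        then show ?thesis using *[of l] B(2)[of l] by (simp add: distrib_right)
      qed
      then show ?thesis by (rule tameI)
    qed
    ultimately show ?thesis by blast
  qed
  then show ?thesis using that by blast
qed

end

section \<open>Resolutions in spaces with condition (A)\<close>

context lcs
begin

lemma tvs_bounded_singleton: "x \<in> S \<Longrightarrow> tvs_bounded s T {x}"
  by (rule tvs_boundedI) auto

text \<open>A normal form of (A) with exponent 1. One disk D0 contains the bounded set B N that (A)
  fixes, and the constant is absorbed into the larger disk D.\<close>

lemma cond_A_strong:
  assumes A: "cond_A s T" and lc: "locally_complete s T"
  obtains D0 where "banach_disk s T D0" "\<And>B. tvs_bounded s T B \<Longrightarrow>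
    \<exists>D. banach_disk s T D \<and> B \<subseteq> D \<and> D0 \<subseteq> D \<and> (\<forall>r>0. B \<subseteq> dil_sum r D (1 / r) D0)"
proof -
  obtain B N where B: "fundamental_bounded s T B" "incseq B" and A': "\<And>M \<nu>. N \<le> M \<Longrightarrow> 0 < \<nu> \<Longrightarrow>
      \<exists>K\<ge>M. \<exists>C>0. \<forall>r>0. B M \<subseteq> {s (of_real r) x + s (of_real (C / r powr \<nu>)) y | x y. x \<in> B K \<and> y \<in> B N}"
    using A unfolding cond_A_def by blast
  have disk: "\<exists>D. banach_disk s T D \<and> X \<subseteq> D" if "tvs_bounded s T X" for X
    using lc that unfolding locally_complete_def by blast
  have Bb: "tvs_bounded s T (B n)" for n using B(1) unfolding fundamental_bounded_def by blast
  obtain D0 where D0: "banach_disk s T D0" "B N \<subseteq> D0" using disk[OF Bb] by blast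
  have "\<exists>D. banach_disk s T D \<and> X \<subseteq> D \<and> D0 \<subseteq> D \<and> (\<forall>r>0. X \<subseteq> dil_sum r D (1 / r) D0)"
    if X: "tvs_bounded s T X" for X
  proof -
    obtain M' where "X \<subseteq> B M'" using B(1) X unfolding fundamental_bounded_def by blast
    moreover define M where "M = max M' N"
    ultimately have XM: "X \<subseteq> B M" using B(2) incseqD[of B M' M] by auto
    obtain K C where C: "0 < C" "\<And>r. 0 < r \<Longrightarrow>
        B M \<subseteq> {s (of_real r) x + s (of_real (C / r powr 1)) y | x y. x \<in> B K \<and> y \<in> B N}"
      using A'[of M 1] by (auto simp: M_def)
    obtain D where D: "banach_disk s T D" "X \<union> (D0 \<union> dil C (B K)) \<subseteq> D"
      using disk[OF tvs_bounded_Un[OF X tvs_bounded_Un[OF banach_disk_bounded[OF D0(1)] tvs_bounded_dil[OF Bb]]]]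
      by blast
    have "x \<in> dil_sum r D (1 / r) D0" if r: "0 < r" and x: "x \<in> X" for r x
    proof -
      \<comment> \<open>Applying (A) with r * C turns the second factor into 1 / r and moves C into
        D, which contains C times B K.\<close>
      have "0 < r * C" using r C(1) by simp
      then obtain u v where uv: "x = s (of_real (r * C)) u + s (of_real (C / (r * C) powr 1)) v" "u \<in> B K" "v \<in> B N"
        using C(2)[of "r * C"] XM x by blast
      have "s (of_real C) u \<in> D" using D(2) uv(2) by (auto simp: dil_def)
      then have "s (of_real (r * C)) u \<in> dil r D" by (rule dilI) simp
      moreover have "C / (r * C) powr 1 = 1 / r" using r C(1) by simp
      then have "s (of_real (C / (r * C) powr 1)) v \<in> dil (1 / r) D0"
        using uv(3) D0(2) by (intro dilI) auto
      ultimately show ?thesis using uv(1) by blast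
    qed
    then show ?thesis using D by blast
  qed
  then show ?thesis using that D0(1) by blast
qed

text \<open>For fixed l, split e repeatedly with parameter 1 / 2 ^ l along a chain of disks. After i
  steps the remainder lies in D i with factor 1 / 2 ^ (i * l), while the pieces removed lie in
  multiples of D0. Stopping after l steps gives b l, and comparing with the remainder at the fixed
  step Suc \<mu> gives decay of rate \<mu> in one disk.\<close>

lemma cond_A_resolution:
  assumes D0: "banach_disk s T D0" and strong: "\<And>B. tvs_bounded s T B \<Longrightarrow>
      \<exists>D. banach_disk s T D \<and> B \<subseteq> D \<and> D0 \<subseteq> D \<and> (\<forall>r>0. B \<subseteq> dil_sum r D (1 / r) D0)"
    and e: "e \<in> S"
  obtains b where "b 0 = 0" "\<And>l. b l \<in> dil (2 * 2 ^ l) D0"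
    "\<And>\<mu>. \<exists>K. \<exists>C>0. banach_disk s T K \<and> (\<forall>l. e - b l \<in> dil (C / 2 ^ (\<mu> * l)) K)"
proof -
  have "\<exists>D. \<forall>i. (banach_disk s T (D i) \<and> D0 \<subseteq> D i \<and> (i = 0 \<longrightarrow> e \<in> D i)) \<and>
      (D i \<subseteq> D (Suc i) \<and> (\<forall>r>0. D i \<subseteq> dil_sum r (D (Suc i)) (1 / r) D0))"
  proof (rule dependent_nat_choice)
    show "\<exists>D. banach_disk s T D \<and> D0 \<subseteq> D \<and> (0 = (0::nat) \<longrightarrow> e \<in> D)"
      using strong[OF tvs_bounded_singleton[OF e]] by blast
    show "\<exists>D'. (banach_disk s T D' \<and> D0 \<subseteq> D' \<and> (Suc i = 0 \<longrightarrow> e \<in> D')) \<and>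
        (D \<subseteq> D' \<and> (\<forall>r>0. D \<subseteq> dil_sum r D' (1 / r) D0))"
      if D: "banach_disk s T D \<and> D0 \<subseteq> D \<and> (i = 0 \<longrightarrow> e \<in> D)" for D and i :: nat
    proof -
      obtain D' where "banach_disk s T D'" "D \<subseteq> D'" "D0 \<subseteq> D'" "\<forall>r>0. D \<subseteq> dil_sum r D' (1 / r) D0"
        using strong[OF banach_disk_bounded, of D] D by auto
      then show ?thesis by (intro exI[of _ D'] conjI impI) auto
    qed
  qed
  then obtain D where D': "\<forall>i. (banach_disk s T (D i) \<and> D0 \<subseteq> D i \<and> (i = 0 \<longrightarrow> e \<in> D i)) \<and>
      (D i \<subseteq> D (Suc i) \<and> (\<forall>r>0. D i \<subseteq> dil_sum r (D (Suc i)) (1 / r) D0))" ..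
  have D: "banach_disk s T (D i)" "D0 \<subseteq> D i" "e \<in> D 0" "D i \<subseteq> D (Suc i)"
    and Dstep: "0 < r \<Longrightarrow> D i \<subseteq> dil_sum r (D (Suc i)) (1 / r) D0" for i and r :: real
    using D'[THEN spec[of _ i]] D'[THEN spec[of _ 0]] by simp_all
  note Da = banach_disk_abs_convex[OF D(1)] and D0a = banach_disk_abs_convex[OF D0]
  have Dmono: "D i \<subseteq> D j" if "i \<le> j" for i j by (rule lift_Suc_mono_le[of D, OF D(4) that])
  \<comment> \<open>Here c i is the remainder after i steps; the accumulated part is never tracked
    separately.\<close>
  have "\<exists>c. \<forall>i. (c i \<in> dil (1 / 2 ^ (i * l)) (D i) \<and> (i = 0 \<longrightarrow> c i = e)) \<and>
      c i - c (Suc i) \<in> dil (2 ^ l / 2 ^ (i * l)) D0" for l :: nat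
  proof (rule dependent_nat_choice)
    show "\<exists>c. c \<in> dil (1 / 2 ^ (0 * l)) (D 0) \<and> (0 = (0::nat) \<longrightarrow> c = e)" using D(3) by simp
    fix c i assume c: "c \<in> dil (1 / 2 ^ (i * l)) (D i) \<and> (i = 0 \<longrightarrow> c = e)"
    define \<rho> where "\<rho> = (1 / 2 ^ (i * l) :: real)"
    have \<rho>: "0 < \<rho>" by (simp add: \<rho>_def)
    obtain d where d: "d \<in> D i" "c = s (of_real \<rho>) d" using c by (auto simp: dil_def \<rho>_def)
    obtain x y where xy: "d = x + y" "x \<in> dil (1 / 2 ^ l) (D (Suc i))" "y \<in> dil (1 / (1 / 2 ^ l)) D0"
      using Dstep[of "1 / 2 ^ l" i] d(1) by auto
    have "s (of_real \<rho>) x \<in> dil (norm (complex_of_real \<rho>) * (1 / 2 ^ l)) (D (Suc i))"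
      by (rule abs_convex_dil_scale[OF Da _ xy(2)]) simp
    moreover have "norm (complex_of_real \<rho>) * (1 / 2 ^ l) = 1 / 2 ^ (Suc i * l)"
      using \<rho> by (simp add: power_add) (simp add: \<rho>_def)
    moreover have "s (of_real \<rho>) y \<in> dil (norm (complex_of_real \<rho>) * (1 / (1 / 2 ^ l))) D0"
      by (rule abs_convex_dil_scale[OF D0a _ xy(3)]) simp
    moreover have "norm (complex_of_real \<rho>) * (1 / (1 / 2 ^ l)) = 2 ^ l / 2 ^ (i * l)"
      using \<rho> by simp (simp add: \<rho>_def)
    moreover have "c - s (of_real \<rho>) x = s (of_real \<rho>) y" by (simp add: d(2) xy(1) scale_right_distrib)
    ultimately show "\<exists>c'. (c' \<in> dil (1 / 2 ^ (Suc i * l)) (D (Suc i)) \<and> (Suc i = 0 \<longrightarrow> c' = e)) \<and>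
        c - c' \<in> dil (2 ^ l / 2 ^ (i * l)) D0"
      by (intro exI[of _ "s (of_real \<rho>) x"]) simp
  qed
  then obtain c where c: "\<And>l i. c l i \<in> dil (1 / 2 ^ (i * l)) (D i)" "\<And>l. c l 0 = e"
    "\<And>l i. c l i - c l (Suc i) \<in> dil (2 ^ l / 2 ^ (i * l)) D0" by metis
  \<comment> \<open>For l \<ge> 1 the ratio 1 / 2 ^ l is at most 1 / 2, so the pieces add up to at
    most twice the first one.\<close>
  have tele: "c l a - c l (a + k) \<in> dil (2 * 2 ^ l / 2 ^ (a * l)) D0" if l: "1 \<le> l" for l a k
  proof -
    define m where "m = (2 ^ l / 2 ^ (a * l) :: real)"
    have m: "0 < m" by (simp add: m_def)
    have "c l a - c l (a + k) \<in> dil (2 * m * (1 - 1 / 2 ^ k)) D0"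
    proof (induction k)
      case 0
      then show ?case using abs_convex_zero_dil[OF D0a] by simp
    next
      case (Suc k)
      have "(2::real) ^ k \<le> 2 ^ (k * l)" using l by (intro power_increasing) auto
      then have "m / 2 ^ (k * l) \<le> m / 2 ^ k" using m by (intro divide_left_mono) auto
      moreover have "2 ^ l / 2 ^ ((a + k) * l) = m / 2 ^ (k * l)" by (simp add: m_def distrib_right power_add)
      ultimately have "dil (2 ^ l / 2 ^ ((a + k) * l)) D0 \<subseteq> dil (m / 2 ^ k) D0"
        using m by (intro abs_convex_dil_mono[OF D0a]) auto
      then have "c l (a + k) - c l (Suc (a + k)) \<in> dil (m / 2 ^ k) D0" using c(3) by blast
      then have "(c l a - c l (a + k)) + (c l (a + k) - c l (Suc (a + k))) \<in> dil (2 * m * (1 - 1 / 2 ^ k) + m / 2 ^ k) D0"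
        using m by (intro abs_convex_dil_add[OF D0a _ _ Suc.IH]) auto
      moreover have "2 * m * (1 - 1 / 2 ^ k) + m / 2 ^ k = 2 * m * (1 - 1 / 2 ^ Suc k)" by (simp add: field_simps)
      ultimately show ?case by simp
    qed
    moreover have "dil (2 * m * (1 - 1 / 2 ^ k)) D0 \<subseteq> dil (2 * m) D0"
      using m by (intro abs_convex_dil_mono[OF D0a]) (auto simp: mult_le_cancel_left2)
    ultimately show ?thesis by (auto simp: m_def)
  qed
  define b where "b = (\<lambda>l. e - c l l)"
  have "b 0 = 0" by (simp add: b_def c(2))
  moreover have "b l \<in> dil (2 * 2 ^ l) D0" for l
  proof (cases "l = 0")
    case True
    then show ?thesis using \<open>b 0 = 0\<close> abs_convex_zero_dil[OF D0a] by simp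
  next
    case False
    then show ?thesis using tele[of l 0 l] by (simp add: b_def c(2))
  qed
  moreover have "\<exists>K. \<exists>C>0. banach_disk s T K \<and> (\<forall>l. e - b l \<in> dil (C / 2 ^ (\<mu> * l)) K)" for \<mu>
  proof -
    \<comment> \<open>The 3 collects the remainder at step Suc \<mu> and twice the first later
      piece; the power of 2 covers the finitely many l \<le> \<mu>, which have not reached that
      step.\<close>
    define C where "C = (3 * 2 ^ (\<mu> * Suc \<mu>) :: real)"
    have C: "3 \<le> C" "2 ^ (\<mu> * Suc \<mu>) \<le> C" by (simp_all add: C_def del: mult_Suc_right)
    have "c l l \<in> dil (C / 2 ^ (\<mu> * l)) (D (Suc \<mu>))" for l
    proof (cases "Suc \<mu> \<le> l")
      case True
      define m where "m = (1 / 2 ^ (\<mu> * l) :: real)"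
      have m: "0 < m" by (simp add: m_def)
      have "c l (Suc \<mu>) - c l (Suc \<mu> + (l - Suc \<mu>)) \<in> dil (2 * 2 ^ l / 2 ^ (Suc \<mu> * l)) D0"
        using True by (intro tele) auto
      moreover have "2 * 2 ^ l / 2 ^ (Suc \<mu> * l) = 2 * m" by (simp add: m_def power_add)
      ultimately have 1: "c l (Suc \<mu>) - c l l \<in> dil (2 * m) (D (Suc \<mu>))"
        using True dil_mono[OF D(2)[of "Suc \<mu>"]] by auto
      have "1 / 2 ^ (Suc \<mu> * l) \<le> m" by (simp add: m_def power_add field_simps)
      then have "dil (1 / 2 ^ (Suc \<mu> * l)) (D (Suc \<mu>)) \<subseteq> dil m (D (Suc \<mu>))"
        by (intro abs_convex_dil_mono[OF Da]) auto
      then have 2: "c l (Suc \<mu>) \<in> dil m (D (Suc \<mu>))" using c(1) by blast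
      have "c l (Suc \<mu>) - (c l (Suc \<mu>) - c l l) \<in> dil (m + 2 * m) (D (Suc \<mu>))"
        using m by (intro abs_convex_dil_diff[OF Da _ _ 2 1]) auto
      moreover have "dil (m + 2 * m) (D (Suc \<mu>)) \<subseteq> dil (C * m) (D (Suc \<mu>))"
        using m C(1) by (intro abs_convex_dil_mono[OF Da]) auto
      ultimately show ?thesis by (auto simp: m_def)
    next
      case False
      have "(2::real) ^ (\<mu> * l) \<le> 2 ^ (\<mu> * Suc \<mu>)" using False by (intro power_increasing mult_le_mono) auto
      then have "2 ^ (\<mu> * l) \<le> C" using C(2) by linarith
      then have "1 \<le> C / 2 ^ (\<mu> * l)" by simp
      have le: "1 / 2 ^ (l * l) \<le> C / 2 ^ (\<mu> * l)" by (rule order_trans[OF _ \<open>1 \<le> _\<close>]) simp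
      have "dil (1 / 2 ^ (l * l)) (D (Suc \<mu>)) \<subseteq> dil (C / 2 ^ (\<mu> * l)) (D (Suc \<mu>))"
        by (rule abs_convex_dil_mono[OF Da _ le]) simp
      moreover have "D l \<subseteq> D (Suc \<mu>)" using False by (intro Dmono) auto
      ultimately show ?thesis using c(1)[of l l] dil_mono by blast
    qed
    moreover have "C > 0" using C by linarith
    ultimately show ?thesis using D(1) by (intro exI[of _ "D (Suc \<mu>)"] exI[of _ C]) (auto simp: b_def)
  qed
  ultimately show ?thesis using that by blast
qed

end

section \<open>Elements of the epsilon product defined by series\<close>

text \<open>Summation over an index set along finite sets Q t. A series dominated by the weights has
  the explicit tail bound L - W t, uniform over all families with the same dominating constant. The
  double series is later summed over squares.\<close>

locale weighted_exhaustion =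
  fixes Q :: "nat \<Rightarrow> 'i set" and w :: "'i \<Rightarrow> real" and L :: real
  assumes finite_Q: "finite (Q t)" and incseq_Q: "incseq Q" and w_nonneg: "0 \<le> w i"
    and weights_lim: "(\<lambda>t. \<Sum>i\<in>Q t. w i) \<longlonglongrightarrow> L"
begin

abbreviation W where "W t \<equiv> \<Sum>i\<in>Q t. w i"

lemma Q_mono: "t \<le> u \<Longrightarrow> Q t \<subseteq> Q u"
  using incseq_Q by (simp add: incseq_def)

lemma sum_Q_diff:
  fixes x :: "'i \<Rightarrow> 'b::ab_group_add"
  shows "t \<le> u \<Longrightarrow> (\<Sum>i\<in>Q u. x i) - (\<Sum>i\<in>Q t. x i) = (\<Sum>i\<in>Q u - Q t. x i)"
  by (simp add: sum_diff finite_Q Q_mono)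

lemma W_mono: "t \<le> u \<Longrightarrow> W t \<le> W u"
  by (intro sum_mono2 finite_Q Q_mono w_nonneg)

lemma W_le: "W t \<le> L"
  using weights_lim by (rule incseq_le[rotated]) (simp add: incseq_def W_mono)

lemma W_tail:
  assumes "0 < e" "0 \<le> H"
  obtains k where "\<And>t. k \<le> t \<Longrightarrow> H * (L - W t) < e"
proof -
  have "(\<lambda>t. H * (L - W t)) \<longlonglongrightarrow> H * (L - L)" by (intro tendsto_intros weights_lim)
  then have "\<forall>\<^sub>F t in sequentially. H * (L - W t) < e" using assms by (intro order_tendstoD) auto
  then show ?thesis using that unfolding eventually_sequentially by blast
qed

end

context lcs
begin

lemma limitin_S: "limitin T f l F \<Longrightarrow> l \<in> S"
  unfolding limitin_def by blast

lemma limitin_unique: "limitin T f l sequentially \<Longrightarrow> limitin T f l' sequentially \<Longrightarrow> l = l'"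
  using lcHs limitin_Hausdorff_unique unfolding lcHs_def by (metis sequentially_bot)

lemma limitin_add:
  assumes f: "limitin T f a sequentially" "\<And>n. f n \<in> S" and g: "limitin T g b sequentially" "\<And>n. g n \<in> S"
  shows "limitin T (\<lambda>n. f n + g n) (a + b) sequentially"
proof (rule limitin_seminormI)
  have ab: "a \<in> S" "b \<in> S" using limitin_S f g by auto
  then show "a + b \<in> S" by (rule S_add)
  show "\<forall>\<^sub>F n in sequentially. f n + g n \<in> S" using f g by (simp add: S_add)
  fix p assume p: "cont_seminorm s T p"
  note p' = cont_seminorm_seminorm_on[OF p]
  have lim: "(\<lambda>n. p (f n - a) + p (g n - b)) \<longlonglongrightarrow> 0 + 0"
    by (intro tendsto_add limitin_seminormD[OF f(1) p] limitin_seminormD[OF g(1) p])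
  have eq: "f n + g n - (a + b) = (f n - a) + (g n - b)" for n by simp
  show "(\<lambda>n. p (f n + g n - (a + b))) \<longlonglongrightarrow> 0"
  proof (rule tendsto_sandwich[OF _ _ tendsto_const])
    show "\<forall>\<^sub>F n in sequentially. 0 \<le> p (f n + g n - (a + b))"
      using f g ab by (simp add: S_add S_diff seminorm_onD(1)[OF p'])
    show "\<forall>\<^sub>F n in sequentially. p (f n + g n - (a + b)) \<le> p (f n - a) + p (g n - b)"
      unfolding eq using f g ab by (simp add: S_diff seminorm_onD(2)[OF p'])
  qed (use lim in simp)
qed

lemma limitin_scale:
  assumes f: "limitin T f a sequentially" "\<And>n. f n \<in> S"
  shows "limitin T (\<lambda>n. s c (f n)) (s c a) sequentially"
proof (rule limitin_seminormI)
  have a: "a \<in> S" using limitin_S f by auto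
  then show "s c a \<in> S" by (rule S_scale)
  show "\<forall>\<^sub>F n in sequentially. s c (f n) \<in> S" using f by (simp add: S_scale)
  fix p assume p: "cont_seminorm s T p"
  have "p (s c (f n) - s c a) = norm c * p (f n - a)" for n
    using seminorm_onD(3)[OF cont_seminorm_seminorm_on[OF p] S_diff[OF f(2) a], of c n]
    by (simp add: scale_right_diff_distrib)
  moreover have "(\<lambda>n. norm c * p (f n - a)) \<longlonglongrightarrow> norm c * 0"
    by (intro tendsto_mult_left limitin_seminormD[OF f(1) p])
  ultimately show "(\<lambda>n. p (s c (f n) - s c a)) \<longlonglongrightarrow> 0" by simp
qed

lemma cont_seminorm_limit_le:
  assumes f: "limitin T f a sequentially" "\<And>n. f n \<in> S" and p: "cont_seminorm s T p"
    and le: "\<And>n. N \<le> n \<Longrightarrow> p (f n) \<le> c"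
  shows "p a \<le> c"
proof -
  note p' = cont_seminorm_seminorm_on[OF p]
  have a: "a \<in> S" using limitin_S f by auto
  have "p a \<le> c + p (f n - a)" if "N \<le> n" for n
    using le[OF that] seminorm_on_diff(2)[OF p' subspace_S f(2) a, of n] by linarith
  moreover have "(\<lambda>n. c + p (f n - a)) \<longlonglongrightarrow> c + 0" by (intro tendsto_intros limitin_seminormD[OF f(1) p])
  ultimately have "p a \<le> c + 0" by (intro LIMSEQ_le_const[of "\<lambda>n. c + p (f n - a)"]) auto
  then show ?thesis by simp
qed

text \<open>Absolutely convergent series converge in the Banach space spanned by D, and its
  inclusion is continuous. The witness a keeps the actual size of x i separate from its bound; H may
  be negative until replaced by H'.\<close>

lemma banach_disk_series:
  assumes "weighted_exhaustion Q w L" and D: "banach_disk s T D"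
    and x: "\<And>i. \<exists>a\<ge>0. x i \<in> dil a D \<and> a \<le> H * w i"
  shows "\<exists>l. limitin T (\<lambda>t. \<Sum>i\<in>Q t. x i) l sequentially"
proof -
  interpret weighted_exhaustion Q w L by fact
  note Da = banach_disk_abs_convex[OF D]
  define H' where "H' = max H 0"
  have x': "x i \<in> dil (H' * w i) D" for i
  proof -
    obtain a where a: "0 \<le> a" "x i \<in> dil a D" "a \<le> H * w i" using x by blast
    have "H * w i \<le> H' * w i" unfolding H'_def using w_nonneg by (intro mult_right_mono) auto
    then show ?thesis using abs_convex_dil_mono[OF Da a(1), of "H' * w i"] a by auto
  qed
  have H': "0 \<le> H'" by (simp add: H'_def)
  have diff: "(\<Sum>i\<in>Q u. x i) - (\<Sum>i\<in>Q t. x i) \<in> dil (H' * (L - W t)) D" if tu: "t \<le> u" for t u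
  proof -
    have "(\<Sum>i\<in>Q u - Q t. x i) \<in> dil (\<Sum>i\<in>Q u - Q t. H' * w i) D"
      by (intro abs_convex_dil_sum[OF Da]) (auto simp: finite_Q w_nonneg H' x')
    also have "(\<Sum>i\<in>Q u - Q t. H' * w i) = H' * (W u - W t)"
      using sum_Q_diff[OF tu, of w] by (simp add: sum_distrib_left)
    also have "dil (H' * (W u - W t)) D \<subseteq> dil (H' * (L - W t)) D"
      using H' W_mono[OF tu] W_le[of u] by (intro abs_convex_dil_mono[OF Da] mult_left_mono) auto
    finally show ?thesis by (simp add: sum_Q_diff[OF tu])
  qed
  have span: "(\<Sum>i\<in>Q t. x i) \<in> span D" for t
  proof (rule span_sum)
    fix i
    obtain z where "z \<in> D" "x i = s (of_real (H' * w i)) z" using x'[of i] unfolding dil_def by blast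
    then show "x i \<in> span D" by (simp only:) (intro span_scale span_base)
  qed
  note p = minkowski_seminorm_on[OF Da]
  have "\<exists>k. \<forall>m\<ge>k. \<forall>n\<ge>k. minkowski s D ((\<Sum>i\<in>Q m. x i) - (\<Sum>i\<in>Q n. x i)) < e" if e: "0 < e" for e
  proof -
    obtain k where k: "\<And>t. k \<le> t \<Longrightarrow> H' * (L - W t) < e / 2"
      using W_tail[of "e / 2" H'] e H' by auto
    have le: "minkowski s D ((\<Sum>i\<in>Q m. x i) - (\<Sum>i\<in>Q n. x i)) \<le> e / 2" if "k \<le> n" "n \<le> m" for m n
    proof -
      have "dil (H' * (L - W n)) D \<subseteq> dil (e / 2) D"
        using k[OF that(1)] H' W_le[of n] by (intro abs_convex_dil_mono[OF Da]) auto
      then show ?thesis using diff[OF that(2)] e by (intro minkowski_le) auto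
    qed
    have "minkowski s D ((\<Sum>i\<in>Q m. x i) - (\<Sum>i\<in>Q n. x i)) < e" if "k \<le> n" "k \<le> m" for m n
      using le[of n m] le[of m n] that e seminorm_on_diff(3)[OF p subspace_span span span, of n m]
      by (cases "n \<le> m") auto
    then show ?thesis by blast
  qed
  then obtain l where l: "l \<in> span D" "(\<lambda>t. minkowski s D ((\<Sum>i\<in>Q t. x i) - l)) \<longlonglongrightarrow> 0"
    using D[unfolded banach_disk_def, THEN conjunct2, THEN conjunct2, THEN spec[of _ "\<lambda>t. \<Sum>i\<in>Q t. x i"]] span
    by blast
  have sub: "span D \<subseteq> S" by (rule banach_disk_span[OF D])
  have "limitin T (\<lambda>t. \<Sum>i\<in>Q t. x i) l sequentially"
  proof (rule limitin_seminormI)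
    show "l \<in> S" using l sub by blast
    show "\<forall>\<^sub>F t in sequentially. (\<Sum>i\<in>Q t. x i) \<in> S" using span sub by (auto intro: always_eventually)
    fix q assume q: "cont_seminorm s T q"
    obtain M where M: "0 < M" "\<And>x. x \<in> span D \<Longrightarrow> q x \<le> M * minkowski s D x"
      using banach_disk_dominates[OF D q] by metis
    have d: "(\<Sum>i\<in>Q t. x i) - l \<in> span D" for t using span l(1) by (rule span_diff)
    have lim: "(\<lambda>t. M * minkowski s D ((\<Sum>i\<in>Q t. x i) - l)) \<longlonglongrightarrow> M * 0" by (intro tendsto_mult_left l)
    show "(\<lambda>t. q ((\<Sum>i\<in>Q t. x i) - l)) \<longlonglongrightarrow> 0"
    proof (rule tendsto_sandwich[OF _ _ tendsto_const])
      show "\<forall>\<^sub>F t in sequentially. 0 \<le> q ((\<Sum>i\<in>Q t. x i) - l)"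
        using d sub seminorm_onD(1)[OF cont_seminorm_seminorm_on[OF q]] by (intro always_eventually) blast
      show "\<forall>\<^sub>F t in sequentially. q ((\<Sum>i\<in>Q t. x i) - l) \<le> M * minkowski s D ((\<Sum>i\<in>Q t. x i) - l)"
        using d M(2) by (intro always_eventually) blast
    qed (use lim in simp)
  qed
  then show ?thesis by blast
qed

end

context graded_frechet
begin

text \<open>The disk \<open>{\<Sum>\<^sub>i \<theta>\<^sub>i x\<^sub>i | \<bar>\<theta>\<^sub>i\<bar> \<le> 1}\<close> is the continuous image of a product of closed discs, and the
  supremum of \<open>\<bar>f\<bar>\<close> over it is \<open>\<Sum>\<^sub>i \<bar>f x\<^sub>i\<bar>\<close>.\<close>

lemma compact_disk_of_series:
  assumes "weighted_exhaustion Q w L" and x: "\<And>i. x i \<in> S" and H: "\<And>m. \<exists>H. \<forall>i. p m (x i) \<le> H * w i"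
  obtains K where "compactin T K" "abs_convex s K"
    "\<And>f c t. f \<in> dual s T \<Longrightarrow> (\<And>y. y \<in> K \<Longrightarrow> norm (f y) \<le> c) \<Longrightarrow> (\<Sum>i\<in>Q t. norm (f (x i))) \<le> c"
proof -
  interpret weighted_exhaustion Q w L by fact
  define B where "B = {\<theta>::'b \<Rightarrow> complex. \<forall>i. norm (\<theta> i) \<le> 1}"
  define P where "P = (\<lambda>\<theta> t. \<Sum>i\<in>Q t. s (\<theta> i) (x i))"
  have PS: "P \<theta> t \<in> S" for \<theta> t unfolding P_def using x by (intro S_sum S_scale)
  have "\<exists>H\<ge>0. \<forall>i. p m (x i) \<le> H * w i" for m
  proof -
    obtain H where "\<And>i. p m (x i) \<le> H * w i" using H by blast
    moreover have "H * w i \<le> max H 0 * w i" for i using w_nonneg by (intro mult_right_mono) auto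
    ultimately show ?thesis by (meson max.cobounded2 order_trans)
  qed
  then obtain h where h: "\<And>m. 0 \<le> h m" "\<And>m i. p m (x i) \<le> h m * w i" by metis
  have diff: "p m (P \<theta> u - P \<theta> t) \<le> h m * (L - W t)" if th: "\<theta> \<in> B" and tu: "t \<le> u" for m \<theta> t u
  proof -
    have "p m (P \<theta> u - P \<theta> t) \<le> (\<Sum>i\<in>Q u - Q t. p m (s (\<theta> i) (x i)))"
      unfolding P_def sum_Q_diff[OF tu] using x finite_Q by (intro p_sum S_scale) auto
    also have "\<dots> \<le> (\<Sum>i\<in>Q u - Q t. h m * w i)"
    proof (rule sum_mono)
      fix i
      have "norm (\<theta> i) * p m (x i) \<le> 1 * p m (x i)"
        using th p_nonneg[OF x] unfolding B_def by (intro mult_right_mono) auto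
      then show "p m (s (\<theta> i) (x i)) \<le> h m * w i" using h(2)[of m i] by (simp add: p_scale[OF x])
    qed
    also have "\<dots> = h m * (W u - W t)"
      using sum_Q_diff[OF tu, of w] by (simp add: sum_distrib_left)
    also have "\<dots> \<le> h m * (L - W t)" using h(1) W_le by (intro mult_left_mono) auto
    finally show ?thesis .
  qed
  have "\<exists>l. limitin T (P \<theta>) l sequentially" if th: "\<theta> \<in> B" for \<theta>
  proof -
    have "\<exists>k. \<forall>i\<ge>k. \<forall>j\<ge>k. p m (P \<theta> i - P \<theta> j) < e" if e: "0 < e" for m e
    proof -
      obtain k where k: "\<And>t. k \<le> t \<Longrightarrow> h m * (L - W t) < e" using W_tail[OF e h(1)] by blast
      have "p m (P \<theta> i - P \<theta> j) < e" if "k \<le> i" "k \<le> j" for i j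
        using diff[OF th, of i j m] diff[OF th, of j i m] k[of i] k[of j] that p_diff(3)[OF PS PS, of m \<theta> i \<theta> j]
        by (cases "i \<le> j") auto
      then show ?thesis by blast
    qed
    then show ?thesis using complete_seminorms[of "P \<theta>"] PS by metis
  qed
  then obtain \<Phi> where \<Phi>: "\<And>\<theta>. \<theta> \<in> B \<Longrightarrow> limitin T (P \<theta>) (\<Phi> \<theta>) sequentially" by metis
  have \<Phi>S: "\<Phi> \<theta> \<in> S" if "\<theta> \<in> B" for \<theta> using limitin_S[OF \<Phi>[OF that]] .
  \<comment> \<open>This bound does not depend on \<theta>: the series converges uniformly on B,
    which yields continuity of the sum map.\<close>
  have tail: "p m (\<Phi> \<theta> - P \<theta> t) \<le> h m * (L - W t)" if th: "\<theta> \<in> B" for m \<theta> t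
  proof (rule cont_seminorm_limit_le[where f = "\<lambda>u. P \<theta> u + - P \<theta> t" and N = t])
    have "limitin T (\<lambda>u. - P \<theta> t) (- P \<theta> t) sequentially" using PS S_neg by (simp add: limitin_const_iff)
    then show "limitin T (\<lambda>u. P \<theta> u + - P \<theta> t) (\<Phi> \<theta> - P \<theta> t) sequentially"
      using limitin_add[OF \<Phi>[OF th] PS, of "\<lambda>u. - P \<theta> t" "- P \<theta> t"] PS S_neg by simp
    show "p m (P \<theta> u + - P \<theta> t) \<le> h m * (L - W t)" if "t \<le> u" for u
      using diff[OF th that] by simp
    show "P \<theta> u + - P \<theta> t \<in> S" for u using PS by (simp add: S_diff)
  qed (rule p_cont)
  define X where "X = product_topology (\<lambda>i::'b. subtopology euclidean (cball (0::complex) 1)) UNIV"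
  have topX: "topspace X = B" unfolding X_def B_def by (auto simp: PiE_def Pi_def)
  have compX: "compact_space X"
    unfolding X_def compact_space_product_topology by (auto simp: compact_space_subtopology)
  have cont: "continuous_map X T \<Phi>"
    unfolding continuous_map_def
  proof (intro conjI allI impI)
    show "\<Phi> \<in> topspace X \<rightarrow> S" unfolding topX using \<Phi>S by blast
    fix V assume V: "openin T V"
    show "openin X {\<theta> \<in> topspace X. \<Phi> \<theta> \<in> V}"
    proof (subst openin_subopen, intro ballI)
      fix \<theta> assume th: "\<theta> \<in> {\<theta> \<in> topspace X. \<Phi> \<theta> \<in> V}"
      then have thB: "\<theta> \<in> B" unfolding topX by blast
      obtain q where q: "cont_seminorm s T q" "\<And>y. y \<in> S \<Longrightarrow> q (y - \<Phi> \<theta>) < 1 \<Longrightarrow> y \<in> V"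
        using openin_seminorm[OF V] th by blast
      obtain m C where C: "0 < C" "\<And>y. y \<in> S \<Longrightarrow> q y \<le> C * p m y" using p_dominates[OF q(1)] by blast
      \<comment> \<open>Two tails and one finite difference, each at most \<eta>, stay below 4
        \<eta>, and C * (4 * \<eta>) = 1.\<close>
      define \<eta> where "\<eta> = 1 / C / 4"
      have \<eta>: "0 < \<eta>" "C * (4 * \<eta>) = 1" using C(1) by (auto simp: \<eta>_def)
      obtain k where "h m * (L - W k) < \<eta>" using W_tail[OF \<eta>(1) h(1)] by blast
      then have tail': "p m (\<Phi> \<theta>' - P \<theta>' k) < \<eta>" if "\<theta>' \<in> B" for \<theta>'
        using tail[OF that, of m k] by linarith
      define \<delta> where "\<delta> = \<eta> / (1 + (\<Sum>i\<in>Q k. p m (x i)))"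
      have sum0: "0 \<le> (\<Sum>i\<in>Q k. p m (x i))" using p_nonneg[OF x] by (intro sum_nonneg) auto
      have \<delta>: "0 < \<delta>" using \<eta> sum0 by (simp add: \<delta>_def)
      \<comment> \<open>Only the finitely many coordinates in Q k are restricted, so this set is
        open in the product; the remaining ones are covered by the uniform tail.\<close>
      define A where "A = (\<Inter>i\<in>Q k. {\<theta>' \<in> topspace X. \<theta>' i \<in> cball 0 1 \<inter> ball (\<theta> i) \<delta>}) \<inter> topspace X"
      have "openin X A"
        unfolding A_def
      proof (rule openin_INT[OF finite_Q])
        fix i
        have "continuous_map X (subtopology euclidean (cball (0::complex) 1)) (\<lambda>\<theta>. \<theta> i)"
          unfolding X_def by (rule continuous_map_product_projection) simp
        then show "openin X {\<theta>' \<in> topspace X. \<theta>' i \<in> cball 0 1 \<inter> ball (\<theta> i) \<delta>}"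
          by (rule openin_continuous_map_preimage) (simp add: openin_open_Int)
      qed
      moreover have "\<theta> \<in> A" using thB \<delta> unfolding A_def topX B_def by auto
      moreover have "\<Phi> \<theta>' \<in> V" if th': "\<theta>' \<in> A" for \<theta>'
      proof (rule q(2))
        have th'B: "\<theta>' \<in> B" using th' unfolding A_def topX by blast
        then show "\<Phi> \<theta>' \<in> S" by (rule \<Phi>S)
        have "p m (P \<theta>' k - P \<theta> k) \<le> (\<Sum>i\<in>Q k. p m (s (\<theta>' i) (x i) - s (\<theta> i) (x i)))"
          unfolding P_def sum_subtractf[symmetric] using x finite_Q by (intro p_sum S_diff S_scale) auto
        also have "\<dots> \<le> (\<Sum>i\<in>Q k. \<delta> * p m (x i))"
        proof (rule sum_mono)
          fix i assume "i \<in> Q k"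
          then have "norm (\<theta>' i - \<theta> i) \<le> \<delta>"
            using th' unfolding A_def by (auto simp: dist_norm norm_minus_commute)
          then have "norm (\<theta>' i - \<theta> i) * p m (x i) \<le> \<delta> * p m (x i)"
            using p_nonneg[OF x] by (intro mult_right_mono)
          then show "p m (s (\<theta>' i) (x i) - s (\<theta> i) (x i)) \<le> \<delta> * p m (x i)"
            by (simp add: p_scale[OF x] flip: scale_left_diff_distrib)
        qed
        also have "\<dots> \<le> \<delta> * (1 + (\<Sum>i\<in>Q k. p m (x i)))" using \<delta> by (simp add: sum_distrib_left distrib_left)
        also have "\<dots> = \<eta>" using sum0 by (simp add: \<delta>_def)
        finally have mid: "p m (P \<theta>' k - P \<theta> k) \<le> \<eta>" .
        have "\<Phi> \<theta>' - \<Phi> \<theta> = (\<Phi> \<theta>' - P \<theta>' k) + ((P \<theta>' k - P \<theta> k) - (\<Phi> \<theta> - P \<theta> k))" by simp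
        then have "p m (\<Phi> \<theta>' - \<Phi> \<theta>) \<le> p m (\<Phi> \<theta>' - P \<theta>' k) + p m ((P \<theta>' k - P \<theta> k) - (\<Phi> \<theta> - P \<theta> k))"
          using \<Phi>S thB th'B PS by (metis p_triangle S_diff)
        moreover have "p m ((P \<theta>' k - P \<theta> k) - (\<Phi> \<theta> - P \<theta> k)) \<le> p m (P \<theta>' k - P \<theta> k) + p m (\<Phi> \<theta> - P \<theta> k)"
          using \<Phi>S thB PS by (intro p_diff(1) S_diff)
        ultimately have "p m (\<Phi> \<theta>' - \<Phi> \<theta>) < 4 * \<eta>"
          using mid tail'[OF thB] tail'[OF th'B] \<eta>(1) by linarith
        then have "C * p m (\<Phi> \<theta>' - \<Phi> \<theta>) < C * (4 * \<eta>)" using C(1) by simp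
        then show "q (\<Phi> \<theta>' - \<Phi> \<theta>) < 1"
          using C(2)[OF S_diff[OF \<Phi>S[OF th'B] \<Phi>S[OF thB]]] \<eta>(2) by linarith
      qed
      ultimately show "\<exists>A. openin X A \<and> \<theta> \<in> A \<and> A \<subseteq> {\<theta> \<in> topspace X. \<Phi> \<theta> \<in> V}"
        unfolding A_def by (intro exI[of _ A]) (auto simp: A_def)
    qed
  qed
  define K where "K = \<Phi> ` B"
  have "compactin T K"
    using image_compactin[OF compX[unfolded compact_space_def] cont] unfolding K_def topX .
  moreover have "abs_convex s K"
    unfolding abs_convex_def
  proof (intro conjI ballI allI impI)
    show "K \<noteq> {}" unfolding K_def B_def by (auto intro: exI[of _ "\<lambda>i. 0"])
    fix y z and a b :: complex
    assume yz: "y \<in> K" "z \<in> K" and ab: "norm a + norm b \<le> 1"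
    obtain \<theta> \<eta> where th: "\<theta> \<in> B" "y = \<Phi> \<theta>" "\<eta> \<in> B" "z = \<Phi> \<eta>" using yz unfolding K_def by blast
    define \<zeta> where "\<zeta> = (\<lambda>i. a * \<theta> i + b * \<eta> i)"
    have \<zeta>: "\<zeta> \<in> B"
      unfolding B_def
    proof (intro CollectI allI)
      fix i
      have "norm (\<zeta> i) \<le> norm a * norm (\<theta> i) + norm b * norm (\<eta> i)"
        unfolding \<zeta>_def by (metis norm_mult norm_triangle_ineq)
      also have "\<dots> \<le> norm a * 1 + norm b * 1"
        using th(1,3) unfolding B_def by (intro add_mono mult_left_mono) auto
      finally show "norm (\<zeta> i) \<le> 1" using ab by simp
    qed
    have "P \<zeta> = (\<lambda>t. s a (P \<theta> t) + s b (P \<eta> t))"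
      unfolding P_def \<zeta>_def by (simp add: scale_left_distrib sum.distrib scale_sum_right)
    then have "limitin T (P \<zeta>) (s a y + s b z) sequentially"
      using limitin_add[OF limitin_scale[OF \<Phi>[OF th(1)] PS] S_scale[OF PS] limitin_scale[OF \<Phi>[OF th(3)] PS] S_scale[OF PS]]
      by (simp add: th)
    then have "s a y + s b z = \<Phi> \<zeta>" using limitin_unique \<Phi>[OF \<zeta>] by blast
    then show "s a y + s b z \<in> K" unfolding K_def using \<zeta> by blast
  qed
  moreover have "(\<Sum>i\<in>Q t. norm (f (x i))) \<le> c" if f: "f \<in> dual s T" and c: "\<And>y. y \<in> K \<Longrightarrow> norm (f y) \<le> c" for f c t
  proof -
    have flin: "linear_on s S f" using f dual_iff by blast
    \<comment> \<open>Conjugate signs on Q t and 0 elsewhere: f maps the corresponding point of K to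
      the sum of the norms of f (x i) over Q t.\<close>
    define \<theta> where "\<theta> = (\<lambda>i. if i \<in> Q t then cnj (sgn (f (x i))) else 0)"
    have th: "\<theta> \<in> B" unfolding B_def \<theta>_def by (auto simp: norm_sgn)
    have "P \<theta> u = P \<theta> t" if "t \<le> u" for u
      unfolding P_def using Q_mono[OF that] by (intro sum.mono_neutral_right finite_Q) (auto simp: \<theta>_def)
    then have "\<forall>\<^sub>F u in sequentially. P \<theta> t = P \<theta> u" unfolding eventually_sequentially by metis
    moreover have "limitin T (\<lambda>u::nat. P \<theta> t) (P \<theta> t) sequentially" using PS by (simp add: limitin_const_iff)
    ultimately have "limitin T (P \<theta>) (P \<theta> t) sequentially"
      by (rule limitin_transform_eventually)
    then have "\<Phi> \<theta> = P \<theta> t" by (rule limitin_unique[OF \<Phi>[OF th]])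
    then have "P \<theta> t \<in> K" using th unfolding K_def by (metis imageI)
    then have "norm (f (P \<theta> t)) \<le> c" by (rule c)
    moreover have "f (P \<theta> t) = of_real (\<Sum>i\<in>Q t. norm (f (x i)))"
    proof -
      have "f (P \<theta> t) = (\<Sum>i\<in>Q t. f (s (\<theta> i) (x i)))"
        unfolding P_def using x by (intro linear_on_sum[OF flin subspace_S finite_Q] S_scale)
      also have "\<dots> = (\<Sum>i\<in>Q t. of_real (norm (f (x i))))"
      proof (rule sum.cong[OF refl])
        fix i assume "i \<in> Q t"
        have "cnj (sgn z) * z = of_real (norm z)" for z :: complex
          by (cases "z = 0") (simp_all add: sgn_eq mult.commute complex_norm_square[symmetric] power2_eq_square)
        then show "f (s (\<theta> i) (x i)) = of_real (norm (f (x i)))"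
          using \<open>i \<in> Q t\<close> by (simp add: linear_onD(2)[OF flin x] \<theta>_def)
      qed
      finally show ?thesis by simp
    qed
    ultimately show ?thesis
      by (simp only: norm_of_real)
  qed
  ultimately show ?thesis using that by blast
qed

end

locale frechet_pair = lcs_pair sG TG sE TE + graded_frechet sG TG p
  for sG :: "complex \<Rightarrow> 'g::ab_group_add \<Rightarrow> 'g" and TG
    and sE :: "complex \<Rightarrow> 'e::ab_group_add \<Rightarrow> 'e" and TE and p
begin

text \<open>Convergence at f needs only the disk for a seminorm dominating f. For continuity, a
  seminorm q on E is moved into G by x i = q (d i) g i: q of the sum at k is at most the sum of the
  norms of k (x i), which a compact disk of G bounds.\<close>

lemma eps_product_series:
  assumes WE: "weighted_exhaustion Q w L" and g: "\<And>i. g i \<in> G.S"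
    and d: "\<And>m. \<exists>D H. banach_disk sE TE D \<and> (\<forall>i. \<exists>\<beta>\<ge>0. d i \<in> E.dil \<beta> D \<and> \<beta> * p m (g i) \<le> H * w i)"
  obtains R where "R \<in> eps_product sG TG sE TE"
    "\<And>f. f \<in> dual sG TG \<Longrightarrow> limitin TE (\<lambda>t. \<Sum>i\<in>Q t. sE (f (g i)) (d i)) (R f) sequentially"
proof -
  interpret weighted_exhaustion Q w L by fact
  have dS: "d i \<in> E.S" for i
  proof -
    obtain D \<beta> where "banach_disk sE TE D" "d i \<in> E.dil \<beta> D" using d[of 0] by blast
    moreover from this have "D \<subseteq> E.S" using E.tvs_bounded_subset_S[OF E.banach_disk_bounded] by blast
    ultimately show ?thesis by (auto simp: E.dil_def intro!: E.S_scale)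
  qed
  have SS: "(\<Sum>i\<in>Q t. sE (f (g i)) (d i)) \<in> E.S" for f t using dS by (intro E.S_sum E.S_scale)
  have "\<exists>l. limitin TE (\<lambda>t. \<Sum>i\<in>Q t. sE (f (g i)) (d i)) l sequentially" if f: "f \<in> dual sG TG" for f
  proof -
    obtain m C where C: "0 < C" "\<And>x. x \<in> G.S \<Longrightarrow> norm (f x) \<le> C * p m x"
      by (rule p_dominates[of "\<lambda>x. norm (f x)"]) (use f G.dual_iff in auto)
    obtain D H where D: "banach_disk sE TE D" and H: "\<And>i. \<exists>\<beta>\<ge>0. d i \<in> E.dil \<beta> D \<and> \<beta> * p m (g i) \<le> H * w i"
      using d[of m] by blast
    have "\<exists>a\<ge>0. sE (f (g i)) (d i) \<in> E.dil a D \<and> a \<le> (C * H) * w i" for i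
    proof -
      obtain \<beta> where \<beta>: "0 \<le> \<beta>" "d i \<in> E.dil \<beta> D" "\<beta> * p m (g i) \<le> H * w i" using H by blast
      have "sE (f (g i)) (d i) \<in> E.dil (norm (f (g i)) * \<beta>) D"
        by (rule E.abs_convex_dil_scale[OF E.banach_disk_abs_convex[OF D] \<beta>(1,2)])
      moreover have "norm (f (g i)) * \<beta> \<le> (C * p m (g i)) * \<beta>" using C(2)[OF g] \<beta>(1) by (intro mult_right_mono)
      moreover have "C * (\<beta> * p m (g i)) \<le> C * (H * w i)" using C(1) \<beta>(3) by (intro mult_left_mono) auto
      ultimately show ?thesis using \<beta>(1) by (intro exI[of _ "norm (f (g i)) * \<beta>"]) (auto simp: mult_ac)
    qed
    then show ?thesis by (rule E.banach_disk_series[OF WE D])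
  qed
  then have "\<exists>R. \<forall>f\<in>dual sG TG. limitin TE (\<lambda>t. \<Sum>i\<in>Q t. sE (f (g i)) (d i)) (R f) sequentially" by metis
  then obtain R0 where R0: "\<And>f. f \<in> dual sG TG \<Longrightarrow>
      limitin TE (\<lambda>t. \<Sum>i\<in>Q t. sE (f (g i)) (d i)) (R0 f) sequentially" by blast
  \<comment> \<open>Maps in \<open>cont_linear\<close> vanish outside the carrier, here the
    dual.\<close>
  define R where "R = (\<lambda>f. if f \<in> dual sG TG then R0 f else 0)"
  have lim: "limitin TE (\<lambda>t. \<Sum>i\<in>Q t. sE (f (g i)) (d i)) (R f) sequentially" if "f \<in> dual sG TG" for f
    using R0 that by (simp add: R_def)
  have RS: "R f \<in> E.S" if "f \<in> dual sG TG" for f using E.limitin_S[OF lim[OF that]] .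
  have add: "R (\<lambda>x. f x + h x) = R f + R h" if "f \<in> dual sG TG" "h \<in> dual sG TG" for f h
    using E.limitin_add[OF lim[OF that(1)] SS lim[OF that(2)] SS]
    by (intro E.limitin_unique[OF lim[OF G.dual_add[OF that]]]) (simp add: E.scale_left_distrib sum.distrib)
  have scale: "R (\<lambda>x. c * f x) = sE c (R f)" if "f \<in> dual sG TG" for f c
    using E.limitin_scale[OF lim[OF that] SS, of c]
    by (intro E.limitin_unique[OF lim[OF G.dual_scale[OF that]]]) (simp add: E.scale_sum_right)
  have "continuous_map (dual_c sG TG) TE R"
    unfolding continuous_map_def G.topspace_dual_c
  proof (intro conjI allI impI)
    show "R \<in> dual sG TG \<rightarrow> E.S" using RS by blast
    fix V assume V: "openin TE V"
    show "openin (dual_c sG TG) {f \<in> dual sG TG. R f \<in> V}"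
    proof (subst openin_subopen, intro ballI)
      fix f assume f: "f \<in> {f \<in> dual sG TG. R f \<in> V}"
      then have fd: "f \<in> dual sG TG" by blast
      obtain q where q: "cont_seminorm sE TE q" "\<And>y. y \<in> E.S \<Longrightarrow> q (y - R f) < 1 \<Longrightarrow> y \<in> V"
        using E.openin_seminorm[OF V] f by blast
      note q' = E.cont_seminorm_seminorm_on[OF q(1)]
      define x where "x = (\<lambda>i. sG (of_real (q (d i))) (g i))"
      have qd: "0 \<le> q (d i)" for i using E.seminorm_onD(1)[OF q' dS] .
      have xS: "x i \<in> G.S" for i unfolding x_def using g by (rule G.S_scale)
      have "\<exists>H. \<forall>i. p m (x i) \<le> H * w i" for m
      proof -
        obtain D H where D: "banach_disk sE TE D" and H: "\<And>i. \<exists>\<beta>\<ge>0. d i \<in> E.dil \<beta> D \<and> \<beta> * p m (g i) \<le> H * w i"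
          using d[of m] by blast
        obtain M where M: "0 < M" "\<And>t x. 0 \<le> t \<Longrightarrow> x \<in> E.dil t D \<Longrightarrow> q x \<le> t * M"
          using E.banach_disk_dominates[OF D q(1)] by metis
        have "p m (x i) \<le> (M * H) * w i" for i
        proof -
          obtain \<beta> where \<beta>: "0 \<le> \<beta>" "d i \<in> E.dil \<beta> D" "\<beta> * p m (g i) \<le> H * w i" using H by blast
          have "p m (x i) = q (d i) * p m (g i)" using qd by (simp add: x_def p_scale[OF g])
          also have "\<dots> \<le> (\<beta> * M) * p m (g i)" using M(2)[OF \<beta>(1,2)] p_nonneg[OF g] by (intro mult_right_mono)
          also have "\<dots> = M * (\<beta> * p m (g i))" by simp
          also have "\<dots> \<le> M * (H * w i)" using M(1) \<beta>(3) by (intro mult_left_mono) auto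
          finally show ?thesis by simp
        qed
        then show ?thesis by blast
      qed
      then obtain K where K: "compactin TG K" "abs_convex sG K"
        and Ksum: "\<And>f c t. f \<in> dual sG TG \<Longrightarrow> (\<And>y. y \<in> K \<Longrightarrow> norm (f y) \<le> c) \<Longrightarrow> (\<Sum>i\<in>Q t. norm (f (x i))) \<le> c"
        using compact_disk_of_series[of Q w L x, OF WE xS] by metis
      \<comment> \<open>The bound 1 / 2 leaves room: passing to the limit preserves only a
        non-strict inequality, while < 1 is needed.\<close>
      define A where "A = {h \<in> dual sG TG. \<forall>y\<in>K. norm (h y - f y) < 1 / 2}"
      have "openin (dual_c sG TG) A"
        unfolding A_def by (rule G.dual_c_basic_openin[OF fd K]) simp
      moreover have "f \<in> A" using fd by (simp add: A_def)
      moreover have "R h \<in> V" if h: "h \<in> A" for h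
      proof (rule q(2))
        have hd: "h \<in> dual sG TG" using h unfolding A_def by blast
        then show "R h \<in> E.S" by (rule RS)
        define k where "k = (\<lambda>y. h y + (-1) * f y)"
        have kd: "k \<in> dual sG TG" unfolding k_def by (intro G.dual_add hd G.dual_scale fd)
        have "norm (k y) \<le> 1 / 2" if "y \<in> K" for y using h that unfolding A_def k_def by (auto intro: less_imp_le)
        from Ksum[OF kd this] have ks: "(\<Sum>i\<in>Q t. norm (k (x i))) \<le> 1 / 2" for t .
        have klin: "linear_on sG G.S k" using kd G.dual_iff by blast
        have "q (\<Sum>i\<in>Q t. sE (k (g i)) (d i)) \<le> 1 / 2" for t
        proof -
          have "q (\<Sum>i\<in>Q t. sE (k (g i)) (d i)) \<le> (\<Sum>i\<in>Q t. q (sE (k (g i)) (d i)))"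
            using dS by (intro E.seminorm_on_sum[OF q' E.subspace_S finite_Q] E.S_scale)
          also have "\<dots> = (\<Sum>i\<in>Q t. norm (k (x i)))"
            using qd by (intro sum.cong refl)
              (simp add: E.seminorm_onD(3)[OF q' dS] x_def G.linear_onD(2)[OF klin g] norm_mult mult.commute)
          finally show ?thesis using ks[of t] by linarith
        qed
        then have "q (R k) \<le> 1 / 2"
          by (rule E.cont_seminorm_limit_le[OF lim[OF kd] SS q(1)])
        moreover have "R k = R h - R f"
          unfolding k_def using add[OF hd G.dual_scale[OF fd, of "-1"]] scale[OF fd, of "-1"] by simp
        ultimately show "q (R h - R f) < 1" by simp
      qed
      ultimately show "\<exists>A. openin (dual_c sG TG) A \<and> f \<in> A \<and> A \<subseteq> {f \<in> dual sG TG. R f \<in> V}"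
        unfolding A_def by (intro exI[of _ A]) (auto simp: A_def)
    qed
  qed
  moreover have "f + h = (\<lambda>x. f x + h x)" for f h :: "'g \<Rightarrow> complex" by (simp add: plus_fun_def)
  ultimately have "R \<in> eps_product sG TG sE TE"
    unfolding eps_product_def cont_linear_def G.topspace_dual_c
    using add scale by (simp add: fun_scale_def R_def)
  then show ?thesis using that lim by blast
qed

end

section \<open>Sufficiency of condition (A)\<close>

definition dyadic_weight :: "nat \<times> nat \<Rightarrow> real" where
  "dyadic_weight = (\<lambda>(j, l). (1/2) ^ j * (1/2) ^ l)"

lemma weighted_exhaustion_dyadic:
  "weighted_exhaustion (\<lambda>t. {..<t} \<times> {..<t}) dyadic_weight 4"
proof
  show "incseq (\<lambda>t. {..<t::nat} \<times> {..<t::nat})" by (auto simp: incseq_def)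
  show "0 \<le> dyadic_weight i" for i by (simp add: dyadic_weight_def split: prod.split)
  have "(\<lambda>t. \<Sum>j<t. (1/2::real) ^ j) \<longlonglongrightarrow> 2"
    using geometric_sums[of "1/2::real"] by (simp add: sums_def)
  then have "(\<lambda>t. (\<Sum>j<t. (1/2::real) ^ j) * (\<Sum>l<t. (1/2) ^ l)) \<longlonglongrightarrow> 2 * 2"
    by (intro tendsto_mult)
  then show "(\<lambda>t. \<Sum>i\<in>{..<t} \<times> {..<t}. dyadic_weight i) \<longlonglongrightarrow> 4"
    by (simp add: dyadic_weight_def sum_product sum.cartesian_product)
qed auto

locale eidelheit_pair = frechet_pair sG TG sE TE p + eidelheit_sequence sG TG p \<xi>
  for sG :: "complex \<Rightarrow> 'g::ab_group_add \<Rightarrow> 'g" and TG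
    and sE :: "complex \<Rightarrow> 'e::ab_group_add \<Rightarrow> 'e" and TE and p \<xi>
begin

text \<open>The level zero of the grading is trivial, so that every \<open>j\<close> has a largest level
  \<open>n \<le> j\<close> at which small interpolating sequences exist.\<close>

lemma interpolating_family:
  assumes Om: "cond_Omega sG (subtopology TG F)" and p0: "\<And>x. p 0 x = 0" and \<epsilon>: "\<And>j. 0 < \<epsilon> j"
  obtains g h where "\<And>j l. g j l \<in> G.S" "\<And>i j l. \<xi> i (g j l) = (if i = j then 1 else 0)"
    "\<And>j l. p (h j) (g j l) \<le> \<epsilon> j / 4 ^ l" "\<And>j k. tame (p k) (g j)" "\<And>m. finite {j. h j < m}"
proof -
  define P where "P = (\<lambda>n j. \<exists>g. (\<forall>l. g l \<in> G.S) \<and> (\<forall>i l. \<xi> i (g l) = (if i = j then 1 else 0)) \<and>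
      (\<forall>l. p n (g l) \<le> \<epsilon> j / 4 ^ l) \<and> (\<forall>k. tame (p k) g))"
  have P0: "P 0 j" for j
  proof -
    obtain \<gamma> where "\<gamma> \<in> G.S" "\<forall>i. \<xi> i \<gamma> = (if i = j then 1 else 0)"
      using \<xi>_surj[of "\<lambda>i. if i = j then 1 else 0"] by blast
    then show ?thesis
      unfolding P_def using \<epsilon>[of j] p0 tame_const by (intro exI[of _ "\<lambda>l. \<gamma>"]) (auto intro: less_imp_le)
  qed
  have PM: "\<exists>M. \<forall>j\<ge>M. P n j" for n
  proof (rule interpolating_sequences[OF Om, of n])
    fix M assume M: "\<And>j e. M \<le> j \<Longrightarrow> 0 < e \<Longrightarrow> \<exists>g. (\<forall>l. g l \<in> G.S) \<and>
      (\<forall>i l. \<xi> i (g l) = (if i = j then 1 else 0)) \<and> (\<forall>l. p n (g l) \<le> e / 4 ^ l) \<and> (\<forall>k. tame (p k) g)"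
    have "P n j" if "M \<le> j" for j unfolding P_def by (rule M[OF that \<epsilon>])
    then show ?thesis by blast
  qed
  \<comment> \<open>The restriction n \<le> j makes the set of candidates finite.\<close>
  define h where "h = (\<lambda>j. Max {n. n \<le> j \<and> P n j})"
  have fin: "finite {n. n \<le> j \<and> P n j}" for j by simp
  have "P (h j) j" for j
    using Max_in[OF fin, of j] P0[of j] unfolding h_def by blast
  then have "\<forall>j. \<exists>g. (\<forall>l. g l \<in> G.S) \<and> (\<forall>i l. \<xi> i (g l) = (if i = j then 1 else 0)) \<and>
      (\<forall>l. p (h j) (g l) \<le> \<epsilon> j / 4 ^ l) \<and> (\<forall>k. tame (p k) g)" unfolding P_def by blast
  from choice[OF this] obtain g where g: "\<forall>j. (\<forall>l. g j l \<in> G.S) \<and>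
      (\<forall>i l. \<xi> i (g j l) = (if i = j then 1 else 0)) \<and>
      (\<forall>l. p (h j) (g j l) \<le> \<epsilon> j / 4 ^ l) \<and> (\<forall>k. tame (p k) (g j))" ..
  have "finite {j. h j < m}" for m
  proof -
    obtain M where M: "\<forall>j\<ge>M. P m j" using PM by blast
    have "m \<le> h j" if "max M m \<le> j" for j
      unfolding h_def using that M by (intro Max_ge[OF fin]) auto
    then have "{j. h j < m} \<subseteq> {..<max M m}" by (auto simp: not_le[symmetric])
    then show ?thesis using finite_subset by blast
  qed
  then show ?thesis using that[of g h] g by simp
qed

lemma cond_A_imp_solvable:
  assumes Om: "cond_Omega sG (subtopology TG F)" and p0: "\<And>x. p 0 x = 0"
    and A: "cond_A sE TE" and lc: "locally_complete sE TE" and e: "\<And>i. e i \<in> E.S"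
  shows "\<exists>R\<in>eps_product sG TG sE TE. \<forall>i. R (\<xi> i) = e i"
proof -
  obtain D0 where D0: "banach_disk sE TE D0" and strong: "\<And>B. tvs_bounded sE TE B \<Longrightarrow>
      \<exists>D. banach_disk sE TE D \<and> B \<subseteq> D \<and> D0 \<subseteq> D \<and> (\<forall>r>0. B \<subseteq> E.dil_sum r D (1 / r) D0)"
    using E.cond_A_strong[OF A lc] by blast
  note D0a = E.banach_disk_abs_convex[OF D0]
  have "\<forall>i. \<exists>b. b 0 = 0 \<and> (\<forall>l. b l \<in> E.dil (2 * 2 ^ l) D0) \<and>
      (\<forall>\<mu>. \<exists>K. \<exists>C>0. banach_disk sE TE K \<and> (\<forall>l. e i - b l \<in> E.dil (C / 2 ^ (\<mu> * l)) K))"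
  proof
    fix i
    show "\<exists>b. b 0 = 0 \<and> (\<forall>l. b l \<in> E.dil (2 * 2 ^ l) D0) \<and>
        (\<forall>\<mu>. \<exists>K. \<exists>C>0. banach_disk sE TE K \<and> (\<forall>l. e i - b l \<in> E.dil (C / 2 ^ (\<mu> * l)) K))"
      by (rule E.cond_A_resolution[OF D0 strong e[of i]]) blast+
  qed
  from choice[OF this] obtain b where b': "\<forall>i. b i 0 = 0 \<and> (\<forall>l. b i l \<in> E.dil (2 * 2 ^ l) D0) \<and>
      (\<forall>\<mu>. \<exists>K. \<exists>C>0. banach_disk sE TE K \<and> (\<forall>l. e i - b i l \<in> E.dil (C / 2 ^ (\<mu> * l)) K))" ..
  have b0: "b i 0 = 0" and b1: "b i l \<in> E.dil (2 * 2 ^ l) D0"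
    and b2: "\<exists>K. \<exists>C>0. banach_disk sE TE K \<and> (\<forall>l. e i - b i l \<in> E.dil (C / 2 ^ (\<mu> * l)) K)" for i l \<mu>
    using b'[THEN spec[of _ i]] by blast+
  define d where "d = (\<lambda>(j, l). b j (Suc l) - b j l)"
  have d1: "d (j, l) \<in> E.dil (6 * 2 ^ l) D0" for j l
    using E.abs_convex_dil_diff[OF D0a _ _ b1[of j "Suc l"] b1[of j l]] by (simp add: d_def)
  obtain g h where g: "\<And>j l. g j l \<in> G.S" "\<And>i j l. \<xi> i (g j l) = (if i = j then 1 else 0)"
    "\<And>j l. p (h j) (g j l) \<le> (1/2) ^ j / 4 ^ l" "\<And>j k. tame (p k) (g j)" "\<And>m. finite {j. h j < m}"
    \<comment> \<open>The choice of \<epsilon> provides summability in j.\<close>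
    using interpolating_family[OF Om p0, of "\<lambda>j. (1/2) ^ j"] by auto
  define g' where "g' = (\<lambda>(j, l). g j l)"
  have bounds: "\<exists>D H. banach_disk sE TE D \<and>
      (\<forall>i. \<exists>\<beta>\<ge>0. d i \<in> E.dil \<beta> D \<and> \<beta> * p m (g' i) \<le> H * dyadic_weight i)" for m
  proof -
    have "\<exists>K H. banach_disk sE TE K \<and> 0 \<le> H \<and> (\<forall>l. \<exists>\<beta>\<ge>0. d (j, l) \<in> E.dil \<beta> K \<and> \<beta> * p m (g j l) \<le> H * (1/2) ^ l)" for j
    proof -
      obtain C c where C: "1 \<le> C" "\<And>l. p m (g j l) \<le> C * 2 ^ (c * l)" using tameE[OF g(4)] by blast
      \<comment> \<open>The growth rate c of g j is known only now. Decay at rate Suc c beats it and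
        leaves the factor 1 / 2 ^ l.\<close>
      obtain K B where K: "banach_disk sE TE K" and B: "0 < B" "\<And>l. e j - b j l \<in> E.dil (B / 2 ^ (Suc c * l)) K"
        using b2[of j "Suc c"] by blast
      note Ka = E.banach_disk_abs_convex[OF K]
      have "\<exists>\<beta>\<ge>0. d (j, l) \<in> E.dil \<beta> K \<and> \<beta> * p m (g j l) \<le> (2 * B * C) * (1/2) ^ l" for l
      proof -
        define \<beta> where "\<beta> = B / 2 ^ (Suc c * l)"
        have \<beta>: "0 < \<beta>" using B by (simp add: \<beta>_def)
        have le: "B / 2 ^ (Suc c * Suc l) \<le> \<beta>"
          unfolding \<beta>_def using B(1) by (intro divide_left_mono power_increasing) auto
        have "0 \<le> B / 2 ^ (Suc c * Suc l)" using B(1) by simp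
        from subsetD[OF E.abs_convex_dil_mono[OF Ka this le] B(2)]
        have "e j - b j (Suc l) \<in> E.dil \<beta> K" .
        then have "(e j - b j l) - (e j - b j (Suc l)) \<in> E.dil (\<beta> + \<beta>) K"
          using \<beta> B(2)[of l] by (intro E.abs_convex_dil_diff[OF Ka]) (auto simp: \<beta>_def)
        then have "d (j, l) \<in> E.dil (2 * \<beta>) K" by (simp add: d_def)
        moreover have "2 * \<beta> * p m (g j l) \<le> 2 * \<beta> * (C * 2 ^ (c * l))"
          using \<beta> C(2) by (intro mult_left_mono) auto
        moreover have "2 * \<beta> * (C * 2 ^ (c * l)) = (2 * B * C) * (1/2) ^ l"
          by (simp add: \<beta>_def power_add power_divide)
        ultimately show ?thesis using \<beta> by (intro exI[of _ "2 * \<beta>"]) auto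
      qed
      then show ?thesis using K B(1) C(1) by (intro exI[of _ K] exI[of _ "2 * B * C"]) auto
    qed
    then have "\<forall>j. \<exists>KH. banach_disk sE TE (fst KH) \<and> 0 \<le> snd KH \<and>
        (\<forall>l. \<exists>\<beta>\<ge>0. d (j, l) \<in> E.dil \<beta> (fst KH) \<and> \<beta> * p m (g j l) \<le> snd KH * (1/2) ^ l)" by simp
    from choice[OF this] obtain KH where KH: "\<forall>j. banach_disk sE TE (fst (KH j)) \<and> 0 \<le> snd (KH j) \<and>
        (\<forall>l. \<exists>\<beta>\<ge>0. d (j, l) \<in> E.dil \<beta> (fst (KH j)) \<and> \<beta> * p m (g j l) \<le> snd (KH j) * (1/2) ^ l)" ..
    \<comment> \<open>For j in J0 the smallness of g j l is measured below level m, so D0 is not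
      enough and the fast decay in a disk depending on j is used. Finiteness permits one disk D for
      all of them.\<close>
    define J0 where "J0 = {j. h j < m}"
    have J0: "finite J0" unfolding J0_def by (rule g(5))
    have "tvs_bounded sE TE (D0 \<union> (\<Union>j\<in>J0. fst (KH j)))"
      using J0
    proof (induction J0 rule: finite_induct)
      case empty
      then show ?case using E.banach_disk_bounded[OF D0] by simp
    next
      case (insert j J)
      then show ?case
        using E.tvs_bounded_Un[OF E.banach_disk_bounded[of "fst (KH j)"] insert.IH] KH by (simp add: Un_left_commute)
    qed
    then obtain D where D: "banach_disk sE TE D" "D0 \<union> (\<Union>j\<in>J0. fst (KH j)) \<subseteq> D"
      using lc unfolding locally_complete_def by blast
    \<comment> \<open>The factors 2 ^ j cancel the weight in j for the exceptional indices; the 6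
      serves the other ones.\<close>
    define H where "H = 6 + (\<Sum>j\<in>J0. snd (KH j) * 2 ^ j)"
    have H0: "6 \<le> H" unfolding H_def using KH by (auto intro!: sum_nonneg)
    have "\<exists>\<beta>\<ge>0. d (j, l) \<in> E.dil \<beta> D \<and> \<beta> * p m (g j l) \<le> H * ((1/2) ^ j * (1/2) ^ l)" for j l
    proof (cases "j \<in> J0")
      case True
      obtain \<beta> where \<beta>: "0 \<le> \<beta>" "d (j, l) \<in> E.dil \<beta> (fst (KH j))" "\<beta> * p m (g j l) \<le> snd (KH j) * (1/2) ^ l"
        using KH[THEN spec[of _ j]] by blast
      have "snd (KH j) * 2 ^ j \<le> (\<Sum>j\<in>J0. snd (KH j) * 2 ^ j)"
        using True KH by (intro member_le_sum J0) auto
      then have "snd (KH j) * 2 ^ j \<le> H" unfolding H_def by linarith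
      then have "snd (KH j) \<le> H * (1/2) ^ j" by (simp add: power_divide field_simps)
      then have "snd (KH j) * (1/2) ^ l \<le> (H * (1/2) ^ j) * (1/2) ^ l" by (intro mult_right_mono) auto
      then have "\<beta> * p m (g j l) \<le> H * ((1/2) ^ j * (1/2) ^ l)" using \<beta>(3) by (simp only: mult.assoc)
      moreover have "d (j, l) \<in> E.dil \<beta> D" using \<beta>(2) E.dil_mono[of "fst (KH j)" D] D(2) True by blast
      ultimately show ?thesis using \<beta>(1) by blast
    next
      case False
      then have "p m (g j l) \<le> p (h j) (g j l)" unfolding J0_def using g(1) by (intro p_mono) auto
      also have "\<dots> \<le> (1/2) ^ j / 4 ^ l" by (rule g(3))
      \<comment> \<open>Growth 2 ^ l of d against decay 1 / 4 ^ l of g leaves 1 / 2 ^ l: this is why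
        the interpolating elements were made small at rate 4.\<close>
      finally have "6 * 2 ^ l * p m (g j l) \<le> 6 * 2 ^ l * ((1/2) ^ j / 4 ^ l)" by (intro mult_left_mono) auto
      also have "\<dots> = 6 * ((1/2) ^ j * (1/2) ^ l)"
      proof -
        have "(4::real) ^ l = 2 ^ l * 2 ^ l" by (simp flip: power_mult_distrib)
        then show ?thesis by (simp add: power_divide)
      qed
      also have "\<dots> \<le> H * ((1/2) ^ j * (1/2) ^ l)" using H0 by (intro mult_right_mono) auto
      finally have "6 * 2 ^ l * p m (g j l) \<le> H * ((1/2) ^ j * (1/2) ^ l)" .
      moreover have "d (j, l) \<in> E.dil (6 * 2 ^ l) D" using d1[of j l] E.dil_mono[of D0 D] D(2) by blast
      ultimately show ?thesis by (intro exI[of _ "6 * 2 ^ l"]) auto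
    qed
    then show ?thesis using D(1) unfolding dyadic_weight_def g'_def by (intro exI[of _ D] exI[of _ H]) auto
  qed
  have g'S: "g' i \<in> G.S" for i unfolding g'_def using g(1) by (cases i) auto
  obtain R where R: "R \<in> eps_product sG TG sE TE"
    and lim: "\<And>f. f \<in> dual sG TG \<Longrightarrow>
      limitin TE (\<lambda>t. \<Sum>i\<in>{..<t} \<times> {..<t}. sE (f (g' i)) (d i)) (R f) sequentially"
    using eps_product_series[OF weighted_exhaustion_dyadic g'S bounds] by blast
  have "R (\<xi> i) = e i" for i
  proof -
    \<comment> \<open>Only the row j = i survives, and it belongs to the square once t > i.\<close>
    have eq: "(\<Sum>k\<in>{..<t} \<times> {..<t}. sE (\<xi> i (g' k)) (d k)) = b i t" if "i < t" for t
    proof -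
      have "(\<Sum>k\<in>{..<t} \<times> {..<t}. sE (\<xi> i (g' k)) (d k)) = (\<Sum>j<t. \<Sum>l<t. sE (\<xi> i (g j l)) (d (j, l)))"
        by (simp add: sum.cartesian_product g'_def case_prod_unfold)
      also have "\<dots> = (\<Sum>j<t. if i = j then (\<Sum>l<t. d (j, l)) else 0)"
        by (intro sum.cong refl) (simp add: g(2))
      also have "\<dots> = (\<Sum>l<t. b i (Suc l) - b i l)" using that by (simp add: d_def)
      also have "\<dots> = b i t" by (simp add: sum_lessThan_telescope b0)
      finally show ?thesis .
    qed
    obtain K C where K: "banach_disk sE TE K" and C: "0 < C" "\<And>l. e i - b i l \<in> E.dil (C / 2 ^ (1 * l)) K"
      using b2[of i 1] by blast
    have bS: "b i t \<in> E.S" for t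
      using b1[of i t] E.tvs_bounded_subset_S[OF E.tvs_bounded_dil[OF E.banach_disk_bounded[OF D0]]] by blast
    have lim_e: "limitin TE (b i) (e i) sequentially"
    proof (rule E.limitin_seminormI[OF e])
      show "\<forall>\<^sub>F t in sequentially. b i t \<in> E.S" using bS by simp
      fix q assume q: "cont_seminorm sE TE q"
      note q' = E.cont_seminorm_seminorm_on[OF q]
      obtain M where M: "0 < M" "\<And>t x. 0 \<le> t \<Longrightarrow> x \<in> E.dil t K \<Longrightarrow> q x \<le> t * M"
        using E.banach_disk_dominates[OF K q] by metis
      have "(\<lambda>t. C * M * (1/2) ^ t) \<longlonglongrightarrow> C * M * 0" by (intro tendsto_mult_left LIMSEQ_power_zero) simp
      then have lim0: "(\<lambda>t. C * M * (1/2) ^ t) \<longlonglongrightarrow> 0" by simp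
      show "(\<lambda>t. q (b i t - e i)) \<longlonglongrightarrow> 0"
      proof (rule tendsto_sandwich[OF _ _ tendsto_const lim0])
        show "\<forall>\<^sub>F t in sequentially. 0 \<le> q (b i t - e i)"
          using E.seminorm_onD(1)[OF q' E.S_diff[OF bS e]] by simp
        have "q (b i t - e i) \<le> C * M * (1/2) ^ t" for t
          using M(2)[OF _ C(2), of t] C(1) E.seminorm_on_diff(3)[OF q' E.subspace_S bS e, of t i]
          by (simp add: power_divide)
        then show "\<forall>\<^sub>F t in sequentially. q (b i t - e i) \<le> C * M * (1/2) ^ t" by simp
      qed
    qed
    have "\<forall>\<^sub>F t in sequentially. b i t = (\<Sum>k\<in>{..<t} \<times> {..<t}. sE (\<xi> i (g' k)) (d k))"
      unfolding eventually_sequentially using eq by (intro exI[of _ "Suc i"]) auto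
    from limitin_transform_eventually[OF this lim_e] show ?thesis
      using E.limitin_unique lim[OF \<xi>_dual] by blast
  qed
  then show ?thesis using R by blast
qed

end

theorem theorem7p6:
  fixes J :: "'j set"
    and sG :: "complex \<Rightarrow> 'g::ab_group_add \<Rightarrow> 'g" and TG :: "'g topology"
    and sE :: "complex \<Rightarrow> 'e::ab_group_add \<Rightarrow> 'e" and TE :: "'e topology"
    and x' :: "'j \<Rightarrow> 'g \<Rightarrow> complex"
  assumes "countable J" and "infinite J"
    and "frechet sG TG" and "nuclear sG TG" and "cond_uDN sG TG"
    and "\<forall>j\<in>J. x' j \<in> dual sG TG"
    and "eidelheit TG J x'"
    and "cond_Omega sG (subtopology TG (kerQ TG J x'))"
    and "lcHs sE TE" and "locally_complete sE TE"
    and "\<exists>B. fundamental_bounded sE TE B"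
  shows "valued_eidelheit sG TG sE TE J x' \<longleftrightarrow> cond_A sE TE"
proof
  have lcsI: "lcs s T" if "lcHs s T" for s :: "complex \<Rightarrow> 'a::ab_group_add \<Rightarrow> 'a" and T
    using that by (simp add: lcs_def cvs_def lcs_axioms_def lcHs_def)
  have G: "lcs sG TG" and E: "lcs sE TE" using assms(3,9) lcsI unfolding frechet_def by blast+
  {
    assume "valued_eidelheit sG TG sE TE J x'"
    moreover have "lcs_pair sG TG sE TE" using G E by (rule lcs_pair.intro)
    ultimately show "cond_A sE TE"
      using assms(11) lcs_pair.valued_eidelheit_imp_cond_A[OF _ assms(2,6,5,10)] by blast
  next
    assume A: "cond_A sE TE"
    define \<iota> where "\<iota> = from_nat_into J"
    have \<iota>: "bij_betw \<iota> UNIV J" unfolding \<iota>_def by (rule bij_betw_from_nat_into[OF assms(1,2)])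
    have \<iota>J: "\<iota> i \<in> J" for i using \<iota> bij_betwE by blast
    define \<xi> where "\<xi> = (\<lambda>i. x' (\<iota> i))"
    obtain p0 where p0: "fundamental_seminorms sG TG p0" "\<And>n x. x \<in> topspace TG \<Longrightarrow> p0 n x \<le> p0 (Suc n) x"
      using assms(5) unfolding cond_uDN_def by blast
    \<comment> \<open>The zero seminorm is put in front as level 0, as
      \<open>cond_A_imp_solvable\<close> requires; the family stays increasing and
      fundamental.\<close>
    define p where "p = (\<lambda>n. case n of 0 \<Rightarrow> (\<lambda>x. 0) | Suc m \<Rightarrow> p0 m)"
    have "cont_seminorm sG TG (p n)" for n
      using p0(1) unfolding p_def fundamental_seminorms_def cont_seminorm_def by (cases n) auto
    moreover have "\<exists>n. \<exists>C>0. \<forall>x\<in>topspace TG. q x \<le> C * p n x" if q: "cont_seminorm sG TG q" for q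
    proof -
      obtain n where "\<exists>C>0. \<forall>x\<in>topspace TG. q x \<le> C * p0 n x"
        using p0(1) q unfolding fundamental_seminorms_def by blast
      then show ?thesis by (intro exI[of _ "Suc n"]) (simp add: p_def)
    qed
    ultimately have fund: "fundamental_seminorms sG TG p" unfolding fundamental_seminorms_def by blast
    have incr: "p n x \<le> p (Suc n) x" if "x \<in> topspace TG" for n x
      using p0 that unfolding p_def fundamental_seminorms_def cont_seminorm_def by (cases n) auto
    have surj: "\<exists>x\<in>topspace TG. \<forall>i. \<xi> i x = a i" for a
    proof -
      obtain x where "x \<in> topspace TG" "\<forall>j\<in>J. x' j x = a (inv_into UNIV \<iota> j)"
        using assms(7)[unfolded eidelheit_def, THEN spec[of _ "\<lambda>j. a (inv_into UNIV \<iota> j)"]] by blast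
      moreover have "inv_into UNIV \<iota> (\<iota> i) = i" for i
        using \<iota> by (simp add: bij_betw_def)
      ultimately show ?thesis using \<iota>J unfolding \<xi>_def by (intro bexI[of _ x]) auto
    qed
    have complete: "\<exists>l. limitin TG u l sequentially" if "tvs_Cauchy TG u" for u
      using assms(3) that unfolding frechet_def by blast
    have gf: "graded_frechet sG TG p"
      using G complete fund incr by (intro graded_frechet.intro graded_frechet_axioms.intro)
    have "\<xi> i \<in> dual sG TG" for i unfolding \<xi>_def using assms(6) \<iota>J by blast
    then have es: "eidelheit_sequence sG TG p \<xi>"
      using gf surj by (intro eidelheit_sequence.intro eidelheit_sequence_axioms.intro)
    have ep: "eidelheit_pair sG TG sE TE p \<xi>"
      using gf es E G by (intro eidelheit_pair.intro frechet_pair.intro lcs_pair.intro)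
    have "kerQ TG J x' = {x \<in> topspace TG. \<forall>i. \<xi> i x = 0}"
    proof -
      have "J = range \<iota>" using \<iota> by (simp add: bij_betw_def)
      then show ?thesis unfolding kerQ_def \<xi>_def by auto
    qed
    then have Om: "cond_Omega sG (subtopology TG {x \<in> topspace TG. \<forall>i. \<xi> i x = 0})"
      using assms(8) by simp
    show "valued_eidelheit sG TG sE TE J x'"
      unfolding valued_eidelheit_def eps_id_def
    proof (intro allI impI)
      fix e assume e: "\<forall>j\<in>J. e j \<in> topspace TE"
      have "p 0 x = 0" for x by (simp add: p_def)
      moreover have "e (\<iota> i) \<in> topspace TE" for i using e \<iota>J by blast
      ultimately obtain R where R: "R \<in> eps_product sG TG sE TE" "\<forall>i. R (\<xi> i) = e (\<iota> i)"
        using eidelheit_pair.cond_A_imp_solvable[OF ep Om _ A assms(10), of "\<lambda>i. e (\<iota> i)"] by blast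
      have "R (x' j) = e j" if "j \<in> J" for j
      proof -
        obtain i where "j = \<iota> i" using \<iota> \<open>j \<in> J\<close> unfolding bij_betw_def by blast
        then show ?thesis using R(2) by (simp add: \<xi>_def)
      qed
      then show "\<exists>R\<in>eps_product sG TG sE TE. \<forall>j\<in>J. R (x' j) = e j" using R(1) by blast
    qed
  }
qed

end
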